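(* There is an algorithm that, given a graph $G$ on $n$ vertices, a rooted branch decomposition $(T,\delta)$ of $G$ of module-width $w$, and an integer $k$, decides whether $G$ has a $b$-coloring with $k$ colors in time $n^{2^{\mathcal{O}(w)}}$.
   Context: All graphs are finite and simple. A $k$-coloring of $G$ is an ordered partition $(C_1,\ldots,C_k)$ of $V(G)$ (classes may be empty); it is proper if every $C_i$ is an independent set. A proper coloring $(C_1,\ldots,C_k)$ is a $b$-coloring if for every $i\in\{1,\ldots,k\}$ there is a vertex $v_i\in C_i$ (a $b$-vertex of color $i$) that has a neighbor in $C_j$ for every $j\neq i$. The \textsc{$b$-Coloring} problem asks, given $G$ and $k$, whether $G$ has a $b$-coloring with $k$ colors. A rooted branch decomposition of $G$ is a pair $(T,\delta)$ where $T$ is a rooted tree of maximum degree at most $3$ and $\delta$ is a bijection from $V(G)$ to the set of leaves of $T$. For a node $t$ of $T$, let $T_t$ be the subtree of $T$ rooted at $t$, $V_t=\{v\in V(G): \delta(v)\text{ is a leaf of }T_t\}$ and $\overline{V_t}=V(G)\setminus V_t$. Let $\sim_t$ be the equivalence relation on $V_t$ with $u\sim_t v$ iff $N_G(u)\cap\overline{V_t}=N_G(v)\cap\overline{V_t}$. The module-width of $(T,\delta)$ is $\max_{t\in V(T)}|V_t/{\sim_t}|$, the maximum number of equivalence classes of $\sim_t$ over all nodes $t$.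
   Formalization: The time bound has an extra summand linear in the number of nodes of T with exactly one child, since such nodes make the input size unbounded in n; it vanishes if T has none and is absorbed if T has polynomially many nodes. *)

theory Defs
  imports Main "HOL-Library.Disjoint_Sets"
begin

section \<open>Graphs and b-colorings\<close>

definition simple_graph :: "'a set \<Rightarrow> 'a set set \<Rightarrow> bool" where
  "simple_graph V E \<longleftrightarrow> finite V \<and> (\<forall>e\<in>E. e \<subseteq> V \<and> card e = 2)"

definition nbhd :: "'a set set \<Rightarrow> 'a \<Rightarrow> 'a set" where
  "nbhd E u = {v. {u, v} \<in> E}"

definition independent :: "'a set set \<Rightarrow> 'a set \<Rightarrow> bool" where
  "independent E S \<longleftrightarrow> (\<forall>u\<in>S. \<forall>v\<in>S. {u, v} \<notin> E)"

definition coloring :: "'a set \<Rightarrow> nat \<Rightarrow> (nat \<Rightarrow> 'a set) \<Rightarrow> bool" where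
  "coloring V k C \<longleftrightarrow> disjoint_family_on C {1..k} \<and> (\<Union>i\<in>{1..k}. C i) = V"

definition proper_coloring :: "'a set \<Rightarrow> 'a set set \<Rightarrow> nat \<Rightarrow> (nat \<Rightarrow> 'a set) \<Rightarrow> bool" where
  "proper_coloring V E k C \<longleftrightarrow> coloring V k C \<and> (\<forall>i\<in>{1..k}. independent E (C i))"

definition b_vertex :: "'a set set \<Rightarrow> nat \<Rightarrow> (nat \<Rightarrow> 'a set) \<Rightarrow> nat \<Rightarrow> 'a \<Rightarrow> bool" where
  "b_vertex E k C i v \<longleftrightarrow> v \<in> C i \<and> (\<forall>j\<in>{1..k}. j \<noteq> i \<longrightarrow> nbhd E v \<inter> C j \<noteq> {})"

definition b_coloring :: "'a set \<Rightarrow> 'a set set \<Rightarrow> nat \<Rightarrow> (nat \<Rightarrow> 'a set) \<Rightarrow> bool" where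
  "b_coloring V E k C \<longleftrightarrow> proper_coloring V E k C \<and> (\<forall>i\<in>{1..k}. \<exists>v. b_vertex E k C i v)"


section \<open>Rooted branch decompositions and module-width\<close>

text \<open>
  A pair of a rooted tree and a bijection \<open>\<delta>\<close> from the vertices to its leaves is
  represented by the rooted tree in which every leaf \<open>\<delta> v\<close> carries the label \<open>v\<close>.
  A node is represented by the subtree below it.  Leaves are the nodes without children;
  \<open>Node []\<close> would be a leaf that is not in the range of \<open>\<delta>\<close>, so it is excluded in
  \<open>rooted_branch_decomposition\<close>.
\<close>

datatype 'a rtree = Leaf 'a | Node "'a rtree list"

fun children :: "'a rtree \<Rightarrow> 'a rtree list" where
  "children (Leaf v) = []"
| "children (Node ts) = ts"

fun subtrees :: "'a rtree \<Rightarrow> 'a rtree set" where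
  "subtrees (Leaf v) = {Leaf v}"
| "subtrees (Node ts) = insert (Node ts) (\<Union>t\<in>set ts. subtrees t)"

fun leaf_labels :: "'a rtree \<Rightarrow> 'a list" where
  "leaf_labels (Leaf v) = [v]"
| "leaf_labels (Node ts) = concat (map leaf_labels ts)"

text \<open>
  The degree of the root is its number of children, the degree of any other node is one more
  than its number of children.
\<close>

definition max_degree_le_3 :: "'a rtree \<Rightarrow> bool" where
  "max_degree_le_3 T \<longleftrightarrow> length (children T) \<le> 3 \<and>
     (\<forall>s\<in>set (children T). \<forall>t\<in>subtrees s. Suc (length (children t)) \<le> 3)"

definition rooted_branch_decomposition :: "'a set \<Rightarrow> 'a rtree \<Rightarrow> bool" where
  "rooted_branch_decomposition V T \<longleftrightarrow>
     max_degree_le_3 T \<and> Node [] \<notin> subtrees T \<and>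
     distinct (leaf_labels T) \<and> set (leaf_labels T) = V"

definition module_equiv :: "'a set \<Rightarrow> 'a set set \<Rightarrow> 'a set \<Rightarrow> ('a \<times> 'a) set" where
  "module_equiv V E A =
     {(u, v). u \<in> A \<and> v \<in> A \<and> nbhd E u \<inter> (V - A) = nbhd E v \<inter> (V - A)}"

definition module_width :: "'a set \<Rightarrow> 'a set set \<Rightarrow> 'a rtree \<Rightarrow> nat" where
  "module_width V E T =
     Max ((\<lambda>t. card (set (leaf_labels t) // module_equiv V E (set (leaf_labels t)))) ` subtrees T)"

text \<open>
  The number of nodes with exactly one child.  Maximum degree 3 allows arbitrarily many of
  them, so the number of nodes is not bounded in terms of the number \<open>n\<close> of leaves; it is
  at most \<open>2 * n + num_unary T\<close>.  Time bounds therefore need a summand for reading these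
  nodes, which vanishes if every node that is not a leaf branches.
\<close>

fun num_unary :: "'a rtree \<Rightarrow> nat" where
  "num_unary (Leaf v) = 0"
| "num_unary (Node ts) = (if length ts = 1 then 1 else 0) + sum_list (map num_unary ts)"


section \<open>Model of computation\<close>

text \<open>
  Programs of a first-order functional language over binary trees, in the style of the
  languages WHILE and F of N. D. Jones (Computability and Complexity from a Programming
  Perspective): finite lists of possibly mutually recursive functions, called by value.
  The only operations on data are construction, selection and the test for \<open>Nl\<close>.
  The running time is the number of evaluation steps; every step takes constant time on a
  pointer machine, since values can be shared and environments have an arity fixed by the
  program.  The model is polynomially equivalent to Turing machines.
\<close>

datatype val = Nl | Pair val val

fun val_fst :: "val \<Rightarrow> val" where
  "val_fst Nl = Nl"
| "val_fst (Pair x y) = x"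

fun val_snd :: "val \<Rightarrow> val" where
  "val_snd Nl = Nl"
| "val_snd (Pair x y) = y"

datatype expr =
    Var nat
  | ENl
  | EPair expr expr
  | EFst expr
  | ESnd expr
  | EIf expr expr expr
  | ECall nat "expr list"

type_synonym prog = "expr list"

inductive
  eval :: "prog \<Rightarrow> val list \<Rightarrow> expr \<Rightarrow> val \<Rightarrow> nat \<Rightarrow> bool" and
  evals :: "prog \<Rightarrow> val list \<Rightarrow> expr list \<Rightarrow> val list \<Rightarrow> nat \<Rightarrow> bool"
  for P :: prog
where
  Var: "i < length env \<Longrightarrow> eval P env (Var i) (env ! i) 1"
| Nl: "eval P env ENl Nl 1"
| Pair: "eval P env e1 v1 t1 \<Longrightarrow> eval P env e2 v2 t2 \<Longrightarrow>
    eval P env (EPair e1 e2) (Pair v1 v2) (t1 + t2 + 1)"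
| Fst: "eval P env e v t \<Longrightarrow> eval P env (EFst e) (val_fst v) (t + 1)"
| Snd: "eval P env e v t \<Longrightarrow> eval P env (ESnd e) (val_snd v) (t + 1)"
| If_true: "eval P env e v t \<Longrightarrow> v \<noteq> Nl \<Longrightarrow> eval P env e1 v1 t1 \<Longrightarrow>
    eval P env (EIf e e1 e2) v1 (t + t1 + 1)"
| If_false: "eval P env e Nl t \<Longrightarrow> eval P env e2 v2 t2 \<Longrightarrow>
    eval P env (EIf e e1 e2) v2 (t + t2 + 1)"
| Call: "evals P env es vs s \<Longrightarrow> f < length P \<Longrightarrow> eval P vs (P ! f) v t \<Longrightarrow>
    eval P env (ECall f es) v (s + t + 1)"
| Nil: "evals P env [] [] 0"
| Cons: "eval P env e v t \<Longrightarrow> evals P env es vs s \<Longrightarrow>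
    evals P env (e # es) (v # vs) (t + s)"

inductive_cases eval_VarE: "eval P env (Var i) v t"
inductive_cases eval_NlE: "eval P env ENl v t"
inductive_cases eval_PairE: "eval P env (EPair e1 e2) v t"
inductive_cases eval_FstE: "eval P env (EFst e) v t"
inductive_cases eval_SndE: "eval P env (ESnd e) v t"
inductive_cases eval_IfE: "eval P env (EIf e e1 e2) v t"
inductive_cases eval_CallE: "eval P env (ECall f es) v t"
inductive_cases evals_NilE: "evals P env [] vs t"
inductive_cases evals_ConsE: "evals P env (e # es) vs t"

lemma eval_deterministic:
  "eval P env e v t \<Longrightarrow> eval P env e v' t' \<Longrightarrow> v' = v \<and> t' = t"
  "evals P env es vs s \<Longrightarrow> evals P env es vs' s' \<Longrightarrow> vs' = vs \<and> s' = s"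
proof (induction arbitrary: v' t' and vs' s' rule: eval_evals.inducts)
  case Var
  from Var.prems show ?case by (rule eval_VarE) simp_all
next
  case Nl
  from Nl.prems show ?case by (rule eval_NlE) simp_all
next
  case Pair
  from Pair.prems show ?case by (rule eval_PairE) (metis Pair.IH Suc_eq_plus1)+
next
  case Fst
  from Fst.prems show ?case by (rule eval_FstE) (metis Fst.IH Suc_eq_plus1)+
next
  case Snd
  from Snd.prems show ?case by (rule eval_SndE) (metis Snd.IH Suc_eq_plus1)+
next
  case If_true
  from If_true.prems show ?case by (rule eval_IfE) (metis If_true.IH If_true.hyps Suc_eq_plus1)+
next
  case If_false
  from If_false.prems show ?case by (rule eval_IfE) (metis If_false.IH Suc_eq_plus1)+
next
  case Call
  from Call.prems show ?case by (rule eval_CallE) (metis Call.IH Suc_eq_plus1)+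
next
  case Nil
  from Nil.prems show ?case by (rule evals_NilE) simp_all
next
  case Cons
  from Cons.prems show ?case by (rule evals_ConsE) (metis Cons.IH Suc_eq_plus1)+
qed

text \<open>The first function of a program is its main function.\<close>

definition runs :: "prog \<Rightarrow> val \<Rightarrow> val \<Rightarrow> nat \<Rightarrow> bool" where
  "runs P inp out t \<longleftrightarrow> P \<noteq> [] \<and> eval P [inp] (P ! 0) out t"


section \<open>Encoding of instances\<close>

definition enc_bool :: "bool \<Rightarrow> val" where
  "enc_bool b = (if b then Pair Nl Nl else Nl)"

fun enc_list :: "val list \<Rightarrow> val" where
  "enc_list [] = Nl"
| "enc_list (x # xs) = Pair x (enc_list xs)"

text \<open>Binary, least significant bit first, without leading zeros.\<close>

fun enc_nat :: "nat \<Rightarrow> val" where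
  "enc_nat n = (if n = 0 then Nl else Pair (enc_bool (odd n)) (enc_nat (n div 2)))"

declare enc_nat.simps [simp del]

definition enc_graph :: "nat \<Rightarrow> nat set set \<Rightarrow> val" where
  "enc_graph n E =
     enc_list (map (\<lambda>i. enc_list (map (\<lambda>j. enc_bool ({i, j} \<in> E)) [0..<n])) [0..<n])"

fun enc_tree :: "nat rtree \<Rightarrow> val" where
  "enc_tree (Leaf v) = Pair (enc_bool False) (enc_nat v)"
| "enc_tree (Node ts) = Pair (enc_bool True) (enc_list (map enc_tree ts))"

definition enc_instance :: "nat \<Rightarrow> nat set set \<Rightarrow> nat rtree \<Rightarrow> nat \<Rightarrow> val" where
  "enc_instance n E T k = Pair (enc_graph n E) (Pair (enc_tree T) (enc_nat k))"

end

theory Submission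
  imports Defs "HOL-Library.Multiset" "HOL-Library.FuncSet" "HOL-Combinatorics.Permutations"
begin

text \<open>
  Dynamic programming over the decomposition tree.  Fix a proper partial coloring \<open>f\<close> of \<open>A = V\<^sub>t\<close>
  and a set \<open>D\<close> of chosen b-vertices.  The type of a color \<open>j\<close> consists of the set of
  \<open>\<sim>\<^sub>t\<close>-classes met by \<open>j\<close>, one bit telling whether the b-vertex of \<open>j\<close> lies in \<open>D\<close>, and the set of
  classes of those vertices of \<open>D\<close> of another color that still lack a neighbor of color \<open>j\<close>.  All
  vertices of a class have the same neighbors outside \<open>A\<close>, so it does not matter which vertex of the
  class still needs \<open>j\<close>.  Up to renaming the colors, a state is a multiset of \<open>k\<close> types; there are
  \<open>2^O(w)\<close> types and therefore \<open>n^(2^O(w))\<close> states.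

  For the running time, \<open>implT F T\<close> says that some program computes \<open>F\<close> in time \<open>T\<close>, and \<open>fpr R F\<close> that
  time and output size are at most a fixed power of \<open>m\<close> on all inputs \<open>x\<close> with \<open>R x m\<close>.  Both are closed
  under composition, branching and recursion, which spares us any concrete program.
\<close>

section \<open>Computable functions with running times\<close>

text \<open>Merging two states has to consider all pairings of their colors, and there are
  \<open>k!\<close> of these. The pairing is therefore built one color at a time, and partial
  pairings are identified as soon as they agree, up to order, in the used types of the second state
  and in the combined types: the continuation depends on nothing else.

  The obstacle for the time analysis is that programs also run on values that encode nothing, where
  the tables may outgrow every polynomial. Hence all bounds are relative to a precondition
  \<open>R x m\<close>. It carries the sizes of intermediate tables through loops and recursion as a
  mere assumption, until the correctness of the tables on genuine instances supplies it, with a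
  power of \<open>(n + 2) ^ 2 ^ (2 * w + 2)\<close> as \<open>m\<close>.

  The input itself is not polynomial in \<open>n\<close>: \<open>k\<close> is arbitrary and unary
  nodes are unlimited. A linear preprocessing deals with both before anything polynomial is run, so
  \<open>num_unary T\<close> enters the time only as a summand.\<close>

lemma eval_append:
  "eval P env e v t \<Longrightarrow> eval (P @ Q) env e v t"
  "evals P env es vs s \<Longrightarrow> evals (P @ Q) env es vs s"
  by (induction rule: eval_evals.inducts) (auto intro: eval_evals.intros[simplified] simp: nth_append)

fun shift :: "nat \<Rightarrow> expr \<Rightarrow> expr" where
  "shift k (Var i) = Var i"
| "shift k ENl = ENl"
| "shift k (EPair a b) = EPair (shift k a) (shift k b)"
| "shift k (EFst a) = EFst (shift k a)"
| "shift k (ESnd a) = ESnd (shift k a)"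
| "shift k (EIf a b c) = EIf (shift k a) (shift k b) (shift k c)"
| "shift k (ECall f es) = ECall (k + f) (map (shift k) es)"

text \<open>Linking: behind a prefix \<open>Q\<close> the functions of \<open>P\<close> sit
  \<open>length Q\<close> places further on, so renumbering the calls preserves values and
  times.\<close>

lemma eval_shift:
  "eval P env e v t \<Longrightarrow> eval (Q @ map (shift (length Q)) P) env (shift (length Q) e) v t"
  "evals P env es vs s \<Longrightarrow>
    evals (Q @ map (shift (length Q)) P) env (map (shift (length Q)) es) vs s"
  by (induction rule: eval_evals.inducts) (auto intro: eval_evals.intros[simplified] simp: nth_append)

text \<open>The bound \<open>T\<close> holds on all values, so even inputs that encode nothing must
  be processed; restrictions on the input only enter through \<open>pb\<close>.\<close>

definition implT :: "(val \<Rightarrow> val) \<Rightarrow> (val \<Rightarrow> nat) \<Rightarrow> bool" where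
  "implT F T \<longleftrightarrow> (\<exists>P e. \<forall>x. \<exists>t\<le>T x. eval P [x] e (F x) t)"

text \<open>A call needs a function index and not an expression. Programs are combined by bringing
  them into this form inside one common program.\<close>

definition computes :: "prog \<Rightarrow> nat \<Rightarrow> (val \<Rightarrow> val) \<Rightarrow> (val \<Rightarrow> nat) \<Rightarrow> bool" where
  "computes P f F T \<longleftrightarrow> f < length P \<and> (\<forall>x. \<exists>t\<le>T x. eval P [x] (P ! f) (F x) t)"

lemma computes_append: "computes P f F T \<Longrightarrow> computes (P @ Q) f F T"
  unfolding computes_def by (auto simp: nth_append) (meson eval_append(1))

lemma computes_link:
  assumes "implT F T"
  shows "\<exists>Q f. computes (P @ Q) f F T"
proof -
  obtain P' e where *: "\<And>x. \<exists>t\<le>T x. eval P' [x] e (F x) t"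
    using assms unfolding implT_def by blast
  let ?s = "shift (length P)"
  have "computes (P @ map ?s P' @ [?s e]) (length P + length P') F T"
    unfolding computes_def
  proof (intro conjI allI)
    fix x
    obtain t where t: "t \<le> T x" "eval P' [x] e (F x) t" using * by blast
    have "eval ((P @ map ?s P') @ [?s e]) [x] (?s e) (F x) t"
      by (intro eval_append(1) eval_shift(1) t)
    then show "\<exists>t\<le>T x. eval (P @ map ?s P' @ [?s e]) [x]
        ((P @ map ?s P' @ [?s e]) ! (length P + length P')) (F x) t"
      using t(1) by (auto simp: nth_append)
  qed simp
  then show ?thesis by blast
qed

lemma implT_link1:
  assumes "implT F T"
  obtains P f where "computes P f F T"
  using computes_link[OF assms, of "[]"] by auto

lemma implT_link2:
  assumes "implT F T" "implT G S"
  obtains P f g where "computes P f F T" "computes P g G S"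
  using computes_link[OF assms(2)] computes_append implT_link1[OF assms(1)] by metis

lemma implT_link3:
  assumes "implT F T" "implT G S" "implT H U"
  obtains P f g h where "computes P f F T" "computes P g G S" "computes P h H U"
  using computes_link[OF assms(3)] computes_append implT_link2[OF assms(1,2)] by metis

lemma eval_call1:
  assumes "computes P f F T" "eval P env e y s"
  shows "\<exists>t\<le>s + T y + 1. eval P env (ECall f [e]) (F y) t"
proof -
  obtain t where t: "t \<le> T y" "eval P [y] (P ! f) (F y) t" "f < length P"
    using assms(1) unfolding computes_def by blast
  have "evals P env [e] [y] (s + 0)" by (intro eval_evals.intros assms)
  from eval_evals.Call[OF this t(3,2)] have "eval P env (ECall f [e]) (F y) (s + 0 + t + 1)" .
  with t(1) show ?thesis by (intro exI[of _ "s + 0 + t + 1"]) simp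
qed

section \<open>Closure under composition, pairing, selection and branching\<close>

lemma implT_mono: "implT F T \<Longrightarrow> (\<And>x. T x \<le> S x) \<Longrightarrow> implT F S"
  unfolding implT_def by (meson order_trans)

lemma eval_Var0: "eval P (x # env) (Var 0) x 1"
  using eval_evals.Var[of 0 "x # env"] by simp

lemma implT_id: "implT (\<lambda>x. x) (\<lambda>x. 1)"
  unfolding implT_def by (blast intro: eval_Var0)

lemma implT_Nl: "implT (\<lambda>x. Nl) (\<lambda>x. 1)"
  unfolding implT_def by (blast intro: eval_evals.Nl)

lemma implT_comp:
  assumes "implT F T" "implT G S"
  shows "implT (\<lambda>x. F (G x)) (\<lambda>x. S x + T (G x) + 3)"
proof -
  obtain P f g where c: "computes P f F T" "computes P g G S"
    using implT_link2[OF assms] .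
  have "\<exists>t\<le>S x + T (G x) + 3. eval P [x] (ECall f [ECall g [Var 0]]) (F (G x)) t" for x
  proof -
    obtain t where t: "t \<le> 1 + S x + 1" "eval P [x] (ECall g [Var 0]) (G x) t"
      using eval_call1[OF c(2) eval_Var0] by blast
    obtain t' where "t' \<le> t + T (G x) + 1" "eval P [x] (ECall f [ECall g [Var 0]]) (F (G x)) t'"
      using eval_call1[OF c(1) t(2)] by blast
    with t(1) show ?thesis by (intro exI[of _ t']) simp
  qed
  then show ?thesis unfolding implT_def by blast
qed

lemma implT_Pair:
  assumes "implT F T" "implT G S"
  shows "implT (\<lambda>x. Pair (F x) (G x)) (\<lambda>x. T x + S x + 5)"
proof -
  obtain P f g where c: "computes P f F T" "computes P g G S"
    using implT_link2[OF assms] .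
  have "\<exists>t\<le>T x + S x + 5. eval P [x] (EPair (ECall f [Var 0]) (ECall g [Var 0])) (Pair (F x) (G x)) t" for x
  proof -
    obtain t where t: "t \<le> 1 + T x + 1" "eval P [x] (ECall f [Var 0]) (F x) t"
      using eval_call1[OF c(1) eval_Var0] by blast
    obtain t' where t': "t' \<le> 1 + S x + 1" "eval P [x] (ECall g [Var 0]) (G x) t'"
      using eval_call1[OF c(2) eval_Var0] by blast
    from eval_evals.Pair[OF t(2) t'(2)] t(1) t'(1) show ?thesis
      by (intro exI[of _ "t + t' + 1"]) simp
  qed
  then show ?thesis unfolding implT_def by blast
qed

lemma implT_fst:
  assumes "implT F T"
  shows "implT (\<lambda>x. val_fst (F x)) (\<lambda>x. T x + 1)"
proof -
  obtain P e where *: "\<And>x. \<exists>t\<le>T x. eval P [x] e (F x) t"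
    using assms unfolding implT_def by blast
  have "\<exists>t\<le>T x + 1. eval P [x] (EFst e) (val_fst (F x)) t" for x
    using *[of x] eval_evals.Fst by (metis add_le_cancel_right)
  then show ?thesis unfolding implT_def by blast
qed

lemma implT_snd:
  assumes "implT F T"
  shows "implT (\<lambda>x. val_snd (F x)) (\<lambda>x. T x + 1)"
proof -
  obtain P e where *: "\<And>x. \<exists>t\<le>T x. eval P [x] e (F x) t"
    using assms unfolding implT_def by blast
  have "\<exists>t\<le>T x + 1. eval P [x] (ESnd e) (val_snd (F x)) t" for x
    using *[of x] eval_evals.Snd by (metis add_le_cancel_right)
  then show ?thesis unfolding implT_def by blast
qed

lemma eval_If_le:
  assumes "eval P env e v t" "v \<noteq> Nl \<Longrightarrow> \<exists>t1\<le>a. eval P env e1 r t1"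
    "v = Nl \<Longrightarrow> \<exists>t1\<le>a. eval P env e2 r t1" "t \<le> b"
  shows "\<exists>t\<le>a + b + 1. eval P env (EIf e e1 e2) r t"
proof (cases "v = Nl")
  case True
  then obtain t1 where "t1 \<le> a" "eval P env e2 r t1" using assms by blast
  with True assms(1,4) eval_evals.If_false[of P env e t e2 r t1 e1] show ?thesis
    by (intro exI[of _ "t + t1 + 1"]) auto
next
  case False
  then obtain t1 where "t1 \<le> a" "eval P env e1 r t1" using assms by blast
  with False assms(1,4) eval_evals.If_true[of P env e v t e1 r t1 e2] show ?thesis
    by (intro exI[of _ "t + t1 + 1"]) auto
qed

lemma implT_If:
  assumes "implT C U" "implT F T" "implT G S"
  shows "implT (\<lambda>x. if C x \<noteq> Nl then F x else G x) (\<lambda>x. U x + T x + S x + 5)"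
proof -
  obtain P c f g where c: "computes P c C U" "computes P f F T" "computes P g G S"
    using implT_link3[OF assms] .
  have "\<exists>t\<le>U x + T x + S x + 5. eval P [x] (EIf (ECall c [Var 0]) (ECall f [Var 0]) (ECall g [Var 0]))
     (if C x \<noteq> Nl then F x else G x) t" for x
  proof -
    obtain t where t: "t \<le> 1 + U x + 1" "eval P [x] (ECall c [Var 0]) (C x) t"
      using eval_call1[OF c(1) eval_Var0] by blast
    obtain t1 where t1: "t1 \<le> 1 + T x + 1" "eval P [x] (ECall f [Var 0]) (F x) t1"
      using eval_call1[OF c(2) eval_Var0] by blast
    obtain t2 where t2: "t2 \<le> 1 + S x + 1" "eval P [x] (ECall g [Var 0]) (G x) t2"
      using eval_call1[OF c(3) eval_Var0] by blast
    have "\<exists>t\<le>(T x + S x + 2) + (U x + 2) + 1. eval P [x] (EIf (ECall c [Var 0]) (ECall f [Var 0]) (ECall g [Var 0]))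
     (if C x \<noteq> Nl then F x else G x) t"
    proof (rule eval_If_le[OF t(2)])
      show "\<exists>t1\<le>T x + S x + 2. eval P [x] (ECall f [Var 0]) (if C x \<noteq> Nl then F x else G x) t1"
        if "C x \<noteq> Nl" using that t1 by (intro exI[of _ t1]) simp
      show "\<exists>t1\<le>T x + S x + 2. eval P [x] (ECall g [Var 0]) (if C x \<noteq> Nl then F x else G x) t1"
        if "C x = Nl" using that t2 by (intro exI[of _ t2]) simp
    qed (use t in simp)
    then show ?thesis by (rule ex_forward) auto
  qed
  then show ?thesis unfolding implT_def by blast
qed

section \<open>Lists, folds and the equality test\<close>

abbreviation fst_snd :: "val \<Rightarrow> val" where "fst_snd x \<equiv> val_fst (val_snd x)"
abbreviation snd_snd :: "val \<Rightarrow> val" where "snd_snd x \<equiv> val_snd (val_snd x)"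

text \<open>Every value is the encoding of exactly one list; \<open>lst\<close> decodes it.\<close>

fun lst :: "val \<Rightarrow> val list" where
  "lst Nl = []"
| "lst (Pair a b) = a # lst b"

lemma lst_enc_list [simp]: "lst (enc_list xs) = xs"
  by (induction xs) auto

lemma enc_list_lst [simp]: "enc_list (lst x) = x"
  by (induction x) auto

lemma enc_list_eq_iff [simp]: "enc_list xs = enc_list ys \<longleftrightarrow> xs = ys"
  by (metis lst_enc_list)

lemma enc_list_eq_Nl [simp]: "enc_list xs = Nl \<longleftrightarrow> xs = []"
  using enc_list_eq_iff[of xs "[]"] by simp

lemma lst_eq_Nil [simp]: "lst x = [] \<longleftrightarrow> x = Nl"
  by (cases x) auto

lemma length_lst_le: "length (lst x) \<le> size x"
  by (induction x) auto

lemma size_mem_lst: "a \<in> set (lst x) \<Longrightarrow> size a < size x"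
  by (induction x) auto

lemma size_enc_list: "size (enc_list xs) = length xs + sum_list (map size xs)"
  by (induction xs) auto

lemma size_enc_list_le: "(\<And>x. x \<in> set xs \<Longrightarrow> size x \<le> b) \<Longrightarrow> length xs \<le> l \<Longrightarrow>
  size (enc_list xs) \<le> l * (b + 1)"
proof (induction xs arbitrary: l)
  case (Cons a xs)
  then obtain l' where "l = Suc l'" by (cases l) auto
  moreover have "size (enc_list xs) \<le> l' * (b + 1)" "size a \<le> b" using Cons calculation by auto
  ultimately show ?case by simp
qed simp

text \<open>The 20 steps per element cover the calls, selections and pairs around the body. The body
  is timed on the partial results that \<open>foldr\<close> produces from the right.\<close>

fun fold_time :: "(val \<Rightarrow> nat) \<Rightarrow> (val \<Rightarrow> val \<Rightarrow> val) \<Rightarrow> val \<Rightarrow> val \<Rightarrow> val list \<Rightarrow> nat" where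
  "fold_time TG G h x [] = 0"
| "fold_time TG G h x (a # as) = 20 + fold_time TG G h x as + TG (Pair a (Pair (foldr G as h) x))"

lemma fold_time_le:
  assumes "\<And>ys a zs. xs = ys @ a # zs \<Longrightarrow> TG (Pair a (Pair (foldr G zs h) x)) \<le> b"
  shows "fold_time TG G h x xs \<le> length xs * (b + 20)"
  using assms
proof (induction xs)
  case (Cons a as)
  have "fold_time TG G h x as \<le> length as * (b + 20)"
    by (rule Cons.IH) (use Cons.prems in \<open>metis append_Cons\<close>)
  moreover have "TG (Pair a (Pair (foldr G as h) x)) \<le> b" using Cons.prems[of "[]"] by simp
  ultimately show ?case by simp
qed simp

text \<open>The language has no closures, so the body receives the element, the accumulator and the
  whole input \<open>x\<close>. The loop becomes a new last function of the program that calls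
  itself on the tail of the list.\<close>

lemma implT_foldr:
  assumes "implT L TL" "implT H TH"
    and "implT (\<lambda>y. G (val_fst y) (fst_snd y) (snd_snd y)) TG"
  shows "implT (\<lambda>x. foldr (\<lambda>a r. G a r x) (lst (L x)) (H x))
    (\<lambda>x. TL x + TH x + 20 + fold_time TG (\<lambda>a r. G a r x) (H x) x (lst (L x)))"
proof -
  let ?G = "\<lambda>y. G (val_fst y) (fst_snd y) (snd_snd y)"
  obtain P0 l h g where c0: "computes P0 l L TL" "computes P0 h H TH" "computes P0 g ?G TG"
    using implT_link3[OF assms] .
  define f where "f = length P0"
  define body where "body = EIf (EFst (Var 0))
      (ECall g [EPair (EFst (EFst (Var 0))) (EPair (ECall f [EPair (ESnd (EFst (Var 0))) (ESnd (Var 0))]) (ESnd (Var 0)))])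
      (ECall h [ESnd (Var 0)])"
  define P where "P = P0 @ [body]"
  have c: "computes P l L TL" "computes P h H TH" "computes P g ?G TG"
    unfolding P_def by (intro computes_append c0)+
  have Pf: "P ! f = body" "f < length P" unfolding P_def f_def by auto
  have main: "\<exists>t\<le>TH x + 10 + fold_time TG (\<lambda>a r. G a r x) (H x) x (lst y).
      eval P [Pair y x] body (foldr (\<lambda>a r. G a r x) (lst y) (H x)) t" for x y
  proof (induction y)
    case Nl
    have s: "eval P [Pair Nl x] (ESnd (Var 0)) x (1 + 1)"
      using eval_evals.Snd[OF eval_Var0[of P "Pair Nl x" "[]"]] by simp
    have fs: "eval P [Pair Nl x] (EFst (Var 0)) Nl (1 + 1)"
      using eval_evals.Fst[OF eval_Var0[of P "Pair Nl x" "[]"]] by simp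
    obtain t where t: "t \<le> 1 + 1 + TH x + 1" "eval P [Pair Nl x] (ECall h [ESnd (Var 0)]) (H x) t"
      using eval_call1[OF c(2) s] by blast
    from eval_evals.If_false[OF fs t(2)] t(1) show ?case unfolding body_def
      by (intro exI[of _ "1 + 1 + t + 1"]) simp
  next
    case (Pair a y)
    let ?z = "Pair (Pair a y) x"
    let ?r = "foldr (\<lambda>a r. G a r x) (lst y) (H x)"
    let ?ft = "fold_time TG (\<lambda>a r. G a r x) (H x) x (lst y)"
    have v: "eval P [?z] (Var 0) ?z 1" by (rule eval_Var0)
    have s: "eval P [?z] (ESnd (Var 0)) x (1 + 1)" using eval_evals.Snd[OF v] by simp
    have fs: "eval P [?z] (EFst (Var 0)) (Pair a y) (1 + 1)" using eval_evals.Fst[OF v] by simp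
    have ffs: "eval P [?z] (EFst (EFst (Var 0))) a (1 + 1 + 1)" using eval_evals.Fst[OF fs] by simp
    have sfs: "eval P [?z] (ESnd (EFst (Var 0))) y (1 + 1 + 1)" using eval_evals.Snd[OF fs] by simp
    obtain t where t: "t \<le> TH x + 10 + ?ft" "eval P [Pair y x] body ?r t" using Pair.IH by blast
    have "evals P [?z] [EPair (ESnd (EFst (Var 0))) (ESnd (Var 0))] [Pair y x] (6 + 0)"
      using eval_evals.Cons[OF eval_evals.Pair[OF sfs s] eval_evals.Nil] by (simp add: eval_nat_numeral)
    from eval_evals.Call[OF this Pf(2)] t(2)
    have "eval P [?z] (ECall f [EPair (ESnd (EFst (Var 0))) (ESnd (Var 0))]) ?r (6 + 0 + t + 1)"
      by (simp add: Pf)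
    from eval_evals.Pair[OF ffs eval_evals.Pair[OF this s]]
    have "eval P [?z] (EPair (EFst (EFst (Var 0))) (EPair (ECall f [EPair (ESnd (EFst (Var 0))) (ESnd (Var 0))]) (ESnd (Var 0))))
        (Pair a (Pair ?r x)) (t + 14)" by (simp add: algebra_simps)
    from eval_call1[OF c(3) this] obtain t' where
      t': "t' \<le> t + 14 + TG (Pair a (Pair ?r x)) + 1"
      "eval P [?z] (ECall g [EPair (EFst (EFst (Var 0))) (EPair (ECall f [EPair (ESnd (EFst (Var 0))) (ESnd (Var 0))]) (ESnd (Var 0)))]) (G a ?r x) t'"
      by auto
    from eval_evals.If_true[OF fs _ t'(2)] t'(1) t(1) show ?case unfolding body_def
      by (intro exI[of _ "1 + 1 + t' + 1"]) simp
  qed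
  have "\<exists>t\<le>TL x + TH x + 20 + fold_time TG (\<lambda>a r. G a r x) (H x) x (lst (L x)).
     eval P [x] (ECall f [EPair (ECall l [Var 0]) (Var 0)]) (foldr (\<lambda>a r. G a r x) (lst (L x)) (H x)) t" for x
  proof -
    obtain t where t: "t \<le> 1 + TL x + 1" "eval P [x] (ECall l [Var 0]) (L x) t"
      using eval_call1[OF c(1) eval_Var0] by blast
    obtain t' where t': "t' \<le> TH x + 10 + fold_time TG (\<lambda>a r. G a r x) (H x) x (lst (L x))"
      "eval P [Pair (L x) x] body (foldr (\<lambda>a r. G a r x) (lst (L x)) (H x)) t'" using main by blast
    from eval_evals.Call[OF eval_evals.Cons[OF eval_evals.Pair[OF t(2) eval_Var0] eval_evals.Nil] Pf(2)] t'(2)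
    have "eval P [x] (ECall f [EPair (ECall l [Var 0]) (Var 0)]) (foldr (\<lambda>a r. G a r x) (lst (L x)) (H x))
      (t + 1 + 1 + 0 + t' + 1)" by (simp add: Pf)
    with t(1) t'(1) show ?thesis by (intro exI[of _ "t + 1 + 1 + 0 + t' + 1"]) simp
  qed
  then show ?thesis unfolding implT_def by blast
qed

text \<open>Equality is not primitive. The descent follows the first argument, which alone bounds
  the time, however large the second one is.\<close>

lemma implT_eq_pair:
  "implT (\<lambda>y. enc_bool (val_fst y = val_snd y)) (\<lambda>y. 50 * size (val_fst y) + 50)"
proof -
  define a where "a = EFst (Var 0)"
  define b where "b = ESnd (Var 0)"
  define c1 where "c1 = ECall 0 [EPair (EFst a) (EFst b)]"
  define c2 where "c2 = ECall 0 [EPair (ESnd a) (ESnd b)]"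
  define tt where "tt = EPair ENl ENl"
  define body where "body = EIf a (EIf b (EIf c1 c2 ENl) ENl) (EIf b ENl tt)"
  have "\<exists>t\<le>50 * size x + 20. eval [body] [Pair x y] body (enc_bool (x = y)) t" for x y
  proof (induction x arbitrary: y)
    case Nl
    let ?P = "[body]" let ?e = "[Pair Nl y]"
    have a: "eval ?P ?e a Nl (1 + 1)" unfolding a_def using eval_evals.Fst[OF eval_Var0[of ?P "Pair Nl y" "[]"]] by simp
    have b: "eval ?P ?e b y (1 + 1)" unfolding b_def using eval_evals.Snd[OF eval_Var0[of ?P "Pair Nl y" "[]"]] by simp
    have "\<exists>t\<le>3 + 2 + 1. eval ?P ?e (EIf b ENl tt) (enc_bool (Nl = y)) t"
    proof (rule eval_If_le[OF b])
      show "\<exists>t1\<le>3. eval ?P ?e ENl (enc_bool (Nl = y)) t1" if "y \<noteq> Nl"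
        using that by (intro exI[of _ 1]) (auto simp: enc_bool_def intro: eval_evals.intros[simplified])
      show "\<exists>t1\<le>3. eval ?P ?e tt (enc_bool (Nl = y)) t1" if "y = Nl"
        using that eval_evals.Pair[OF eval_evals.Nl eval_evals.Nl, of ?P ?e] unfolding tt_def
        by (intro exI[of _ 3]) (auto simp: enc_bool_def eval_nat_numeral)
    qed simp
    then obtain t where t: "t \<le> 6" "eval ?P ?e (EIf b ENl tt) (enc_bool (Nl = y)) t" by auto
    then show ?case unfolding body_def
      using eval_evals.If_false[OF a t(2)] by (intro exI[of _ "1 + 1 + t + 1"]) (auto simp: body_def)
  next
    case (Pair x1 x2)
    let ?x = "Pair x1 x2"
    let ?P = "[body]" let ?e = "[Pair ?x y]"
    have a: "eval ?P ?e a ?x (1 + 1)" unfolding a_def using eval_evals.Fst[OF eval_Var0[of ?P "Pair ?x y" "[]"]] by simp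
    have b: "eval ?P ?e b y (1 + 1)" unfolding b_def using eval_evals.Snd[OF eval_Var0[of ?P "Pair ?x y" "[]"]] by simp
    \<comment> \<open>Selectors are total, so the induction hypotheses apply before \<open>y\<close>
      is known to be a pair.\<close>
    obtain t1 where t1: "t1 \<le> 50 * size x1 + 20"
      "eval ?P [Pair x1 (val_fst y)] body (enc_bool (x1 = val_fst y)) t1" using Pair.IH(1) by blast
    obtain t2 where t2: "t2 \<le> 50 * size x2 + 20"
      "eval ?P [Pair x2 (val_snd y)] body (enc_bool (x2 = val_snd y)) t2" using Pair.IH(2) by blast
    have p1: "eval ?P ?e (EPair (EFst a) (EFst b)) (Pair x1 (val_fst y)) 7"
      using eval_evals.Pair[OF eval_evals.Fst[OF a] eval_evals.Fst[OF b]] by (simp add: eval_nat_numeral)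
    have p2: "eval ?P ?e (EPair (ESnd a) (ESnd b)) (Pair x2 (val_snd y)) 7"
      using eval_evals.Pair[OF eval_evals.Snd[OF a] eval_evals.Snd[OF b]] by (simp add: eval_nat_numeral)
    have c1: "eval ?P ?e c1 (enc_bool (x1 = val_fst y)) (7 + 0 + t1 + 1)" unfolding c1_def
      by (rule eval_evals.Call[OF eval_evals.Cons[OF p1 eval_evals.Nil]]) (use t1 in auto)
    have c2: "eval ?P ?e c2 (enc_bool (x2 = val_snd y)) (7 + 0 + t2 + 1)" unfolding c2_def
      by (rule eval_evals.Call[OF eval_evals.Cons[OF p2 eval_evals.Nil]]) (use t2 in auto)
    have nl: "\<exists>t\<le>m. eval ?P ?e ENl Nl t" if "1 \<le> m" for m using that by (intro exI[of _ 1]) (auto intro: eval_evals.intros[simplified])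
    have "\<exists>t\<le>(t2 + 8) + (t1 + 8) + 1. eval ?P ?e (EIf c1 c2 ENl)
        (enc_bool (x1 = val_fst y \<and> x2 = val_snd y)) t"
    proof (rule eval_If_le[OF c1])
      show "\<exists>t\<le>t2 + 8. eval ?P ?e c2 (enc_bool (x1 = val_fst y \<and> x2 = val_snd y)) t"
        if "enc_bool (x1 = val_fst y) \<noteq> Nl"
        using that c2 by (intro exI[of _ "7 + 0 + t2 + 1"]) (auto simp: enc_bool_def)
      show "\<exists>t\<le>t2 + 8. eval ?P ?e ENl (enc_bool (x1 = val_fst y \<and> x2 = val_snd y)) t"
        if "enc_bool (x1 = val_fst y) = Nl"
        using that nl[of "t2 + 8"] by (simp add: enc_bool_def split: if_splits)
    qed simp
    then obtain t3 where t3: "t3 \<le> t2 + t1 + 17" "eval ?P ?e (EIf c1 c2 ENl)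
        (enc_bool (x1 = val_fst y \<and> x2 = val_snd y)) t3" by (auto simp: ac_simps)
    have "\<exists>t\<le>(t2 + t1 + 17) + 2 + 1. eval ?P ?e (EIf b (EIf c1 c2 ENl) ENl) (enc_bool (?x = y)) t"
    proof (rule eval_If_le[OF b])
      show "\<exists>t\<le>t2 + t1 + 17. eval ?P ?e (EIf c1 c2 ENl) (enc_bool (?x = y)) t" if "y \<noteq> Nl"
        using that t3 by (cases y) auto
      show "\<exists>t\<le>t2 + t1 + 17. eval ?P ?e ENl (enc_bool (?x = y)) t" if "y = Nl"
        using that nl[of "t2 + t1 + 17"] by (simp add: enc_bool_def)
    qed simp
    then obtain t4 where t4: "t4 \<le> t2 + t1 + 20"
      "eval ?P ?e (EIf b (EIf c1 c2 ENl) ENl) (enc_bool (?x = y)) t4" by (auto simp: ac_simps)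
    have "eval ?P ?e body (enc_bool (?x = y)) (1 + 1 + t4 + 1)"
      using eval_evals.If_true[OF a _ t4(2)] unfolding body_def by (simp add: body_def)
    then show ?case using t1(1) t2(1) t4(1) by (intro exI[of _ "1 + 1 + t4 + 1"]) simp
  qed
  then obtain tf where tf: "\<And>x y. tf x y \<le> 50 * size x + 20"
     "\<And>x y. eval [body] [Pair x y] body (enc_bool (x = y)) (tf x y)" by metis
  have "\<exists>t\<le>50 * size (val_fst y) + 50. eval [body] [y] (ECall 0 [EPair (EFst (Var 0)) (ESnd (Var 0))])
     (enc_bool (val_fst y = val_snd y)) t" for y
  proof -
    have "eval [body] [y] (EPair (EFst (Var 0)) (ESnd (Var 0))) (Pair (val_fst y) (val_snd y)) 5"
      using eval_evals.Pair[OF eval_evals.Fst[OF eval_Var0[of "[body]" y "[]"]] eval_evals.Snd[OF eval_Var0[of "[body]" y "[]"]]]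
      by (simp add: eval_nat_numeral)
    from eval_evals.Call[OF eval_evals.Cons[OF this eval_evals.Nil], of 0] tf(2)[of "val_fst y" "val_snd y"]
    have "eval [body] [y] (ECall 0 [EPair (EFst (Var 0)) (ESnd (Var 0))])
     (enc_bool (val_fst y = val_snd y)) (5 + 0 + tf (val_fst y) (val_snd y) + 1)" by simp
    with tf(1)[of "val_fst y" "val_snd y"] show ?thesis
      by (intro exI[of _ "5 + 0 + tf (val_fst y) (val_snd y) + 1"]) simp
  qed
  then show ?thesis unfolding implT_def by blast
qed

section \<open>Polynomially bounded functions\<close>

text \<open>With \<open>m\<close> at least 2, constants and factors are absorbed by the exponent
  (\<open>k \<le> m ^ k\<close>), so that a polynomial bound is a single power.\<close>

definition pb :: "(val \<Rightarrow> nat \<Rightarrow> bool) \<Rightarrow> (val \<Rightarrow> nat) \<Rightarrow> bool" where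
  "pb R T \<longleftrightarrow> (\<exists>c. \<forall>x m. 2 \<le> m \<longrightarrow> R x m \<longrightarrow> T x \<le> m ^ c)"

lemma pow_mono: "2 \<le> (m::nat) \<Longrightarrow> a \<le> b \<Longrightarrow> m ^ a \<le> m ^ b"
  by (rule power_increasing) auto

lemma two_le_pow: "2 \<le> (m::nat) \<Longrightarrow> 2 \<le> m ^ Suc a"
  using pow_mono[of m 1 "Suc a"] by (simp del: power_Suc)

lemma const_le_pow: "2 \<le> (m::nat) \<Longrightarrow> k \<le> m ^ k"
  by (meson less_exp less_imp_le_nat order_trans power_mono zero_le)

lemma pow_add_le: "2 \<le> (m::nat) \<Longrightarrow> x \<le> m ^ a \<Longrightarrow> y \<le> m ^ b \<Longrightarrow> x + y \<le> m ^ Suc (a + b)"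
proof -
  assume m: "2 \<le> m" and "x \<le> m ^ a" "y \<le> m ^ b"
  then have "x \<le> m ^ (a + b)" "y \<le> m ^ (a + b)"
    using pow_mono[OF m, of a "a + b"] pow_mono[OF m, of b "a + b"] by (metis le_add1 le_add2 order_trans)+
  then have "x + y \<le> 2 * m ^ (a + b)" by simp
  also have "\<dots> \<le> m * m ^ (a + b)" using m by (rule mult_right_mono) simp
  finally show ?thesis by simp
qed

lemma pow_mult_le: "x \<le> m ^ a \<Longrightarrow> y \<le> m ^ b \<Longrightarrow> x * y \<le> (m::nat) ^ (a + b)"
  by (simp add: power_add mult_le_mono)

lemma pb_const: "pb R (\<lambda>x. k)"
  unfolding pb_def using const_le_pow by blast

lemma pb_mono: "pb R S \<Longrightarrow> (\<And>x. T x \<le> S x) \<Longrightarrow> pb R T"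
  unfolding pb_def by (meson order_trans)

lemma pb_Suc: "pb R S \<Longrightarrow> pb R (\<lambda>x. Suc (S x))"
  unfolding pb_def using pow_add_le[of _ _ _ 1 1] by (metis One_nat_def Suc_eq_plus1 one_le_power le_trans one_le_numeral)

lemma pb_add: "pb R S \<Longrightarrow> pb R T \<Longrightarrow> pb R (\<lambda>x. S x + T x)"
  unfolding pb_def by (meson pow_add_le)

lemma pb_mult: "pb R S \<Longrightarrow> pb R T \<Longrightarrow> pb R (\<lambda>x. S x * T x)"
  unfolding pb_def by (meson pow_mult_le)

text \<open>\<open>Suc d\<close> keeps the inner parameter at least 2; a power of a power is again a
  fixed power.\<close>

lemma pb_comp:
  assumes "pb R' T" "\<exists>d. \<forall>x m. 2 \<le> m \<longrightarrow> R x m \<longrightarrow> R' (G x) (m ^ Suc d)"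
  shows "pb R (\<lambda>x. T (G x))"
proof -
  obtain c where c: "\<And>x m. 2 \<le> m \<Longrightarrow> R' x m \<Longrightarrow> T x \<le> m ^ c" using assms(1) unfolding pb_def by blast
  obtain d where d: "\<And>x m. 2 \<le> m \<Longrightarrow> R x m \<Longrightarrow> R' (G x) (m ^ Suc d)" using assms(2) by blast
  have "T (G x) \<le> m ^ (Suc d * c)" if "2 \<le> m" "R x m" for x m
  proof -
    have "2 \<le> m ^ Suc d" using two_le_pow[OF that(1)] .
    from c[OF this d[OF that]] show ?thesis by (simp only: power_mult)
  qed
  then show ?thesis unfolding pb_def by blast
qed

text \<open>The output size is a separate requirement: pairs may share their components, so few
  steps can build a value of exponential size.\<close>

definition fpr :: "(val \<Rightarrow> nat \<Rightarrow> bool) \<Rightarrow> (val \<Rightarrow> val) \<Rightarrow> bool" where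
  "fpr R F \<longleftrightarrow> (\<exists>T. implT F T \<and> pb R T) \<and> pb R (\<lambda>x. size (F x))"

lemma fprI: "implT F T \<Longrightarrow> pb R T \<Longrightarrow> pb R (\<lambda>x. size (F x)) \<Longrightarrow> fpr R F"
  unfolding fpr_def by blast

lemma fprE:
  assumes "fpr R F"
  obtains T where "implT F T" "pb R T" "pb R (\<lambda>x. size (F x))"
  using assms unfolding fpr_def by blast

definition sz :: "val \<Rightarrow> nat \<Rightarrow> bool" where
  "sz x m \<longleftrightarrow> size x \<le> m"

abbreviation fp :: "(val \<Rightarrow> val) \<Rightarrow> bool" where
  "fp \<equiv> fpr sz"

lemma fpr_Nl: "fpr R (\<lambda>x. Nl)"
  by (rule fprI[OF implT_Nl]) (simp_all add: pb_const)

lemma fpr_id: "pb R size \<Longrightarrow> fpr R (\<lambda>x. x)"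
  by (rule fprI[OF implT_id]) (simp_all add: pb_const)

lemma pb_sz_size: "pb sz size"
  unfolding pb_def sz_def by (metis power_one_right)

lemmas fp_id = fpr_id[OF pb_sz_size]

lemma fpr_Pair: "fpr R F \<Longrightarrow> fpr R G \<Longrightarrow> fpr R (\<lambda>x. Pair (F x) (G x))"
  by (elim fprE, rule fprI[OF implT_Pair]) (auto intro!: pb_Suc pb_add pb_const simp: pb_const)

lemma size_val_fst: "size (val_fst x) \<le> size x"
  by (cases x) auto

lemma size_val_snd: "size (val_snd x) \<le> size x"
  by (cases x) auto

lemma fpr_fst: "fpr R F \<Longrightarrow> fpr R (\<lambda>x. val_fst (F x))"
  by (elim fprE, rule fprI[OF implT_fst])
    (auto intro!: pb_Suc pb_add pb_const intro: pb_mono[OF _ size_val_fst])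

lemma fpr_snd: "fpr R F \<Longrightarrow> fpr R (\<lambda>x. val_snd (F x))"
  by (elim fprE, rule fprI[OF implT_snd])
    (auto intro!: pb_Suc pb_add pb_const intro: pb_mono[OF _ size_val_snd])

lemma fpr_If_Nl:
  assumes "fpr R C" "fpr R F" "fpr R G"
  shows "fpr R (\<lambda>x. if C x \<noteq> Nl then F x else G x)"
proof -
  obtain T1 T2 T3 where T: "implT C T1" "implT F T2" "implT G T3" "pb R T1" "pb R T2" "pb R T3"
    "pb R (\<lambda>x. size (F x))" "pb R (\<lambda>x. size (G x))"
    using assms by (elim fprE) blast
  show ?thesis
    by (rule fprI[OF implT_If[OF T(1-3)]])
      (auto intro!: pb_Suc pb_add pb_const T intro: pb_mono[OF pb_add[OF T(7,8)]])
qed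

lemma fpr_comp:
  assumes "fpr R' F" "fpr R G" "\<exists>d. \<forall>x m. 2 \<le> m \<longrightarrow> R x m \<longrightarrow> R' (G x) (m ^ Suc d)"
  shows "fpr R (\<lambda>x. F (G x))"
proof -
  obtain T S where T: "implT F T" "implT G S" "pb R' T" "pb R S" "pb R' (\<lambda>x. size (F x))"
    using assms(1,2) by (elim fprE) blast
  show ?thesis
    by (rule fprI[OF implT_comp[OF T(1,2)]])
      (auto intro!: pb_Suc pb_add pb_const T pb_comp[OF T(3) assms(3)] intro: pb_comp[OF T(5) assms(3)])
qed

lemma pb_sz_premise:
  assumes "pb R (\<lambda>x. size (G x))"
  shows "\<exists>d. \<forall>x m. 2 \<le> m \<longrightarrow> R x m \<longrightarrow> sz (G x) (m ^ Suc d)"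
proof -
  obtain c where c: "\<And>x m. 2 \<le> m \<Longrightarrow> R x m \<Longrightarrow> size (G x) \<le> m ^ c" using assms unfolding pb_def by blast
  have "size (G x) \<le> m ^ Suc c" if "2 \<le> m" "R x m" for x m
    by (rule order_trans[OF c[OF that] pow_mono[OF that(1)]]) simp
  then show ?thesis unfolding sz_def by blast
qed

lemma fpr_comp_fp:
  assumes "fp F" "fpr R G"
  shows "fpr R (\<lambda>x. F (G x))"
  using assms(2) by (intro fpr_comp[OF assms] pb_sz_premise) (auto elim: fprE)

lemma fp_lift1:
  assumes "fp (\<lambda>y. f y)" "fpr R A"
  shows "fpr R (\<lambda>x. f (A x))"
  using fpr_comp_fp[OF assms] .

text \<open>Several arguments are passed as nested pairs. As \<open>f\<close> is polynomial in the
  size of its input alone, only the sizes of the computed arguments have to be known under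
  \<open>R\<close>.\<close>

lemma fp_lift2:
  assumes "fp (\<lambda>y. f (val_fst y) (val_snd y))" "fpr R A" "fpr R B"
  shows "fpr R (\<lambda>x. f (A x) (B x))"
  using fpr_comp_fp[OF assms(1) fpr_Pair[OF assms(2,3)]] by simp

lemma fp_lift3:
  assumes "fp (\<lambda>y. f (val_fst y) (fst_snd y) (snd_snd y))"
    "fpr R A" "fpr R B" "fpr R C"
  shows "fpr R (\<lambda>x. f (A x) (B x) (C x))"
  using fpr_comp_fp[OF assms(1) fpr_Pair[OF assms(2) fpr_Pair[OF assms(3,4)]]] by simp

lemma fp_lift4:
  assumes "fp (\<lambda>y. f (val_fst y) (fst_snd y) (fst_snd (val_snd y))
      (snd_snd (val_snd y)))"
    "fpr R A" "fpr R B" "fpr R C" "fpr R D"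
  shows "fpr R (\<lambda>x. f (A x) (B x) (C x) (D x))"
  using fpr_comp_fp[OF assms(1) fpr_Pair[OF assms(2) fpr_Pair[OF assms(3) fpr_Pair[OF assms(4,5)]]]] by simp

text \<open>A loop with a polynomial body need not be polynomial, because every round may raise the
  size to a power. Hence \<open>RG\<close> is demanded, with one common exponent, for the
  accumulators over all suffixes \<open>zs\<close> of the list.\<close>

lemma fpr_foldr:
  assumes L: "fpr R L" and H: "fpr R H"
    and G: "fpr RG (\<lambda>y. G (val_fst y) (fst_snd y) (snd_snd y))"
    and RG: "\<exists>d. \<forall>x m ys a zs. 2 \<le> m \<longrightarrow> R x m \<longrightarrow> lst (L x) = ys @ a # zs \<longrightarrow>
      RG (Pair a (Pair (foldr (\<lambda>a r. G a r x) zs (H x)) x)) (m ^ Suc d)"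
  shows "fpr R (\<lambda>x. foldr (\<lambda>a r. G a r x) (lst (L x)) (H x))"
proof -
  let ?G = "\<lambda>y. G (val_fst y) (fst_snd y) (snd_snd y)"
  obtain TL where TL: "implT L TL" "pb R TL" "pb R (\<lambda>x. size (L x))" using L by (rule fprE)
  obtain TH where TH: "implT H TH" "pb R TH" "pb R (\<lambda>x. size (H x))" using H by (rule fprE)
  obtain TG where TG: "implT ?G TG" "pb RG TG" "pb RG (\<lambda>x. size (?G x))" using G by (rule fprE)
  obtain d where d: "\<And>x m ys a zs. 2 \<le> m \<Longrightarrow> R x m \<Longrightarrow> lst (L x) = ys @ a # zs \<Longrightarrow>
      RG (Pair a (Pair (foldr (\<lambda>a r. G a r x) zs (H x)) x)) (m ^ Suc d)"
    using RG by blast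
  have two: "2 \<le> m ^ Suc d" if "2 \<le> m" for m :: nat
    using two_le_pow[OF that] .
  obtain cT where cT: "\<And>x m. 2 \<le> m \<Longrightarrow> RG x m \<Longrightarrow> TG x \<le> m ^ cT" using TG(2) unfolding pb_def by blast
  obtain cS where cS: "\<And>x m. 2 \<le> m \<Longrightarrow> RG x m \<Longrightarrow> size (?G x) \<le> m ^ cS" using TG(3) unfolding pb_def by blast
  obtain cL where cL: "\<And>x m. 2 \<le> m \<Longrightarrow> R x m \<Longrightarrow> size (L x) \<le> m ^ cL" using TL(3) unfolding pb_def by blast
  obtain cH where cH: "\<And>x m. 2 \<le> m \<Longrightarrow> R x m \<Longrightarrow> size (H x) \<le> m ^ cH" using TH(3) unfolding pb_def by blast
  show ?thesis
  proof (rule fprI[OF implT_foldr[OF TL(1) TH(1) TG(1)]])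
    have "fold_time TG (\<lambda>a r. G a r x) (H x) x (lst (L x)) \<le> m ^ (cL + Suc (Suc d * cT + 20))"
      if "2 \<le> m" "R x m" for x m
    proof -
      have "fold_time TG (\<lambda>a r. G a r x) (H x) x (lst (L x)) \<le> length (lst (L x)) * (m ^ (Suc d * cT) + 20)"
        by (rule fold_time_le, simp only: power_mult) (rule cT[OF two[OF that(1)] d[OF that]])
      also have "\<dots> \<le> m ^ (cL + Suc (Suc d * cT + 20))"
        by (intro pow_mult_le pow_add_le that const_le_pow order_refl order_trans[OF length_lst_le] cL)
      finally show ?thesis .
    qed
    then have "pb R (\<lambda>x. fold_time TG (\<lambda>a r. G a r x) (H x) x (lst (L x)))"
      unfolding pb_def by blast
    then show "pb R (\<lambda>x. TL x + TH x + 20 + fold_time TG (\<lambda>a r. G a r x) (H x) x (lst (L x)))"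
      by (intro pb_add pb_const TL TH)
    have "size (foldr (\<lambda>a r. G a r x) (lst (L x)) (H x)) \<le> m ^ (cH + Suc d * cS)"
      if "2 \<le> m" "R x m" for x m
    proof (cases "lst (L x)")
      case Nil
      then show ?thesis using cH[OF that] pow_mono[OF that(1), of cH "cH + Suc d * cS"] by simp
    next
      case (Cons a zs)
      have "size (G a (foldr (\<lambda>a r. G a r x) zs (H x)) x) \<le> (m ^ Suc d) ^ cS"
        using cS[OF two[OF that(1)] d[OF that, of "[]" a zs]] Cons by simp
      also have "\<dots> = m ^ (Suc d * cS)" by (simp only: power_mult)
      also have "\<dots> \<le> m ^ (cH + Suc d * cS)" by (rule pow_mono) (use that in auto)
      finally show ?thesis using Cons by simp
    qed
    then show "pb R (\<lambda>x. size (foldr (\<lambda>a r. G a r x) (lst (L x)) (H x)))"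
      unfolding pb_def by blast
  qed
qed

text \<open>For a body that is polynomial in its input size, only the sizes of the partial results
  remain to be bounded.\<close>

lemma fpr_foldr_size:
  assumes L: "fpr R L" and H: "fpr R H" and I: "pb R size"
    and G: "fp (\<lambda>y. G (val_fst y) (fst_snd y) (snd_snd y))"
    and B: "\<exists>d. \<forall>x m ys zs. 2 \<le> m \<longrightarrow> R x m \<longrightarrow> lst (L x) = ys @ zs \<longrightarrow>
      size (foldr (\<lambda>a r. G a r x) zs (H x)) \<le> m ^ d"
  shows "fpr R (\<lambda>x. foldr (\<lambda>a r. G a r x) (lst (L x)) (H x))"
proof (rule fpr_foldr[OF L H G])
  obtain d where d: "\<And>x m ys zs. 2 \<le> m \<Longrightarrow> R x m \<Longrightarrow> lst (L x) = ys @ zs \<Longrightarrow>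
      size (foldr (\<lambda>a r. G a r x) zs (H x)) \<le> m ^ d" using B by blast
  obtain c where c: "\<And>x m. 2 \<le> m \<Longrightarrow> R x m \<Longrightarrow> size x \<le> m ^ c" using I unfolding pb_def by blast
  obtain cL where cL: "\<And>x m. 2 \<le> m \<Longrightarrow> R x m \<Longrightarrow> size (L x) \<le> m ^ cL"
    using L unfolding fpr_def pb_def by blast
  have "size (Pair a (Pair (foldr (\<lambda>a r. G a r x) zs (H x)) x)) \<le> m ^ Suc (Suc (Suc (cL + d) + c) + 2)"
    if *: "2 \<le> m" "R x m" "lst (L x) = ys @ a # zs" for x m ys a zs
  proof -
    have "size a \<le> m ^ cL" using size_mem_lst[of a "L x"] *(3) cL[OF *(1,2)] by simp
    moreover have "size (foldr (\<lambda>a r. G a r x) zs (H x)) \<le> m ^ d"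
      using d[OF *(1,2), of "ys @ [a]"] *(3) by simp
    ultimately have "size a + size (foldr (\<lambda>a r. G a r x) zs (H x)) + size x + 2 \<le> m ^ Suc (Suc (Suc (cL + d) + c) + 2)"
      using * by (intro pow_add_le c const_le_pow) auto
    then show ?thesis by simp
  qed
  then show "\<exists>d. \<forall>x m ys a zs. 2 \<le> m \<longrightarrow> R x m \<longrightarrow> lst (L x) = ys @ a # zs \<longrightarrow>
      sz (Pair a (Pair (foldr (\<lambda>a r. G a r x) zs (H x)) x)) (m ^ Suc d)"
    unfolding sz_def by blast
qed

lemma fp_append_aux: "fp (\<lambda>y. enc_list (lst (val_fst y) @ lst (val_snd y)))"
proof -
  have eq: "enc_list (xs @ lst b) = foldr Pair xs b" for xs b
    by (induction xs) auto
  have "size (foldr Pair zs b) \<le> size (enc_list zs) + size b" for zs b by (induction zs) auto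
  moreover have "size (enc_list zs) \<le> size (enc_list (ys @ zs))" for ys zs
    by (simp add: size_enc_list)
  ultimately have "size (foldr Pair zs (val_snd x)) \<le> m ^ 2"
    if "2 \<le> m" "sz x m" "lst (val_fst x) = ys @ zs" for x m ys zs
  proof -
    have "size (foldr Pair zs (val_snd x)) \<le> size (enc_list (ys @ zs)) + size (val_snd x)"
      using \<open>\<And>b zs. size (foldr Pair zs b) \<le> size (enc_list zs) + size b\<close>[of zs "val_snd x"]
        \<open>\<And>zs ys. size (enc_list zs) \<le> size (enc_list (ys @ zs))\<close>[of zs ys] by linarith
    also have "\<dots> = size (val_fst x) + size (val_snd x)" using that(3) by (metis enc_list_lst)
    also have "\<dots> \<le> size x" by (cases x) auto
    also have "\<dots> \<le> m" using that unfolding sz_def by simp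
    also have "\<dots> \<le> m ^ 2" using pow_mono[OF that(1), of 1 2] by simp
    finally show ?thesis .
  qed
  then have B: "\<exists>d. \<forall>x m ys zs. 2 \<le> m \<longrightarrow> sz x m \<longrightarrow> lst (val_fst x) = ys @ zs \<longrightarrow>
      size (foldr Pair zs (val_snd x)) \<le> m ^ d" by blast
  show ?thesis unfolding eq
    by (rule fpr_foldr_size[where G = "\<lambda>a r x. Pair a r"])
      (use B in \<open>auto intro!: fpr_Pair fpr_fst fpr_snd fp_id pb_sz_size\<close>)
qed

lemma fpr_append:
  "fpr R A \<Longrightarrow> fpr R B \<Longrightarrow> fpr R (\<lambda>x. enc_list (lst (A x) @ lst (B x)))"
  by (rule fp_lift2[OF fp_append_aux])

lemma size_concat_le:
  "(\<And>x. x \<in> set xs \<Longrightarrow> size (f x) \<le> b) \<Longrightarrow>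
    size (enc_list (concat (map (\<lambda>x. lst (f x)) xs))) \<le> length xs * b"
proof (induction xs)
  case (Cons x xs)
  have "size (enc_list (lst (f x) @ ys)) = size (f x) + size (enc_list ys)" for ys
    using size_enc_list[of "lst (f x)"] by (simp add: size_enc_list)
  moreover have "size (f x) \<le> b" using Cons.prems by simp
  moreover have "size (enc_list (concat (map (\<lambda>x. lst (f x)) xs))) \<le> length xs * b"
    using Cons by simp
  ultimately show ?case by simp
qed simp

text \<open>No bound on partial results is assumed: \<open>G\<close> does not see the accumulator,
  which is a concatenation of at most \<open>length (lst (L x))\<close> outputs of
  \<open>G\<close>.\<close>

lemma fpr_concat_map_rel:
  assumes L: "fpr R L" and G: "fpr RG (\<lambda>y. G (val_fst y) (val_snd y))"
    and RG: "\<exists>d. \<forall>x m a. 2 \<le> m \<longrightarrow> R x m \<longrightarrow> a \<in> set (lst (L x)) \<longrightarrow> RG (Pair a x) (m ^ Suc d)"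
  shows "fpr R (\<lambda>x. enc_list (concat (map (\<lambda>a. lst (G a x)) (lst (L x)))))"
proof -
  let ?G = "\<lambda>a r x. enc_list (lst (G a x) @ lst r)"
  have eq: "foldr (\<lambda>a r. ?G a r x) zs Nl = enc_list (concat (map (\<lambda>a. lst (G a x)) zs))" for zs x
    by (induction zs) auto
  obtain d where d: "\<And>x m a. 2 \<le> m \<Longrightarrow> R x m \<Longrightarrow> a \<in> set (lst (L x)) \<Longrightarrow> RG (Pair a x) (m ^ Suc d)"
    using RG by blast
  obtain cS where cS: "\<And>x m. 2 \<le> m \<Longrightarrow> RG x m \<Longrightarrow> size (G (val_fst x) (val_snd x)) \<le> m ^ cS"
    using G unfolding fpr_def pb_def by blast
  obtain cL where cL: "\<And>x m. 2 \<le> m \<Longrightarrow> R x m \<Longrightarrow> size (L x) \<le> m ^ cL"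
    using L unfolding fpr_def pb_def by blast
  \<comment> \<open>At most \<open>m ^ cL\<close> outputs, each of size at most
    \<open>m ^ (Suc d * cS)\<close>.\<close>
  define K where "K = cL + Suc d * cS"
  define RG' where "RG' y m \<longleftrightarrow> RG (Pair (val_fst y) (snd_snd y)) m \<and> size (fst_snd y) \<le> m ^ K" for y m
  have "fpr R (\<lambda>x. foldr (\<lambda>a r. ?G a r x) (lst (L x)) Nl)"
  proof (rule fpr_foldr[OF L fpr_Nl, of RG'])
    have "pb RG' (\<lambda>y. size (fst_snd y))"
      unfolding pb_def RG'_def by blast
    then have 1: "fpr RG' (\<lambda>y. fst_snd y)"
      by (intro fprI[OF implT_fst[OF implT_snd[OF implT_id]]] pb_add pb_const)
    let ?pr = "\<lambda>y. Pair (val_fst y) (snd_snd y)"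
    obtain TG where TG: "implT (\<lambda>y. G (val_fst y) (val_snd y)) TG" "pb RG TG"
       "pb RG (\<lambda>y. size (G (val_fst y) (val_snd y)))" using G by (rule fprE)
    have pr: "\<exists>d. \<forall>x m. 2 \<le> m \<longrightarrow> RG' x m \<longrightarrow> RG (?pr x) (m ^ Suc d)"
      unfolding RG'_def by (intro exI[of _ 0]) simp
    have "implT (\<lambda>x. (\<lambda>y. G (val_fst y) (val_snd y)) (?pr x)) (\<lambda>x. (1 + 1) + (1 + 1 + 1) + 5 + TG (?pr x) + 3)"
      by (intro implT_comp[OF TG(1)] implT_Pair implT_fst implT_snd implT_id)
    moreover have "pb RG' (\<lambda>x. (1 + 1) + (1 + 1 + 1) + 5 + TG (?pr x) + 3)"
      by (intro pb_add pb_const pb_comp[OF TG(2) pr])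
    ultimately have 2: "fpr RG' (\<lambda>y. G (val_fst y) (snd_snd y))"
      using pb_comp[OF TG(3) pr] unfolding fpr_def by auto
    show "fpr RG' (\<lambda>y. enc_list (lst (G (val_fst y) (snd_snd y)) @ lst (fst_snd y)))"
      by (intro fpr_append 1 2)
    have "RG' (Pair a (Pair (foldr (\<lambda>a r. ?G a r x) zs Nl) x)) (m ^ Suc d)"
      if *: "2 \<le> m" "R x m" "lst (L x) = ys @ a # zs" for x m ys a zs
    proof -
      have "size (G b x) \<le> m ^ (Suc d * cS)" if "b \<in> set zs" for b
        using cS[OF two_le_pow d[OF *(1,2)], of b] that * by (simp add: power_mult del: power_Suc mult_Suc)
      then have "size (enc_list (concat (map (\<lambda>a. lst (G a x)) zs))) \<le> length zs * m ^ (Suc d * cS)"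
        by (rule size_concat_le)
      also have "\<dots> \<le> m ^ cL * m ^ (Suc d * cS)"
        using length_lst_le[of "L x"] cL[OF *(1,2)] *(3) by (intro mult_right_mono) auto
      also have "\<dots> = m ^ K" by (simp add: K_def power_add)
      also have "\<dots> \<le> (m ^ Suc d) ^ K" unfolding power_mult[symmetric]
        by (rule pow_mono) (use * in auto)
      finally have "size (foldr (\<lambda>a r. ?G a r x) zs Nl) \<le> (m ^ Suc d) ^ K"
        unfolding eq .
      moreover have "RG (Pair a x) (m ^ Suc d)" using d[OF *(1,2)] *(3) by simp
      ultimately show ?thesis unfolding RG'_def by simp
    qed
    then show "\<exists>d. \<forall>x m ys a zs. 2 \<le> m \<longrightarrow> R x m \<longrightarrow> lst (L x) = ys @ a # zs \<longrightarrow>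
       RG' (Pair a (Pair (foldr (\<lambda>a r. ?G a r x) zs Nl) x)) (m ^ Suc d)" by blast
  qed
  then show ?thesis unfolding eq .
qed

lemma fp_concat_map:
  assumes L: "fp L" and G: "fp (\<lambda>y. G (val_fst y) (val_snd y))"
  shows "fp (\<lambda>x. enc_list (concat (map (\<lambda>a. lst (G a x)) (lst (L x)))))"
proof (rule fpr_concat_map_rel[OF L G])
  obtain cL where cL: "\<And>x m. 2 \<le> m \<Longrightarrow> sz x m \<Longrightarrow> size (L x) \<le> m ^ cL"
    using L unfolding fpr_def pb_def by blast
  have "sz (Pair a x) (m ^ Suc (Suc (cL + 1) + 1))" if "2 \<le> m" "sz x m" "a \<in> set (lst (L x))" for x m a
  proof -
    have "size a \<le> m ^ cL" using cL[OF that(1,2)] size_mem_lst[OF that(3)] by simp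
    then have "size a + size x + 1 \<le> m ^ Suc (Suc (cL + 1) + 1)"
      using that by (intro pow_add_le) (auto simp: sz_def)
    then show ?thesis by (simp add: sz_def)
  qed
  then show "\<exists>d. \<forall>x m a. 2 \<le> m \<longrightarrow> sz x m \<longrightarrow> a \<in> set (lst (L x)) \<longrightarrow> sz (Pair a x) (m ^ Suc d)"
    by blast
qed

lemma fp_map:
  assumes "fp L" "fp (\<lambda>y. G (val_fst y) (val_snd y))"
  shows "fp (\<lambda>x. enc_list (map (\<lambda>a. G a x) (lst (L x))))"
  using fp_concat_map[OF assms(1) fpr_Pair[OF assms(2) fpr_Nl]] by (simp add: concat_map_singleton)

section \<open>Boolean connectives, bounded quantifiers and membership\<close>

lemma enc_bool_eq_Nl [simp]: "enc_bool b = Nl \<longleftrightarrow> \<not> b"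
  by (simp add: enc_bool_def)

lemma fpr_If:
  assumes "fpr R (\<lambda>x. enc_bool (C x))" "fpr R F" "fpr R G"
  shows "fpr R (\<lambda>x. if C x then F x else G x)"
  using fpr_If_Nl[OF assms] by simp

lemma fp_filter:
  assumes "fp L" "fp (\<lambda>y. enc_bool (C (val_fst y) (val_snd y)))"
  shows "fp (\<lambda>x. enc_list (filter (\<lambda>a. C a x) (lst (L x))))"
proof -
  have "concat (map (\<lambda>a. lst (if C a x then Pair a Nl else Nl)) xs) = filter (\<lambda>a. C a x) xs" for x xs
    by (induction xs) auto
  moreover have "fp (\<lambda>x. enc_list (concat (map (\<lambda>a. lst (if C a x then Pair a Nl else Nl)) (lst (L x)))))"
    by (intro fp_concat_map[OF assms(1)] fpr_If assms fpr_Pair fpr_fst fp_id fpr_Nl)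
  ultimately show ?thesis by simp
qed

lemma fpr_True: "fpr R (\<lambda>x. enc_bool True)"
  unfolding enc_bool_def by (simp add: fpr_Nl fpr_Pair)

lemma fpr_False: "fpr R (\<lambda>x. enc_bool False)"
  unfolding enc_bool_def by (simp add: fpr_Nl fpr_Pair)

lemma fpr_not_Nl: "fpr R A \<Longrightarrow> fpr R (\<lambda>x. enc_bool (A x \<noteq> Nl))"
proof -
  assume "fpr R A"
  have "(\<lambda>x. enc_bool (A x \<noteq> Nl)) = (\<lambda>x. if A x \<noteq> Nl then enc_bool True else enc_bool False)" by auto
  with fpr_If_Nl[OF \<open>fpr R A\<close> fpr_True fpr_False] show ?thesis by simp
qed

lemma fpr_conj:
  assumes "fpr R (\<lambda>x. enc_bool (C x))" "fpr R (\<lambda>x. enc_bool (D x))"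
  shows "fpr R (\<lambda>x. enc_bool (C x \<and> D x))"
proof -
  have "(\<lambda>x. enc_bool (C x \<and> D x)) = (\<lambda>x. if C x then enc_bool (D x) else enc_bool False)" by auto
  with fpr_If[OF assms fpr_False] show ?thesis by simp
qed

lemma fpr_not:
  assumes "fpr R (\<lambda>x. enc_bool (C x))"
  shows "fpr R (\<lambda>x. enc_bool (\<not> C x))"
proof -
  have "(\<lambda>x. enc_bool (\<not> C x)) = (\<lambda>x. if C x then enc_bool False else enc_bool True)" by auto
  with fpr_If[OF assms fpr_False fpr_True] show ?thesis by simp
qed

lemma fpr_disj:
  assumes "fpr R (\<lambda>x. enc_bool (C x))" "fpr R (\<lambda>x. enc_bool (D x))"
  shows "fpr R (\<lambda>x. enc_bool (C x \<or> D x))"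
  using fpr_not[OF fpr_conj[OF assms[THEN fpr_not]]] by simp

lemma fpr_eq:
  assumes "fpr R A" "fpr R B"
  shows "fpr R (\<lambda>x. enc_bool (A x = B x))"
proof (rule fp_lift2[OF _ assms])
  have "pb sz (\<lambda>y. 50 * size (val_fst y) + 50)"
    by (intro pb_add pb_mult pb_const pb_mono[OF pb_sz_size size_val_fst])
  moreover have "pb sz (\<lambda>y. size (enc_bool (val_fst y = val_snd y)))"
    by (rule pb_mono[OF pb_const[of _ 1]]) (simp add: enc_bool_def)
  ultimately show "fp (\<lambda>y. enc_bool (val_fst y = val_snd y))"
    by (rule fprI[OF implT_eq_pair])
qed

lemma fpr_iff:
  assumes "fpr R (\<lambda>x. enc_bool (C x))" "fpr R (\<lambda>x. enc_bool (D x))"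
  shows "fpr R (\<lambda>x. enc_bool (C x \<longleftrightarrow> D x))"
proof -
  have "(\<lambda>x. enc_bool (C x \<longleftrightarrow> D x)) = (\<lambda>x. enc_bool (enc_bool (C x) = enc_bool (D x)))"
    by (auto simp: enc_bool_def)
  with fpr_eq[OF assms] show ?thesis by simp
qed

lemma fp_Bex:
  assumes "fp L" "fp (\<lambda>y. enc_bool (C (val_fst y) (val_snd y)))"
  shows "fp (\<lambda>x. enc_bool (\<exists>a\<in>set (lst (L x)). C a x))"
  using fpr_not_Nl[OF fp_filter[OF assms]] by (simp add: filter_empty_conv)

lemma fp_Ball:
  assumes "fp L" "fp (\<lambda>y. enc_bool (C (val_fst y) (val_snd y)))"
  shows "fp (\<lambda>x. enc_bool (\<forall>a\<in>set (lst (L x)). C a x))"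
  using fpr_not[OF fp_Bex[OF assms(1) fpr_not[OF assms(2)]]] by simp

lemma fpr_mem:
  assumes "fpr R A" "fpr R L"
  shows "fpr R (\<lambda>x. enc_bool (A x \<in> set (lst (L x))))"
proof (rule fp_lift2[OF _ assms])
  have "fp (\<lambda>y. enc_bool (\<exists>b\<in>set (lst (val_snd y)). val_fst y = b))"
    by (intro fp_Bex fpr_eq fpr_fst fpr_snd fp_id)
  then show "fp (\<lambda>y. enc_bool (val_fst y \<in> set (lst (val_snd y))))" by simp
qed

lemmas fp_rules = fp_id fpr_Nl fpr_Pair fpr_fst fpr_snd fpr_append fp_concat_map fp_map fp_filter
  fpr_If fpr_True fpr_False fpr_not fpr_conj fpr_disj fpr_iff fpr_eq fp_Bex fp_Ball fpr_mem

section \<open>Recursion on binary trees\<close>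

text \<open>Leaves are the values with first component \<open>Nl\<close>, as in the encoding
  \<open>btenc\<close>. The context \<open>p\<close> is the same at all nodes.\<close>

function trec :: "(val \<Rightarrow> val \<Rightarrow> val \<Rightarrow> val) \<Rightarrow> (val \<Rightarrow> val \<Rightarrow> val) \<Rightarrow> val \<Rightarrow> val \<Rightarrow> val" where
  "trec g h p t = (if val_fst t = Nl then h t p else g (trec g h p (val_fst t)) (trec g h p (val_snd t)) p)"
  by auto
termination
proof (relation "measure (\<lambda>(g, h, p, t). size t)", goal_cases)
  case (2 g h p t)
  then show ?case by (cases t) auto
next
  case (3 g h p t)
  then show ?case by (cases t) auto
qed simp

declare trec.simps [simp del]

function trec_time :: "(val \<Rightarrow> nat) \<Rightarrow> (val \<Rightarrow> nat) \<Rightarrow> (val \<Rightarrow> val \<Rightarrow> val \<Rightarrow> val) \<Rightarrow> (val \<Rightarrow> val \<Rightarrow> val) \<Rightarrow> val \<Rightarrow> val \<Rightarrow> nat" where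
  "trec_time TG TH g h p t = (if val_fst t = Nl then TH (Pair t p) + 30 else
     trec_time TG TH g h p (val_fst t) + trec_time TG TH g h p (val_snd t) +
     TG (Pair (trec g h p (val_fst t)) (Pair (trec g h p (val_snd t)) p)) + 50)"
  by auto
termination
proof (relation "measure (\<lambda>(TG, TH, g, h, p, t). size t)", goal_cases)
  case (2 TG TH g h p t)
  then show ?case by (cases t) auto
next
  case (3 TG TH g h p t)
  then show ?case by (cases t) auto
qed simp

declare trec_time.simps [simp del]

lemma implT_trec:
  assumes "implT (\<lambda>y. g (val_fst y) (fst_snd y) (snd_snd y)) TG"
    and "implT (\<lambda>y. h (val_fst y) (val_snd y)) TH"
  shows "implT (\<lambda>y. trec g h (val_snd y) (val_fst y)) (\<lambda>y. trec_time TG TH g h (val_snd y) (val_fst y))"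
proof -
  let ?G = "\<lambda>y. g (val_fst y) (fst_snd y) (snd_snd y)"
  let ?H = "\<lambda>y. h (val_fst y) (val_snd y)"
  obtain P0 ig ih where c0: "computes P0 ig ?G TG" "computes P0 ih ?H TH"
    using implT_link2[OF assms] .
  define f where "f = length P0"
  define a where "a = EFst (EFst (Var 0))"
  define b where "b = ESnd (EFst (Var 0))"
  define p where "p = ESnd (Var 0)"
  define body where "body = EIf a (ECall ig [EPair (ECall f [EPair a p]) (EPair (ECall f [EPair b p]) p)])
      (ECall ih [EPair (EFst (Var 0)) p])"
  define P where "P = P0 @ [body]"
  have c: "computes P ig ?G TG" "computes P ih ?H TH"
    unfolding P_def by (intro computes_append c0)+
  have Pf: "P ! f = body" "f < length P" unfolding P_def f_def by auto
  \<comment> \<open>The argument is given by its selectors and not as a \<open>Pair\<close>, because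
    the program may also be run on \<open>Nl\<close>.\<close>
  have main: "\<exists>t\<le>trec_time TG TH g h (val_snd y) x. val_fst y = x \<longrightarrow>
      eval P [y] body (trec g h (val_snd y) x) t" for x y
  proof (induction x arbitrary: y rule: measure_induct_rule[of size])
    case (less x)
    let ?q = "val_snd y"
    show ?case
    proof (cases "val_fst y = x")
      case False then show ?thesis by auto
    next
      case True
      have v: "eval P [y] (Var 0) y 1" by (rule eval_Var0)
      have ea: "eval P [y] a (val_fst x) 3" unfolding a_def
        using eval_evals.Fst[OF eval_evals.Fst[OF v]] True by (simp add: eval_nat_numeral)
      have eb: "eval P [y] b (val_snd x) 3" unfolding b_def
        using eval_evals.Snd[OF eval_evals.Fst[OF v]] True by (simp add: eval_nat_numeral)
      have ep: "eval P [y] p ?q 2" unfolding p_def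
        using eval_evals.Snd[OF v] True by (simp add: eval_nat_numeral)
      show ?thesis
      proof (cases "val_fst x = Nl")
        case Nl: True
        have "eval P [y] (EFst (Var 0)) x 2"
          using eval_evals.Fst[OF v] True by (simp add: eval_nat_numeral)
        from eval_call1[OF c(2) eval_evals.Pair[OF this ep]]
        obtain t where t: "t \<le> (2 + 2 + 1) + TH (Pair x ?q) + 1"
          "eval P [y] (ECall ih [EPair (EFst (Var 0)) p]) (h x ?q) t" by auto
        have "eval P [y] body (trec g h ?q x) (3 + t + 1)" unfolding body_def
          using eval_evals.If_false[OF ea[unfolded Nl] t(2)] Nl by (simp add: trec.simps)
        moreover have "3 + t + 1 \<le> trec_time TG TH g h ?q x"
          using t(1) Nl by (simp add: trec_time.simps[of TG TH g h ?q x])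
        ultimately show ?thesis by blast
      next
        case nNl: False
        then have lt: "size (val_fst x) < size x" "size (val_snd x) < size x"
          by (cases x; auto)+
        have rec: "\<exists>t\<le>trec_time TG TH g h ?q z + 9. eval P [y] (ECall f [EPair e p]) (trec g h ?q z) t"
          if e: "eval P [y] e z 3" "size z < size x" for e z
        proof -
          obtain t where t: "t \<le> trec_time TG TH g h ?q z" "eval P [Pair z ?q] body (trec g h ?q z) t"
            using less.IH[OF e(2), of "Pair z ?q"] by auto
          from eval_evals.Call[OF eval_evals.Cons[OF eval_evals.Pair[OF e(1) ep] eval_evals.Nil] Pf(2)] t(2)
          have "eval P [y] (ECall f [EPair e p]) (trec g h ?q z) (3 + 2 + 1 + 0 + t + 1)"
            by (simp add: Pf)
          with t(1) show ?thesis by (intro exI[of _ "3 + 2 + 1 + 0 + t + 1"]) simp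
        qed
        let ?r1 = "trec g h ?q (val_fst x)" and ?r2 = "trec g h ?q (val_snd x)"
        obtain t1 where t1: "t1 \<le> trec_time TG TH g h ?q (val_fst x) + 9"
          "eval P [y] (ECall f [EPair a p]) ?r1 t1" using rec[OF ea lt(1)] by blast
        obtain t2 where t2: "t2 \<le> trec_time TG TH g h ?q (val_snd x) + 9"
          "eval P [y] (ECall f [EPair b p]) ?r2 t2" using rec[OF eb lt(2)] by blast
        obtain t where t: "t \<le> (t1 + (t2 + 2 + 1) + 1) + TG (Pair ?r1 (Pair ?r2 ?q)) + 1"
          "eval P [y] (ECall ig [EPair (ECall f [EPair a p]) (EPair (ECall f [EPair b p]) p)])
            (?G (Pair ?r1 (Pair ?r2 ?q))) t"
          using eval_call1[OF c(1) eval_evals.Pair[OF t1(2) eval_evals.Pair[OF t2(2) ep]]] by blast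
        have "eval P [y] body (trec g h ?q x) (3 + t + 1)" unfolding body_def
          using eval_evals.If_true[OF ea nNl t(2)] nNl by (simp add: trec.simps[of g h ?q x])
        moreover have "3 + t + 1 \<le> trec_time TG TH g h ?q x"
          using t(1) t1(1) t2(1) nNl by (simp add: trec_time.simps[of TG TH g h ?q x])
        ultimately show ?thesis by blast
      qed
    qed
  qed
  then have "\<exists>t\<le>trec_time TG TH g h (val_snd y) (val_fst y). eval P [y] (P ! f) (trec g h (val_snd y) (val_fst y)) t" for y
    using main[of "val_snd y" "val_fst y"] unfolding Pf by blast
  then show ?thesis using Pf(2) unfolding implT_def by blast
qed

text \<open>The values on which \<open>trec\<close> is called, starting from \<open>t\<close>. The
  descent stops at leaves, so labels are not entered.\<close>

inductive_set nodes :: "val \<Rightarrow> val set" for t where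
  root: "t \<in> nodes t"
| left: "s \<in> nodes t \<Longrightarrow> val_fst s \<noteq> Nl \<Longrightarrow> val_fst s \<in> nodes t"
| right: "s \<in> nodes t \<Longrightarrow> val_fst s \<noteq> Nl \<Longrightarrow> val_snd s \<in> nodes t"

text \<open>\<open>2 * size t + 1\<close> counts all nodes of a binary value, occurrences of
  \<open>Nl\<close> included: the counts of both components plus one give that of the pair.\<close>

lemma trec_time_le:
  assumes "\<And>s. s \<in> nodes t \<Longrightarrow> val_fst s = Nl \<Longrightarrow> TH (Pair s p) \<le> b"
    and "\<And>s. s \<in> nodes t \<Longrightarrow> val_fst s \<noteq> Nl \<Longrightarrow>
      TG (Pair (trec g h p (val_fst s)) (Pair (trec g h p (val_snd s)) p)) \<le> b"
  shows "trec_time TG TH g h p t \<le> (2 * size t + 1) * (b + 50)"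
proof -
  have "trec_time TG TH g h p s \<le> (2 * size s + 1) * (b + 50)" if "s \<in> nodes t" for s
    using that
  proof (induction s rule: measure_induct_rule[of size])
    case (less s)
    show ?case
    proof (cases "val_fst s = Nl")
      case True
      then have "trec_time TG TH g h p s \<le> b + 30"
        using assms(1)[OF less.prems] by (simp add: trec_time.simps[of TG TH g h p s])
      then show ?thesis by simp
    next
      case False
      then obtain l r where s: "s = Pair l r" "l \<noteq> Nl" by (cases s) auto
      have n: "l \<in> nodes t" "r \<in> nodes t"
        using nodes.left[OF less.prems] nodes.right[OF less.prems] s by auto
      have "trec_time TG TH g h p l \<le> (2 * size l + 1) * (b + 50)"
        "trec_time TG TH g h p r \<le> (2 * size r + 1) * (b + 50)"
        using less.IH n s by auto
      moreover have "TG (Pair (trec g h p l) (Pair (trec g h p r) p)) \<le> b"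
        using assms(2)[OF less.prems] s by simp
      ultimately have "trec_time TG TH g h p s \<le> (2 * size l + 1) * (b + 50) + (2 * size r + 1) * (b + 50) + (b + 50)"
        using s by (simp add: trec_time.simps[of TG TH g h p "Pair l r"])
      also have "\<dots> = (2 * size s + 1) * (b + 50)" using s by (simp add: algebra_simps)
      finally show ?thesis .
    qed
  qed
  then show ?thesis using nodes.root by blast
qed

text \<open>As in \<open>fpr_foldr\<close>, the premise controls all intermediate results. The size
  of the output then follows from the step at the root alone.\<close>

lemma fpr_trec:
  assumes I: "pb R size"
    and g: "fpr RG (\<lambda>y. g (val_fst y) (fst_snd y) (snd_snd y))"
    and h: "fp (\<lambda>y. h (val_fst y) (val_snd y))"
    and H: "\<exists>d. \<forall>x m. \<forall>s\<in>nodes (val_fst x). 2 \<le> m \<longrightarrow> R x m \<longrightarrow>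
      (if val_fst s = Nl then sz (Pair s (val_snd x)) (m ^ Suc d)
       else RG (Pair (trec g h (val_snd x) (val_fst s)) (Pair (trec g h (val_snd x) (val_snd s)) (val_snd x))) (m ^ Suc d))"
  shows "fpr R (\<lambda>x. trec g h (val_snd x) (val_fst x))"
proof -
  obtain TG where TG: "implT (\<lambda>y. g (val_fst y) (fst_snd y) (snd_snd y)) TG" "pb RG TG"
    "pb RG (\<lambda>y. size (g (val_fst y) (fst_snd y) (snd_snd y)))" using g by (rule fprE)
  obtain TH where TH: "implT (\<lambda>y. h (val_fst y) (val_snd y)) TH" "pb sz TH"
    "pb sz (\<lambda>y. size (h (val_fst y) (val_snd y)))" using h by (rule fprE)
  obtain d where d: "\<And>x m s. s \<in> nodes (val_fst x) \<Longrightarrow> 2 \<le> m \<Longrightarrow> R x m \<Longrightarrow>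
      (if val_fst s = Nl then sz (Pair s (val_snd x)) (m ^ Suc d)
       else RG (Pair (trec g h (val_snd x) (val_fst s)) (Pair (trec g h (val_snd x) (val_snd s)) (val_snd x))) (m ^ Suc d))"
    using H by blast
  obtain a where a: "\<And>y m. 2 \<le> m \<Longrightarrow> RG y m \<Longrightarrow> TG y \<le> m ^ a" using TG(2) unfolding pb_def by blast
  obtain b where b: "\<And>y m. 2 \<le> m \<Longrightarrow> sz y m \<Longrightarrow> TH y \<le> m ^ b" using TH(2) unfolding pb_def by blast
  obtain a' where a': "\<And>y m. 2 \<le> m \<Longrightarrow> RG y m \<Longrightarrow> size (g (val_fst y) (fst_snd y) (snd_snd y)) \<le> m ^ a'"
    using TG(3) unfolding pb_def by blast
  obtain b' where b': "\<And>y m. 2 \<le> m \<Longrightarrow> sz y m \<Longrightarrow> size (h (val_fst y) (val_snd y)) \<le> m ^ b'"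
    using TH(3) unfolding pb_def by blast
  obtain c where c: "\<And>x m. 2 \<le> m \<Longrightarrow> R x m \<Longrightarrow> size x \<le> m ^ c" using I unfolding pb_def by blast
  have le: "m ^ (Suc d * u) \<le> m ^ (Suc d * (u + v))" "m ^ (Suc d * v) \<le> m ^ (Suc d * (u + v))"
    if "2 \<le> m" for m u v :: nat
    by (rule pow_mono[OF that], rule mult_le_mono2, simp)+
  show ?thesis
  proof (rule fprI[OF implT_trec[OF TG(1) TH(1)]])
    have "trec_time TG TH g h (val_snd x) (val_fst x) \<le> m ^ (Suc ((1 + c) + 1) + Suc (Suc d * (a + b) + 50))"
      if m: "2 \<le> m" "R x m" for x m
    proof -
      note two = two_le_pow[OF m(1), of d]
      have "trec_time TG TH g h (val_snd x) (val_fst x) \<le> (2 * size (val_fst x) + 1) * (m ^ (Suc d * (a + b)) + 50)"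
      proof (rule trec_time_le)
        fix s assume s: "s \<in> nodes (val_fst x)"
        show "TH (Pair s (val_snd x)) \<le> m ^ (Suc d * (a + b))" if "val_fst s = Nl"
        proof -
          have "sz (Pair s (val_snd x)) (m ^ Suc d)" using d[OF s m] that by simp
          from b[OF two this] le(2)[OF m(1), of b a] show ?thesis
            unfolding power_mult[symmetric] by (rule order_trans)
        qed
        show "TG (Pair (trec g h (val_snd x) (val_fst s)) (Pair (trec g h (val_snd x) (val_snd s)) (val_snd x)))
          \<le> m ^ (Suc d * (a + b))" if "val_fst s \<noteq> Nl"
        proof -
          have "RG (Pair (trec g h (val_snd x) (val_fst s)) (Pair (trec g h (val_snd x) (val_snd s)) (val_snd x))) (m ^ Suc d)"
            using d[OF s m] that by simp
          from a[OF two this] le(1)[OF m(1), of a b] show ?thesis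
            unfolding power_mult[symmetric] by (rule order_trans)
        qed
      qed
      also have "\<dots> \<le> m ^ (Suc ((1 + c) + 1) + Suc (Suc d * (a + b) + 50))"
        using m order_trans[OF size_val_fst c[OF m]]
        by (intro pow_mult_le pow_add_le const_le_pow order_refl) auto
      finally show ?thesis .
    qed
    then show "pb R (\<lambda>y. trec_time TG TH g h (val_snd y) (val_fst y))" unfolding pb_def by blast
    have "size (trec g h (val_snd x) (val_fst x)) \<le> m ^ (Suc d * (a' + b'))" if m: "2 \<le> m" "R x m" for x m
    proof (cases "val_fst (val_fst x) = Nl")
      case True
      have "sz (Pair (val_fst x) (val_snd x)) (m ^ Suc d)" using d[OF nodes.root m] True by simp
      from b'[OF two_le_pow[OF m(1)] this] have "size (trec g h (val_snd x) (val_fst x)) \<le> m ^ (Suc d * b')"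
        using True unfolding power_mult[symmetric] by (simp add: trec.simps[of g h _ "val_fst x"])
      then show ?thesis using le(2)[OF m(1)] by (rule order_trans)
    next
      case False
      have "RG (Pair (trec g h (val_snd x) (val_fst (val_fst x))) (Pair (trec g h (val_snd x) (val_snd (val_fst x))) (val_snd x))) (m ^ Suc d)"
        using d[OF nodes.root m] False by simp
      from a'[OF two_le_pow[OF m(1)] this] have "size (trec g h (val_snd x) (val_fst x)) \<le> m ^ (Suc d * a')"
        using False unfolding power_mult[symmetric] by (simp add: trec.simps[of g h _ "val_fst x"])
      then show ?thesis using le(1)[OF m(1)] by (rule order_trans)
    qed
    then show "pb R (\<lambda>x. size (trec g h (val_snd x) (val_fst x)))" unfolding pb_def by blast
  qed
qed

section \<open>The dynamic program\<close>

text \<open>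
  The context of the program is \<open>Pair vertices (Pair edges (Pair k cap))\<close>, with \<open>k\<close> and \<open>cap\<close> in unary.
\<close>

abbreviation cv :: "val \<Rightarrow> val" where "cv p \<equiv> val_fst p"
abbreviation ce :: "val \<Rightarrow> val" where "ce p \<equiv> fst_snd p"
abbreviation ck :: "val \<Rightarrow> val" where "ck p \<equiv> fst_snd (val_snd p)"
abbreviation ccap :: "val \<Rightarrow> val" where "ccap p \<equiv> snd_snd (val_snd p)"

text \<open>
  A color type is \<open>Pair S (Pair b Q)\<close>.  Sets of classes are represented by their unions, listed
  in the order of the vertex list, so that equal sets are equal values.
\<close>

abbreviation tS :: "val \<Rightarrow> val" where "tS t \<equiv> val_fst t"
abbreviation tb :: "val \<Rightarrow> val" where "tb t \<equiv> fst_snd t"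
abbreviation tQ :: "val \<Rightarrow> val" where "tQ t \<equiv> snd_snd t"

section \<open>Operations on color types\<close>

definition app :: "val \<Rightarrow> val \<Rightarrow> val" where
  "app a b = enc_list (lst a @ lst b)"

definition adjp :: "val \<Rightarrow> val \<Rightarrow> val \<Rightarrow> bool" where
  "adjp p u v \<longleftrightarrow> Pair u v \<in> set (lst (ce p))"

text \<open>The relation \<open>module_equiv\<close> for the set listed by \<open>A\<close>, with
  \<open>cv p\<close> as vertex set.\<close>

definition eqv :: "val \<Rightarrow> val \<Rightarrow> val \<Rightarrow> val \<Rightarrow> bool" where
  "eqv p A u v \<longleftrightarrow> u \<in> set (lst A) \<and> v \<in> set (lst A) \<and>
     (\<forall>z\<in>set (lst (cv p)). z \<in> set (lst A) \<or> (adjp p u z \<longleftrightarrow> adjp p v z))"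

definition sat :: "val \<Rightarrow> val \<Rightarrow> val \<Rightarrow> val" where
  "sat p A X = enc_list (filter (\<lambda>v. \<exists>u\<in>set (lst X). eqv p A u v) (lst (cv p)))"

text \<open>When a color of type \<open>s\<close> on one side may be identified with a color of type
  \<open>t\<close> on the other: it must not get two b-vertices, and its vertices must stay
  independent.\<close>

definition compatible :: "val \<Rightarrow> val \<Rightarrow> val \<Rightarrow> bool" where
  "compatible p s t \<longleftrightarrow> \<not> (\<not> tb s = Nl \<and> \<not> tb t = Nl) \<and>
     \<not> (\<exists>u\<in>set (lst (tS s)). \<exists>v\<in>set (lst (tS t)). adjp p u v)"

text \<open>\<open>S\<close> holds the classes of a color on the other side; what is kept are the
  demands in \<open>Q\<close> for this color that edges across do not fulfil.\<close>

definition unmet :: "val \<Rightarrow> val \<Rightarrow> val \<Rightarrow> val" where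
  "unmet p Q S = enc_list (filter (\<lambda>v. \<not> (\<exists>u\<in>set (lst S). adjp p v u)) (lst Q))"

text \<open>Passing to the larger set \<open>A\<close> coarsens the classes, hence the renewed
  saturation. Demands met inside a side are gone already, so each side is only checked against the
  other.\<close>

definition comb :: "val \<Rightarrow> val \<Rightarrow> val \<Rightarrow> val \<Rightarrow> val" where
  "comb p A s t = Pair (sat p A (app (tS s) (tS t))) (Pair (if tb s = Nl then tb t else tb s)
     (sat p A (app (unmet p (tQ s) (tS t)) (unmet p (tQ t) (tS s)))))"

text \<open>The list of copies serves as a unary multiplicity, so multiplicities are compared by
  equality of values.\<close>

definition occurrences :: "val \<Rightarrow> val \<Rightarrow> val" where
  "occurrences a xs = enc_list (filter (\<lambda>b. a = b) (lst xs))"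

definition same_mset :: "val \<Rightarrow> val \<Rightarrow> bool" where
  "same_mset xs ys \<longleftrightarrow> (\<forall>a\<in>set (lst (app xs ys)). occurrences a xs = occurrences a ys)"

text \<open>
  Keeps one pair of each class modulo permutations of both components; this is what bounds
  the number of states.
\<close>

definition dedup :: "val \<Rightarrow> val" where
  "dedup L = foldr (\<lambda>a r. if \<exists>b\<in>set (lst r). same_mset (val_fst a) (val_fst b) \<and> same_mset (val_snd a) (val_snd b)
     then r else Pair a r) (lst L) Nl"

text \<open>
  A configuration is a pair of the types of the second state used so far and the combined types.
\<close>

definition ext :: "val \<Rightarrow> val \<Rightarrow> val \<Rightarrow> val \<Rightarrow> val \<Rightarrow> val" where
  "ext p A s2 s c = enc_list (map (\<lambda>t. Pair (Pair t (val_fst c)) (Pair (comb p A s t) (val_snd c)))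
     (lst (enc_list (filter (\<lambda>t. compatible p s t \<and> \<not> occurrences t (val_fst c) = occurrences t s2) (lst s2)))))"

definition mstep :: "val \<Rightarrow> val \<Rightarrow> val \<Rightarrow> val \<Rightarrow> val \<Rightarrow> val" where
  "mstep p A s2 s acc = dedup (enc_list (concat (map (\<lambda>c. lst (ext p A s2 s c)) (lst acc))))"

text \<open>The start is the single empty configuration. Without the \<open>dedup\<close> in
  \<open>mstep\<close>, all pairings of the colors in \<open>zs\<close> with colors of the second
  state could be listed.\<close>

definition match_fold :: "val \<Rightarrow> val \<Rightarrow> val \<Rightarrow> val list \<Rightarrow> val" where
  "match_fold p A s2 zs = foldr (\<lambda>s acc. mstep p A s2 s acc) zs (Pair (Pair Nl Nl) Nl)"

text \<open>Once all colors are matched, the used types say nothing about the combined state.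
  Clearing them lets \<open>dedup\<close> identify results that come from different pairs of
  states.\<close>

definition strip :: "val \<Rightarrow> val" where
  "strip T = enc_list (map (\<lambda>c. Pair Nl (val_snd c)) (lst T))"

definition merge :: "val \<Rightarrow> val \<Rightarrow> val \<Rightarrow> val \<Rightarrow> val" where
  "merge T1 T2 A p = dedup (enc_list (concat (map (\<lambda>c1. lst (enc_list (concat (map (\<lambda>c2.
     lst (strip (match_fold p A (val_snd c2) (lst (val_snd c1))))) (lst T2))))) (lst T1))))"

definition node_step :: "val \<Rightarrow> val \<Rightarrow> val \<Rightarrow> val" where
  "node_step a b p = Pair (app (val_fst a) (val_fst b))
     (merge (val_snd a) (val_snd b) (app (val_fst a) (val_fst b)) p)"

text \<open>Serves to compare lengths, the result being \<open>Nl\<close> iff \<open>b\<close> is at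
  most as long as \<open>a\<close>, and to reach the entry of a list at a unary index.\<close>

definition dropv :: "val \<Rightarrow> val \<Rightarrow> val" where
  "dropv a b = foldr (\<lambda>_ r. val_snd r) (lst a) b"

text \<open>Binary to unary, cut off at \<open>cap\<close>, so that the result is never large.\<close>

definition tou :: "val \<Rightarrow> val \<Rightarrow> val" where
  "tou cap bits = foldr (\<lambda>b r. if dropv cap (app (app r r) (if b = Nl then Nl else Pair Nl Nl)) = Nl
     then app (app r r) (if b = Nl then Nl else Pair Nl Nl) else cap) (lst bits) Nl"

text \<open>Up to renaming colors, a single vertex has two states: it is not chosen as a b-vertex,
  or it is, and then every other color is still missing at it. \<open>val_snd k\<close> counts the
  other colors; without colors there is no state.\<close>

definition leaf_table :: "val \<Rightarrow> val \<Rightarrow> val \<Rightarrow> val" where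
  "leaf_table k A S = (if k = Nl then Nl else
     Pair (Pair Nl (Pair (Pair S (Pair Nl Nl)) (enc_list (map (\<lambda>_. Pair Nl (Pair Nl Nl)) (lst (val_snd k))))))
      (Pair (Pair Nl (Pair (Pair S (Pair (Pair Nl Nl) Nl)) (enc_list (map (\<lambda>_. Pair Nl (Pair Nl S)) (lst (val_snd k))))))
      Nl))"

definition leaf_vertex :: "val \<Rightarrow> val \<Rightarrow> val" where
  "leaf_vertex t p = val_fst (dropv (tou (ccap p) (val_snd t)) (cv p))"

definition leaf_step :: "val \<Rightarrow> val \<Rightarrow> val" where
  "leaf_step t p = Pair (Pair (leaf_vertex t p) Nl)
     (leaf_table (ck p) (Pair (leaf_vertex t p) Nl) (sat p (Pair (leaf_vertex t p) Nl) (Pair (leaf_vertex t p) Nl)))"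

definition accepting :: "val \<Rightarrow> bool" where
  "accepting r \<longleftrightarrow> (\<exists>c\<in>set (lst (val_snd r)). \<forall>t\<in>set (lst (val_snd c)). \<not> tb t = Nl \<and> tQ t = Nl)"

definition idx :: "val \<Rightarrow> val" where
  "idx l = foldr (\<lambda>a r. Pair (Pair (enc_list (map (\<lambda>_. Nl) (lst r))) a) r) (lst l) Nl"

text \<open>The cap is one more than the number of rows, so that a \<open>k\<close> beyond this
  number is not cut down to an admissible number of colors.\<close>

definition ctx_of :: "val \<Rightarrow> val \<Rightarrow> val" where
  "ctx_of rows kb = Pair (enc_list (map val_fst (lst rows)))
     (Pair (enc_list (concat (map (\<lambda>r. lst (enc_list (map (\<lambda>c. Pair (val_fst r) (val_fst c))
        (lst (enc_list (filter (\<lambda>c. \<not> val_snd c = Nl) (lst (idx (val_snd r))))))))) (lst rows))))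
     (Pair (tou (Pair Nl (enc_list (map (\<lambda>_. Nl) (lst rows)))) kb)
       (Pair Nl (enc_list (map (\<lambda>_. Nl) (lst rows))))))"

text \<open>Expects \<open>Pair matrix (Pair tree k)\<close>, with a binary tree and a \<open>k\<close> of polynomial size.\<close>

definition solve :: "val \<Rightarrow> val" where
  "solve x = enc_bool (accepting
     (trec node_step leaf_step (ctx_of (idx (val_fst x)) (snd_snd x)) (fst_snd x)))"

subsection \<open>Polynomial bounds for its parts\<close>

lemma fp_app: "fpr R A \<Longrightarrow> fpr R B \<Longrightarrow> fpr R (\<lambda>x. app (A x) (B x))"
  unfolding app_def by (rule fpr_append)

lemma fp_adjp:
  assumes "fpr R A" "fpr R B" "fpr R C"
  shows "fpr R (\<lambda>x. enc_bool (adjp (A x) (B x) (C x)))"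
  by (rule fp_lift3[OF _ assms, where f = "\<lambda>a b c. enc_bool (adjp a b c)"])
    (unfold adjp_def, intro fp_rules)

lemma fp_eqv:
  assumes "fpr R A" "fpr R B" "fpr R C" "fpr R D"
  shows "fpr R (\<lambda>x. enc_bool (eqv (A x) (B x) (C x) (D x)))"
  by (rule fp_lift4[OF _ assms, where f = "\<lambda>a b c d. enc_bool (eqv a b c d)"])
    (unfold eqv_def, intro fp_rules fp_adjp)

lemma fp_sat:
  assumes "fpr R A" "fpr R B" "fpr R C"
  shows "fpr R (\<lambda>x. sat (A x) (B x) (C x))"
  by (rule fp_lift3[OF _ assms, where f = sat]) (unfold sat_def, intro fp_rules fp_eqv)

lemma fp_compatible:
  assumes "fpr R A" "fpr R B" "fpr R C"
  shows "fpr R (\<lambda>x. enc_bool (compatible (A x) (B x) (C x)))"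
  by (rule fp_lift3[OF _ assms, where f = "\<lambda>a b c. enc_bool (compatible a b c)"])
    (unfold compatible_def, intro fp_rules fp_adjp)

lemma fp_unmet:
  assumes "fpr R A" "fpr R B" "fpr R C"
  shows "fpr R (\<lambda>x. unmet (A x) (B x) (C x))"
  by (rule fp_lift3[OF _ assms, where f = unmet]) (unfold unmet_def, intro fp_rules fp_adjp)

lemma fp_comb:
  assumes "fpr R A" "fpr R B" "fpr R C" "fpr R D"
  shows "fpr R (\<lambda>x. comb (A x) (B x) (C x) (D x))"
  by (rule fp_lift4[OF _ assms, where f = comb])
    (unfold comb_def, intro fp_rules fp_sat fp_unmet fp_app)

lemma fp_occurrences:
  assumes "fpr R A" "fpr R B"
  shows "fpr R (\<lambda>x. occurrences (A x) (B x))"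
  by (rule fp_lift2[OF _ assms, where f = occurrences]) (unfold occurrences_def, intro fp_rules)

lemma fp_same_mset:
  assumes "fpr R A" "fpr R B"
  shows "fpr R (\<lambda>x. enc_bool (same_mset (A x) (B x)))"
  by (rule fp_lift2[OF _ assms, where f = "\<lambda>a b. enc_bool (same_mset a b)"])
    (unfold same_mset_def, intro fp_rules fp_occurrences fp_app)

lemma size_enc_list_suffix: "size (enc_list zs) \<le> size (enc_list (ys @ zs))"
  by (simp add: size_enc_list)

lemma le_pow_1: "2 \<le> (m::nat) \<Longrightarrow> x \<le> m \<Longrightarrow> x \<le> m ^ Suc d"
  using pow_mono[of m 1 "Suc d"] by (simp del: power_Suc)

lemma fp_dedup:
  assumes "fpr R A"
  shows "fpr R (\<lambda>x. dedup (A x))"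
proof (rule fp_lift1[OF _ assms])
  let ?G = "\<lambda>a r x. if \<exists>b\<in>set (lst r). same_mset (val_fst a) (val_fst b) \<and> same_mset (val_snd a) (val_snd b)
     then r else Pair a r"
  have *: "size (foldr (\<lambda>a r. ?G a r x) zs Nl) \<le> size (enc_list zs)" for zs x
    by (induction zs) auto
  have "size (foldr (\<lambda>a r. ?G a r x) zs Nl) \<le> m ^ 1"
    if "sz x m" "lst x = ys @ zs" for x m ys zs
  proof -
    have "size x = size (enc_list (ys @ zs))" using that(2) by (metis enc_list_lst)
    then show ?thesis using *[of zs] size_enc_list_suffix[of zs ys] that(1) unfolding sz_def by simp
  qed
  then show "fp dedup" unfolding dedup_def
    by (intro fpr_foldr_size[where G = ?G] fp_rules fp_same_mset pb_sz_size) blast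
qed

lemma fp_ext:
  "fp (\<lambda>y. ext (snd_snd (snd_snd y)) (fst_snd (snd_snd y))
     (fst_snd (val_snd y)) (fst_snd y) (val_fst y))"
  unfolding ext_def by (intro fp_rules fp_comb fp_compatible fp_occurrences)

lemma fp_mstep:
  "fp (\<lambda>y. mstep (snd_snd (snd_snd (val_snd y)))
    (fst_snd (snd_snd (val_snd y)))
    (fst_snd (snd_snd y)) (val_fst y) (fst_snd y))"
proof -
  let ?p = "\<lambda>y. snd_snd (snd_snd (val_snd y))"
  let ?A = "\<lambda>y. fst_snd (snd_snd (val_snd y))"
  let ?s2 = "\<lambda>y. fst_snd (snd_snd y)"
  have "fp (\<lambda>z. Pair (val_fst z) (Pair (fst_snd z) (Pair (?s2 (val_snd z)) (Pair (?A (val_snd z)) (?p (val_snd z))))))"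
    by (intro fp_rules)
  from fpr_comp_fp[OF fp_ext this]
  have *: "fp (\<lambda>z. ext (?p (val_snd z)) (?A (val_snd z)) (?s2 (val_snd z)) (fst_snd z) (val_fst z))"
    by simp
  show ?thesis unfolding mstep_def
    by (intro fp_dedup fp_concat_map[where G = "\<lambda>c y. ext (?p y) (?A y) (?s2 y) (val_fst y) c"] * fp_rules)
qed

text \<open>
  The accumulators of \<open>match_fold\<close> are not of polynomial size for arbitrary values; their size is
  part of the precondition until it is derived from the width.
\<close>

definition match_bound :: "val \<Rightarrow> nat \<Rightarrow> bool" where
  "match_bound y m \<longleftrightarrow> size y \<le> m \<and> (\<forall>ys zs. lst (val_fst y) = ys @ zs \<longrightarrow>
     size (match_fold (snd_snd (val_snd y)) (fst_snd (val_snd y)) (fst_snd y) zs) \<le> m)"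

lemma match_bound_mono: "match_bound y m \<Longrightarrow> m \<le> m' \<Longrightarrow> match_bound y m'"
  unfolding match_bound_def by force

lemma pb_size_le: "(\<And>x m. R x m \<Longrightarrow> size x \<le> m) \<Longrightarrow> pb R size"
  unfolding pb_def by (metis power_one_right)

lemma fpr_match:
  "fpr match_bound (\<lambda>y. match_fold (snd_snd (val_snd y)) (fst_snd (val_snd y))
     (fst_snd y) (lst (val_fst y)))"
proof -
  have s: "pb match_bound size" by (rule pb_size_le) (simp add: match_bound_def)
  show ?thesis unfolding match_fold_def
  proof (rule fpr_foldr_size[where G = "\<lambda>s acc y. mstep (snd_snd (val_snd y))
     (fst_snd (val_snd y)) (fst_snd y) s acc"])
    show "\<exists>d. \<forall>x m ys zs. 2 \<le> m \<longrightarrow> match_bound x m \<longrightarrow> lst (val_fst x) = ys @ zs \<longrightarrow>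
       size (foldr (\<lambda>a r. mstep (snd_snd (val_snd x)) (fst_snd (val_snd x))
         (fst_snd x) a r) zs (Pair (Pair Nl Nl) Nl)) \<le> m ^ d"
      unfolding match_bound_def match_fold_def by (intro exI[of _ 1]) simp
  qed (intro fp_mstep s fpr_fst fpr_id fpr_Pair fpr_Nl)+
qed

lemma fp_strip: "fp strip"
  unfolding strip_def by (intro fp_rules)

definition merge_bound :: "val \<Rightarrow> nat \<Rightarrow> bool" where
  "merge_bound y m \<longleftrightarrow> size y \<le> m \<and> (\<forall>c1\<in>set (lst (val_fst y)). \<forall>c2\<in>set (lst (fst_snd y)).
     match_bound (Pair (val_snd c1) (Pair (val_snd c2) (snd_snd y))) m)"

text \<open>\<open>match_bound\<close> is only given for configurations from the two tables. So the
  precondition \<open>R1\<close> of the outer loop remembers that its variable comes from the first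
  table, and \<open>R2\<close> of the inner loop carries the bound for the current pair.\<close>

lemma fpr_merge:
  "fpr merge_bound (\<lambda>y. merge (val_fst y) (fst_snd y) (fst_snd (val_snd y))
     (snd_snd (val_snd y)))"
proof -
  have s: "pb merge_bound size" by (rule pb_size_le) (simp add: merge_bound_def)
  define R1 where "R1 z m \<longleftrightarrow> size z \<le> m \<and> merge_bound (val_snd z) m \<and>
    val_fst z \<in> set (lst (fst_snd z))" for z m
  define R2 where "R2 z m \<longleftrightarrow> match_bound (Pair (val_snd (fst_snd z))
     (Pair (val_snd (val_fst z)) (snd_snd (snd_snd z)))) m \<and> size z \<le> m" for z m
  have s1: "pb R1 size" by (rule pb_size_le) (simp add: R1_def)
  have s2: "pb R2 size" by (rule pb_size_le) (simp add: R2_def)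
  let ?t = "\<lambda>z. (Pair (val_snd (fst_snd z))
     (Pair (val_snd (val_fst z)) (snd_snd (snd_snd z))))"
  have "fpr R2 (\<lambda>z. (\<lambda>y. match_fold (snd_snd (val_snd y)) (fst_snd (val_snd y))
     (fst_snd y) (lst (val_fst y))) (?t z))"
    by (rule fpr_comp[OF fpr_match], intro fpr_Pair fpr_fst fpr_snd fpr_id s2)
      (unfold R2_def, intro exI[of _ 0], simp)
  from fpr_comp_fp[OF _ this, of strip] fp_strip have *: "fpr R2 (\<lambda>z. strip (match_fold (snd_snd (snd_snd (val_snd z)))
     (fst_snd (snd_snd (val_snd z)))
     (val_snd (val_fst z)) (lst (val_snd (fst_snd z)))))" by simp
  have size_pair: "size (Pair a x) \<le> m ^ Suc 1" if "2 \<le> m" "size x \<le> m" "size a < size x" for a x and m :: nat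
  proof -
    have "size (Pair a x) \<le> 2 * m" using that by simp
    also have "\<dots> \<le> m * m" using that by (intro mult_right_mono) auto
    finally show ?thesis by (simp add: power2_eq_square)
  qed
  have mono2: "match_bound y (m ^ Suc d)" if "match_bound y m" "2 \<le> m" for y m d
    using match_bound_mono[OF that(1) le_pow_1[OF that(2) order_refl]] .
  have mono: "merge_bound y (m ^ Suc d)" if "merge_bound y m" "2 \<le> m" for y m d
    using that(1) mono2[OF _ that(2)] le_pow_1[OF that(2), of _ d] unfolding merge_bound_def by blast
  show ?thesis unfolding merge_def
  proof (intro fp_dedup, rule fpr_concat_map_rel[where RG = R1 and G = "\<lambda>c1 y. enc_list (concat (map (\<lambda>c2.
     lst (strip (match_fold (snd_snd (val_snd y)) (fst_snd (val_snd y))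
       (val_snd c2) (lst (val_snd c1))))) (lst (fst_snd y))))"])
    show "fpr merge_bound val_fst" by (intro fpr_fst fpr_id s)
    show "fpr R1 (\<lambda>z. enc_list (concat (map (\<lambda>c2.
     lst (strip (match_fold (snd_snd (snd_snd z)) (fst_snd (snd_snd z))
       (val_snd c2) (lst (val_snd (val_fst z)))))) (lst (fst_snd (val_snd z))))))"
    proof (rule fpr_concat_map_rel[where RG = R2 and G = "\<lambda>c2 z. strip (match_fold (snd_snd (snd_snd z)) (fst_snd (snd_snd z))
       (val_snd c2) (lst (val_snd (val_fst z))))", OF _ *])
      show "fpr R1 (\<lambda>z. fst_snd (val_snd z))" by (intro fpr_fst fpr_snd fpr_id s1)
      have "R2 (Pair a x) (m ^ Suc 1)" if "2 \<le> m" "R1 x m" "a \<in> set (lst (fst_snd (val_snd x)))" for a x m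
      proof -
        have "size a < size x" using size_mem_lst[OF that(3)]
          using size_val_fst[of "snd_snd x"] size_val_snd[of "val_snd x"] size_val_snd[of x] by linarith
        with size_pair that show ?thesis unfolding R1_def R2_def
          by (auto simp: merge_bound_def simp del: power_Suc intro!: mono2)
      qed
      then show "\<exists>d. \<forall>x m a. 2 \<le> m \<longrightarrow> R1 x m \<longrightarrow> a \<in> set (lst (fst_snd (val_snd x))) \<longrightarrow> R2 (Pair a x) (m ^ Suc d)"
        by blast
    qed
    have "R1 (Pair a x) (m ^ Suc 1)" if "2 \<le> m" "merge_bound x m" "a \<in> set (lst (val_fst x))" for a x m
    proof -
      have "size a < size x" using size_mem_lst[OF that(3)]
        using size_val_fst[of x] by linarith
      moreover have "size x \<le> m" using that by (simp add: merge_bound_def)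
      ultimately show ?thesis using size_pair that mono unfolding R1_def by (simp del: power_Suc)
    qed
    then show "\<exists>d. \<forall>x m a. 2 \<le> m \<longrightarrow> merge_bound x m \<longrightarrow> a \<in> set (lst (val_fst x)) \<longrightarrow> R1 (Pair a x) (m ^ Suc d)"
      by blast
  qed
qed

definition node_bound :: "val \<Rightarrow> nat \<Rightarrow> bool" where
  "node_bound y m \<longleftrightarrow> size y \<le> m \<and> merge_bound (Pair (val_snd (val_fst y)) (Pair (val_snd (fst_snd y))
     (Pair (app (val_fst (val_fst y)) (val_fst (fst_snd y))) (snd_snd y)))) m"

lemma fpr_node_step:
  "fpr node_bound (\<lambda>y. node_step (val_fst y) (fst_snd y) (snd_snd y))"
proof -
  have s: "pb node_bound size" by (rule pb_size_le) (simp add: node_bound_def)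
  let ?A = "\<lambda>y. app (val_fst (val_fst y)) (val_fst (fst_snd y))"
  have "fpr node_bound (\<lambda>z. (\<lambda>y. merge (val_fst y) (fst_snd y) (fst_snd (val_snd y))
     (snd_snd (val_snd y))) (Pair (val_snd (val_fst z)) (Pair (val_snd (fst_snd z))
     (Pair (?A z) (snd_snd z)))))"
    by (rule fpr_comp[OF fpr_merge], intro fpr_Pair fpr_fst fpr_snd fpr_id s fp_app)
      (unfold node_bound_def, intro exI[of _ 0], simp)
  then show ?thesis unfolding node_step_def
    by (intro fpr_Pair fp_app fpr_fst fpr_snd fpr_id s) simp
qed

section \<open>Indexing, conversion of numbers and construction of the context\<close>

lemma dropv_conv: "dropv a b = enc_list (drop (length (lst a)) (lst b))"
proof -
  have "foldr (\<lambda>_ r. val_snd r) xs b = enc_list (drop (length xs) (lst b))" for xs :: "val list"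
  proof (induction xs)
    case (Cons a xs)
    have "val_snd (enc_list ys) = enc_list (tl ys)" for ys by (cases ys) auto
    then show ?case using Cons by (simp add: drop_Suc tl_drop)
  qed simp
  then show ?thesis unfolding dropv_def .
qed

lemma fp_dropv:
  assumes "fpr R A" "fpr R B"
  shows "fpr R (\<lambda>x. dropv (A x) (B x))"
proof (rule fp_lift2[OF _ assms])
  have *: "size (foldr (\<lambda>_ r. val_snd r) zs b) \<le> size b" for zs :: "val list" and b
    using size_val_snd order_trans by (induction zs) auto
  have "size (foldr (\<lambda>_ r. val_snd r) zs (val_snd x)) \<le> m ^ 1" if "sz x m" for x m and zs :: "val list"
    using that size_val_snd[of x] *[of zs "val_snd x"] unfolding sz_def by simp
  then show "fp (\<lambda>y. dropv (val_fst y) (val_snd y))" unfolding dropv_def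
    by (intro fpr_foldr_size[where G = "\<lambda>a r x. val_snd r"] fp_rules pb_sz_size) blast
qed

lemma fp_tou:
  assumes "fpr R A" "fpr R B"
  shows "fpr R (\<lambda>x. tou (A x) (B x))"
proof (rule fp_lift2[OF _ assms])
  let ?r = "\<lambda>b r. app (app r r) (if b = Nl then Nl else Pair Nl Nl)"
  let ?G = "\<lambda>b r x. if dropv (val_fst x) (?r b r) = Nl then ?r b r else val_fst x"
  have unary: "size (enc_list xs) = length xs" if "set xs \<subseteq> {Nl}" for xs
    using that by (induction xs) auto
  \<comment> \<open>The cap is an arbitrary value here, so the result is either the cap or unary. A
    doubled cap passes the test only if it is the empty list.\<close>
  have *: "size (foldr (\<lambda>a r. ?G a r x) zs Nl) \<le> size (val_fst x) \<and>
     (foldr (\<lambda>a r. ?G a r x) zs Nl = val_fst x \<or> set (lst (foldr (\<lambda>a r. ?G a r x) zs Nl)) \<subseteq> {Nl})" for zs x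
  proof (induction zs)
    case (Cons b zs)
    let ?q = "foldr (\<lambda>a r. ?G a r x) zs Nl"
    show ?case
    proof (cases "dropv (val_fst x) (?r b ?q) = Nl")
      case True
      then have len: "length (lst (?r b ?q)) \<le> length (lst (val_fst x))"
        by (simp add: dropv_conv)
      have "set (lst ?q) \<subseteq> {Nl}"
      proof (cases "?q = val_fst x")
        case True
        with len have "length (lst ?q) = 0" by (simp add: app_def)
        then show ?thesis by simp
      qed (use Cons in blast)
      then have sub: "set (lst (?r b ?q)) \<subseteq> {Nl}" by (auto simp: app_def)
      have "size (?r b ?q) = length (lst (?r b ?q))" using unary[OF sub] by simp
      also have "\<dots> \<le> size (val_fst x)" using len length_lst_le order_trans by blast
      finally show ?thesis using True sub by simp
    qed simp
  qed simp
  have "size (foldr (\<lambda>a r. ?G a r x) zs Nl) \<le> m ^ 1" if "sz x m" for x m and zs :: "val list"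
    using conjunct1[OF *[of x zs]] that size_val_fst[of x] unfolding sz_def by simp
  then show "fp (\<lambda>y. tou (val_fst y) (val_snd y))" unfolding tou_def
    by (intro fpr_foldr_size[where G = ?G] fp_rules fp_dropv fp_app pb_sz_size) blast
qed

lemma fp_leaf_step: "fp (\<lambda>y. leaf_step (val_fst y) (val_snd y))"
  unfolding leaf_step_def leaf_table_def leaf_vertex_def
  by (intro fp_rules fp_sat fp_dropv fp_tou)

lemma fp_accepting: "fp (\<lambda>y. enc_bool (accepting y))"
  unfolding accepting_def by (intro fp_rules)

lemma idx_conv: "idx l = enc_list (map (\<lambda>i. Pair (enc_list (replicate (length (lst l) - 1 - i) Nl)) (lst l ! i)) [0..<length (lst l)])"
proof -
  let ?G = "\<lambda>a r. Pair (Pair (enc_list (map (\<lambda>_. Nl) (lst r))) a) r"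
  have "foldr ?G xs Nl = enc_list (map (\<lambda>i. Pair (enc_list (replicate (length xs - 1 - i) Nl)) (xs ! i)) [0..<length xs])" for xs
  proof (induction xs)
    case (Cons a xs)
    have "map (\<lambda>i. Pair (enc_list (replicate (length (a # xs) - 1 - i) Nl)) ((a # xs) ! i)) [0..<length (a # xs)]
      = Pair (enc_list (replicate (length xs) Nl)) a #
        map (\<lambda>i. Pair (enc_list (replicate (length xs - 1 - i) Nl)) (xs ! i)) [0..<length xs]"
      by (simp add: map_upt_Suc del: upt_Suc)
    moreover have "map (\<lambda>_. Nl) ys = replicate (length ys) Nl" for ys :: "val list" by (simp add: map_replicate_const)
    ultimately show ?case using Cons by simp
  qed simp
  then show ?thesis unfolding idx_def .
qed

lemma fp_idx:
  assumes "fpr R A"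
  shows "fpr R (\<lambda>x. idx (A x))"
proof (rule fp_lift1[OF _ assms])
  let ?G = "\<lambda>a r x. Pair (Pair (enc_list (map (\<lambda>_. Nl) (lst r))) a) r"
  have unary: "size (enc_list (map (\<lambda>_. Nl) xs)) = length xs" for xs :: "val list"
    by (induction xs) auto
  have *: "size (foldr (\<lambda>a r. ?G a r x) zs Nl) \<le> length zs * length zs + length zs + size (enc_list zs) \<and>
      length (lst (foldr (\<lambda>a r. ?G a r x) zs Nl)) = length zs" for zs and x :: val
    by (induction zs) (auto simp: unary)
  have "size (foldr (\<lambda>a r. ?G a r x) zs Nl) \<le> m ^ Suc (Suc (2 + 1) + 1)"
    if "2 \<le> m" "sz x m" "lst x = ys @ zs" for x m ys zs
  proof -
    have "size (enc_list zs) \<le> m" using size_enc_list_suffix[of zs ys] that unfolding sz_def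
      using enc_list_lst[of x] by simp
    moreover from this have "length zs \<le> m" using length_lst_le[of "enc_list zs"] by simp
    ultimately have "length zs * length zs + length zs + size (enc_list zs) \<le> m ^ Suc (Suc (2 + 1) + 1)"
      using that(1) by (intro pow_add_le) (auto simp: power2_eq_square intro: mult_le_mono)
    with * show ?thesis by (meson order_trans)
  qed
  then show "fp idx" unfolding idx_def
    by (intro fpr_foldr_size[where G = ?G] fp_rules pb_sz_size) blast
qed

lemma fp_ctx_of: "fp (\<lambda>y. ctx_of (val_fst y) (val_snd y))"
  unfolding ctx_of_def by (intro fp_rules fp_tou fp_idx)

definition solve_ctx :: "val \<Rightarrow> val" where
  "solve_ctx x = ctx_of (idx (val_fst x)) (snd_snd x)"

text \<open>Collects the size assumptions on all tables met in the recursion; for encoded instances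
  they are established in \<open>solve_bound_inst\<close>.\<close>

definition solve_bound :: "val \<Rightarrow> nat \<Rightarrow> bool" where
  "solve_bound x m \<longleftrightarrow> size x \<le> m \<and> (\<forall>s\<in>nodes (fst_snd x). val_fst s \<noteq> Nl \<longrightarrow>
     node_bound (Pair (trec node_step leaf_step (solve_ctx x) (val_fst s))
       (Pair (trec node_step leaf_step (solve_ctx x) (val_snd s)) (solve_ctx x))) m)"

lemma node_bound_mono: "node_bound y m \<Longrightarrow> m \<le> m' \<Longrightarrow> node_bound y m'"
  using match_bound_mono[of _ m m'] unfolding node_bound_def merge_bound_def by auto

lemma size_nodes: "s \<in> nodes t \<Longrightarrow> size s \<le> size t"
  by (induction rule: nodes.induct) (auto intro: order_trans[OF size_val_fst] order_trans[OF size_val_snd])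

lemma fpr_solve: "fpr solve_bound solve"
proof -
  let ?F = "trec node_step leaf_step"
  define R where "R z m \<longleftrightarrow> size z \<le> m \<and> (\<forall>s\<in>nodes (val_fst z). val_fst s \<noteq> Nl \<longrightarrow>
     node_bound (Pair (?F (val_snd z) (val_fst s)) (Pair (?F (val_snd z) (val_snd s)) (val_snd z))) m)" for z m
  have sR: "pb R size" by (rule pb_size_le) (simp add: R_def)
  have sS: "pb solve_bound size" by (rule pb_size_le) (simp add: solve_bound_def)
  have 1: "fpr R (\<lambda>z. ?F (val_snd z) (val_fst z))"
  proof (rule fpr_trec[OF sR fpr_node_step fp_leaf_step])
    have "(if val_fst s = Nl then sz (Pair s (val_snd x)) (m ^ Suc 1)
       else node_bound (Pair (?F (val_snd x) (val_fst s)) (Pair (?F (val_snd x) (val_snd s)) (val_snd x))) (m ^ Suc 1))"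
      if "s \<in> nodes (val_fst x)" "2 \<le> m" "R x m" for s x m
    proof (cases "val_fst s = Nl")
      case True
      have m: "size x \<le> m" using that(3) by (simp add: R_def)
      have "size s + size (val_snd x) + 1 \<le> size (val_fst x) + size (val_snd x) + 1"
        using size_nodes[OF that(1)] by simp
      also have "\<dots> \<le> size x + 1" by (cases x) auto
      also have "\<dots> \<le> 2 * m" using m that(2) by simp
      also have "\<dots> \<le> m * m" using that(2) by (intro mult_right_mono) auto
      finally show ?thesis using True by (simp add: sz_def)
    next
      case False
      with that show ?thesis unfolding R_def
        by (simp del: power_Suc add: node_bound_mono[OF _ le_pow_1[OF that(2) order_refl]])
    qed
    then show "\<exists>d. \<forall>x m. \<forall>s\<in>nodes (val_fst x). 2 \<le> m \<longrightarrow> R x m \<longrightarrow> (if val_fst s = Nl then sz (Pair s (val_snd x)) (m ^ Suc d)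
       else node_bound (Pair (?F (val_snd x) (val_fst s)) (Pair (?F (val_snd x) (val_snd s)) (val_snd x))) (m ^ Suc d))"
      by blast
  qed
  define prep where "prep x = Pair (fst_snd x) (solve_ctx x)" for x
  have lift: "fpr R' (\<lambda>x. ctx_of (A x) (B x))" if "fpr R' A" "fpr R' B" for R' A B
    by (rule fp_lift2[OF fp_ctx_of that])
  have 2: "fpr solve_bound prep" unfolding prep_def solve_ctx_def
    by (intro lift fpr_Pair fpr_fst fpr_snd fpr_id sS fp_idx)
  have "fpr solve_bound (\<lambda>x. (\<lambda>z. ?F (val_snd z) (val_fst z)) (prep x))"
  proof (rule fpr_comp[OF 1 2])
    obtain c where c: "\<And>x m. 2 \<le> m \<Longrightarrow> solve_bound x m \<Longrightarrow> size (prep x) \<le> m ^ c"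
      using 2 unfolding fpr_def pb_def by blast
    have "R (prep x) (m ^ Suc c)" if "2 \<le> m" "solve_bound x m" for x m
    proof -
      have "size (prep x) \<le> m ^ Suc c" using c[OF that] pow_mono[OF that(1), of c "Suc c"] by linarith
      then show ?thesis using that unfolding R_def solve_bound_def prep_def
        by (simp del: power_Suc add: node_bound_mono[OF _ le_pow_1[OF that(1) order_refl]])
    qed
    then show "\<exists>d. \<forall>x m. 2 \<le> m \<longrightarrow> solve_bound x m \<longrightarrow> R (prep x) (m ^ Suc d)" by blast
  qed
  from fpr_comp_fp[OF fp_accepting this]
  show ?thesis unfolding solve_def prep_def solve_ctx_def by simp
qed

section \<open>Correctness of the dynamic program\<close>

subsection \<open>Multisets as lists\<close>

lemma filter_eq_replicate_count: "filter (\<lambda>b. a = b) xs = replicate (count (mset xs) a) a"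
  by (induction xs) auto

lemma occurrences_eq_iff: "occurrences a xs = occurrences a ys \<longleftrightarrow> count (mset (lst xs)) a = count (mset (lst ys)) a"
proof
  assume "occurrences a xs = occurrences a ys"
  then have "length (lst (occurrences a xs)) = length (lst (occurrences a ys))" by simp
  then show "count (mset (lst xs)) a = count (mset (lst ys)) a"
    by (simp add: occurrences_def filter_eq_replicate_count)
qed (simp add: occurrences_def filter_eq_replicate_count)

lemma same_mset_iff: "same_mset xs ys \<longleftrightarrow> mset (lst xs) = mset (lst ys)"
proof
  assume *: "same_mset xs ys"
  show "mset (lst xs) = mset (lst ys)"
  proof (rule multiset_eqI)
    fix a
    show "count (mset (lst xs)) a = count (mset (lst ys)) a"
    proof (cases "a \<in> set (lst xs) \<union> set (lst ys)")
      case True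
      with * show ?thesis by (auto simp: same_mset_def occurrences_eq_iff app_def)
    next
      case False
      then show ?thesis by (metis UnI1 UnI2 count_inI set_mset_mset)
    qed
  qed
qed (simp add: same_mset_def occurrences_eq_iff)

definition ckey :: "val \<Rightarrow> val multiset \<times> val multiset" where
  "ckey c = (mset (lst (val_fst c)), mset (lst (val_snd c)))"

lemma dedup_props:
  "set (lst (dedup L)) \<subseteq> set (lst L)"
  "ckey ` set (lst (dedup L)) = ckey ` set (lst L)"
  "distinct (map ckey (lst (dedup L)))"
proof -
  let ?G = "\<lambda>a r. if \<exists>b\<in>set (lst r). same_mset (val_fst a) (val_fst b) \<and> same_mset (val_snd a) (val_snd b)
     then r else Pair a r"
  have G: "?G = (\<lambda>a r. if ckey a \<in> ckey ` set (lst r) then r else Pair a r)"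
    by (auto simp: fun_eq_iff same_mset_iff ckey_def)
  have "set (lst (foldr ?G xs Nl)) \<subseteq> set xs \<and> ckey ` set (lst (foldr ?G xs Nl)) = ckey ` set xs \<and>
     distinct (map ckey (lst (foldr ?G xs Nl)))" for xs
    unfolding G by (induction xs) auto
  then show "set (lst (dedup L)) \<subseteq> set (lst L)" "ckey ` set (lst (dedup L)) = ckey ` set (lst L)"
    "distinct (map ckey (lst (dedup L)))" unfolding dedup_def by blast+
qed

lemma dedup_ckey:
  assumes "c \<in> set (lst L)"
  shows "\<exists>e. e \<in> set (lst (dedup L)) \<and> ckey e = ckey c"
proof -
  have "ckey c \<in> ckey ` set (lst (dedup L))" unfolding dedup_props(2) using assms by (rule imageI)
  then show ?thesis by (elim imageE) (intro exI conjI, assumption, rule sym)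
qed

subsection \<open>Matching the colours of two states\<close>

lemma lst_ext: "lst (ext p A s2 s c) = map (\<lambda>t. Pair (Pair t (val_fst c)) (Pair (comb p A s t) (val_snd c)))
  (filter (\<lambda>t. compatible p s t \<and> count (mset (lst (val_fst c))) t \<noteq> count (mset (lst s2)) t) (lst s2))"
  by (simp add: ext_def occurrences_eq_iff)

lemma match_fold_Cons: "match_fold p A s2 (s # zs) = mstep p A s2 s (match_fold p A s2 zs)"
  by (simp add: match_fold_def)

lemma match_fold_sound:
  assumes "c \<in> set (lst (match_fold p A s2 zs))"
  shows "mset (lst (val_fst c)) \<subseteq># mset (lst s2) \<and> list_all2 (compatible p) zs (lst (val_fst c)) \<and>
    lst (val_snd c) = map2 (comb p A) zs (lst (val_fst c))"
  using assms
proof (induction zs arbitrary: c)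
  case Nil
  then show ?case by (simp add: match_fold_def)
next
  case (Cons s zs)
  have "c \<in> set (lst (enc_list (concat (map (\<lambda>c. lst (ext p A s2 s c)) (lst (match_fold p A s2 zs))))))"
    using Cons.prems unfolding match_fold_Cons mstep_def by (rule subsetD[OF dedup_props(1)])
  then obtain d where d: "d \<in> set (lst (match_fold p A s2 zs))" "c \<in> set (lst (ext p A s2 s d))"
    unfolding lst_enc_list set_concat set_map by blast
  let ?P = "\<lambda>t. compatible p s t \<and> count (mset (lst (val_fst d))) t \<noteq> count (mset (lst s2)) t"
  let ?f = "\<lambda>t. Pair (Pair t (val_fst d)) (Pair (comb p A s t) (val_snd d))"
  have "c \<in> ?f ` {t \<in> set (lst s2). ?P t}" using d(2) unfolding lst_ext by (simp only: set_map set_filter)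
  then obtain t where "c = ?f t" "t \<in> {t \<in> set (lst s2). ?P t}" by (rule imageE)
  then have t: "t \<in> set (lst s2)" "compatible p s t" "count (mset (lst (val_fst d))) t \<noteq> count (mset (lst s2)) t"
    and c: "c = ?f t" by simp_all
  note IH = Cons.IH[OF d(1)]
  \<comment> \<open>\<open>ext\<close> only tests that the two multiplicities of \<open>t\<close>
    differ. Together with the inclusion known for \<open>d\<close>, this means that a copy of
    \<open>t\<close> is still free.\<close>
  have "add_mset t (mset (lst (val_fst d))) \<subseteq># mset (lst s2)"
  proof (rule mset_subset_eqI)
    fix a
    have "count (mset (lst (val_fst d))) b \<le> count (mset (lst s2)) b" for b
      by (rule mset_subset_eq_count[OF conjunct1[OF IH]])
    from this[of a] this[of t] t(3)
    show "count (add_mset t (mset (lst (val_fst d)))) a \<le> count (mset (lst s2)) a" by auto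
  qed
  then show ?case using IH t c by simp
qed

text \<open>\<open>dedup\<close> may have dropped the intended configuration, but \<open>ext\<close>
  looks at the used types only through their multiplicities. Any representative with the same key
  can therefore be continued in the same way.\<close>

lemma match_fold_complete:
  assumes "list_all2 (compatible p) zs us" "mset us \<subseteq># mset (lst s2)"
  shows "\<exists>c\<in>set (lst (match_fold p A s2 zs)). ckey c = (mset us, mset (map2 (comb p A) zs us))"
  using assms
proof (induction zs arbitrary: us)
  case Nil
  then show ?case by (simp add: match_fold_def ckey_def)
next
  case (Cons s zs)
  then obtain t us' where us: "us = t # us'" "compatible p s t" "list_all2 (compatible p) zs us'"
    by (cases us) auto
  have sub: "add_mset t (mset us') \<subseteq># mset (lst s2)" using Cons.prems us by simp
  then have "mset us' \<subseteq># mset (lst s2)" by (metis mset_subset_eq_insertD subset_mset.less_imp_le)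
  from Cons.IH[OF us(3) this] obtain d where d: "d \<in> set (lst (match_fold p A s2 zs))"
    "ckey d = (mset us', mset (map2 (comb p A) zs us'))" by blast
  have "Suc (count (mset us') t) \<le> count (mset (lst s2)) t"
    using mset_subset_eq_count[OF sub, of t] by simp
  then have cnt: "count (mset (lst (val_fst d))) t \<noteq> count (mset (lst s2)) t"
    using d(2) by (simp add: ckey_def)
  have t: "t \<in> set (lst s2)" using mset_subset_eqD[OF sub, of t] by simp
  define c where "c = Pair (Pair t (val_fst d)) (Pair (comb p A s t) (val_snd d))"
  let ?L = "enc_list (concat (map (\<lambda>c. lst (ext p A s2 s c)) (lst (match_fold p A s2 zs))))"
  have "c \<in> set (lst ?L)" using d(1) t us(2) cnt unfolding c_def by (auto simp: lst_ext)
  then obtain e where "e \<in> set (lst (dedup ?L))" "ckey e = ckey c"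
    using dedup_ckey[of c ?L] by blast
  moreover have "ckey c = (mset us, mset (map2 (comb p A) (s # zs) us))"
    using d(2) us(1) by (simp add: c_def ckey_def)
  ultimately show ?case unfolding match_fold_Cons mstep_def by metis
qed

lemma match_fold_distinct: "distinct (map ckey (lst (match_fold p A s2 zs)))"
  by (cases zs) (simp_all add: match_fold_Cons mstep_def dedup_props(3) match_fold_def)

subsection \<open>Partial solutions and their states\<close>

locale graph_ctx =
  fixes p :: val and k :: nat
  assumes distinct_verts: "distinct (lst (cv p))"
    and adj_sym: "adjp p u v \<Longrightarrow> adjp p v u"
    and adj_irrefl: "\<not> adjp p u u"
begin

abbreviation V :: "val set" where "V \<equiv> set (lst (cv p))"
abbreviation adj :: "val \<Rightarrow> val \<Rightarrow> bool" where "adj \<equiv> adjp p"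

definition eqS :: "val set \<Rightarrow> val \<Rightarrow> val \<Rightarrow> bool" where
  "eqS A u v \<longleftrightarrow> u \<in> A \<and> v \<in> A \<and> (\<forall>z\<in>V. z \<in> A \<or> (adj u z \<longleftrightarrow> adj v z))"

definition cl :: "val set \<Rightarrow> val set \<Rightarrow> val set" where
  "cl A X = {v \<in> A. \<exists>u\<in>X. eqS A u v}"

definition satS :: "val set \<Rightarrow> val set \<Rightarrow> val" where
  "satS A X = enc_list (filter (\<lambda>v. v \<in> cl A X) (lst (cv p)))"

lemma sat_conv: "sat p a X = satS (set (lst a)) (set (lst X))"
proof -
  have "(\<exists>u\<in>set (lst X). eqv p a u v) \<longleftrightarrow> v \<in> cl (set (lst a)) (set (lst X))" for v
    by (auto simp: eqv_def eqS_def cl_def)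
  then show ?thesis unfolding sat_def satS_def by simp
qed

lemma set_satS: "A \<subseteq> V \<Longrightarrow> set (lst (satS A X)) = cl A X"
  by (auto simp: satS_def cl_def)

lemma eqS_refl: "u \<in> A \<Longrightarrow> eqS A u u"
  by (simp add: eqS_def)

lemma eqS_trans: "eqS A u v \<Longrightarrow> eqS A v w \<Longrightarrow> eqS A u w"
  unfolding eqS_def by blast

lemma eqS_mono: "eqS A u v \<Longrightarrow> A \<subseteq> B \<Longrightarrow> eqS B u v"
  unfolding eqS_def by blast

lemma eqS_adj: "eqS A u v \<Longrightarrow> z \<in> V \<Longrightarrow> z \<notin> A \<Longrightarrow> adj u z \<longleftrightarrow> adj v z"
  unfolding eqS_def by blast

text \<open>Fewer vertices lie outside the union, so classes of the parts lie inside classes of the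
  union, and saturating in the parts first adds nothing.\<close>

lemma cl_union:
  assumes "X1 \<subseteq> A1" "X2 \<subseteq> A2"
  shows "cl (A1 \<union> A2) (cl A1 X1 \<union> cl A2 X2) = cl (A1 \<union> A2) (X1 \<union> X2)"
proof
  show "cl (A1 \<union> A2) (cl A1 X1 \<union> cl A2 X2) \<subseteq> cl (A1 \<union> A2) (X1 \<union> X2)"
    unfolding cl_def using eqS_mono[of A1 _ _ "A1 \<union> A2"] eqS_mono[of A2 _ _ "A1 \<union> A2"] eqS_trans by blast
  show "cl (A1 \<union> A2) (X1 \<union> X2) \<subseteq> cl (A1 \<union> A2) (cl A1 X1 \<union> cl A2 X2)"
    unfolding cl_def using assms eqS_refl by blast
qed

definition ftyp :: "(val \<Rightarrow> nat) \<Rightarrow> val set \<Rightarrow> val set \<Rightarrow> nat \<Rightarrow> val" where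
  "ftyp f A D j = Pair (satS A {v \<in> A. f v = j}) (Pair (enc_bool (\<exists>v\<in>D. f v = j))
     (satS A {v \<in> D. f v \<noteq> j \<and> \<not> (\<exists>u\<in>A. f u = j \<and> adj v u)}))"

text \<open>Colors are numbered from 0 here. Injectivity of \<open>f\<close> on \<open>D\<close>
  allows at most one chosen b-vertex per color; that every color has one is only required at the
  root.\<close>

definition valid :: "val set \<Rightarrow> (val \<Rightarrow> nat) \<Rightarrow> val set \<Rightarrow> bool" where
  "valid A f D \<longleftrightarrow> (\<forall>v\<in>A. f v < k) \<and> D \<subseteq> A \<and> inj_on f D \<and> (\<forall>u\<in>A. \<forall>v\<in>A. adj u v \<longrightarrow> f u \<noteq> f v)"

definition states :: "val set \<Rightarrow> val list set" where
  "states A = {map (ftyp f A D) [0..<k] | f D. valid A f D}"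

lemma statesI: "valid A f D \<Longrightarrow> map (ftyp f A D) [0..<k] \<in> states A"
  unfolding states_def by auto

lemma ftyp_cong: "D \<subseteq> A \<Longrightarrow> (\<And>v. v \<in> A \<Longrightarrow> f v = g v) \<Longrightarrow> ftyp f A D j = ftyp g A D j"
proof -
  assume *: "D \<subseteq> A" "\<And>v. v \<in> A \<Longrightarrow> f v = g v"
  have "{v \<in> A. f v = j} = {v \<in> A. g v = j}"
    "(\<exists>v\<in>D. f v = j) = (\<exists>v\<in>D. g v = j)"
    "{v \<in> D. f v \<noteq> j \<and> \<not> (\<exists>u\<in>A. f u = j \<and> adj v u)} = {v \<in> D. g v \<noteq> j \<and> \<not> (\<exists>u\<in>A. g u = j \<and> adj v u)}"
    using * by (auto simp: subset_iff)
  then show ?thesis unfolding ftyp_def by simp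
qed

lemma valid_cong: "(\<And>v. v \<in> A \<Longrightarrow> f v = g v) \<Longrightarrow> valid A f D \<Longrightarrow> valid A g D"
  unfolding valid_def by (auto cong: inj_on_cong simp: subset_iff inj_on_def)

text \<open>Permuting the list is renaming the colors: composing \<open>f\<close> with the inverse
  permutation realizes it.\<close>

lemma states_perm:
  assumes "\<sigma> \<in> states A" "mset \<sigma>' = mset \<sigma>"
  shows "\<sigma>' \<in> states A"
proof -
  obtain f D where fD: "\<sigma> = map (ftyp f A D) [0..<k]" "valid A f D" using assms(1) unfolding states_def by blast
  obtain \<pi> where \<pi>: "\<pi> permutes {..<length \<sigma>}" "permute_list \<pi> \<sigma> = \<sigma>'"
    using mset_eq_permutation[OF assms(2)] by blast
  have len: "length \<sigma> = k" using fD by simp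
  define g where "g = (\<lambda>v. inv \<pi> (f v))"
  have pk: "\<pi> permutes {..<k}" using \<pi>(1) len by simp
  have g_iff: "g v = j \<longleftrightarrow> f v = \<pi> j" for v j
    unfolding g_def using permutes_inverses[OF pk] by metis
  have "ftyp g A D j = ftyp f A D (\<pi> j)" for j
    unfolding ftyp_def g_iff by simp
  moreover have "\<sigma>' = map (\<lambda>j. \<sigma> ! \<pi> j) [0..<k]"
    using \<pi>(2) len unfolding permute_list_def by simp
  moreover have "\<pi> j < k" if "j < k" for j using permutes_in_image[OF pk, of j] that by simp
  ultimately have "\<sigma>' = map (ftyp g A D) [0..<k]" using fD(1) by simp
  moreover have "inv \<pi> x = inv \<pi> y \<longleftrightarrow> x = y" for x y
    using permutes_inj[OF permutes_inv[OF pk]] by (simp add: inj_eq)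
  then have "valid A g D"
    using fD(2) permutes_in_image[OF permutes_inv[OF pk]]
    unfolding valid_def g_def by (simp add: inj_on_def)
  ultimately show ?thesis using statesI by simp
qed

text \<open>The types carry all that is needed of the coloring. Equivalent vertices of
  \<open>A1\<close> have the same neighbors in \<open>A2\<close> and vice versa, so for edges
  across, a color class or a set of demands may be replaced by its saturation. A demand is open in
  the union iff it is open on its own side and not met across.\<close>

lemma comb_ftyp:
  assumes "A1 \<inter> A2 = {}" "A1 \<subseteq> V" "A2 \<subseteq> V" "D1 \<subseteq> A1" "D2 \<subseteq> A2" "set (lst a) = A1 \<union> A2"
  shows "comb p a (ftyp f A1 D1 j) (ftyp f A2 D2 j) = ftyp f (A1 \<union> A2) (D1 \<union> D2) j"
proof -
  define X1 where "X1 = {v \<in> D1. f v \<noteq> j \<and> \<not> (\<exists>u\<in>A1. f u = j \<and> adj v u)}"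
  define X2 where "X2 = {v \<in> D2. f v \<noteq> j \<and> \<not> (\<exists>u\<in>A2. f u = j \<and> adj v u)}"
  define C1 where "C1 = {v \<in> A1. f v = j}"
  define C2 where "C2 = {v \<in> A2. f v = j}"
  have sub: "X1 \<subseteq> A1" "X2 \<subseteq> A2" "C1 \<subseteq> A1" "C2 \<subseteq> A2"
    using assms unfolding X1_def X2_def C1_def C2_def by auto
  have unmet: "set (lst (unmet p (satS B Y) (satS B' C))) = cl B {v \<in> Y. \<not> (\<exists>u\<in>C. adj v u)}"
    if "B \<inter> B' = {}" "B \<subseteq> V" "B' \<subseteq> V" "Y \<subseteq> B" "C \<subseteq> B'" for B B' Y C
  proof -
    have 1: "(\<exists>u\<in>cl B' C. adj v u) \<longleftrightarrow> (\<exists>u\<in>C. adj v u)" if "v \<in> B" for v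
    proof
      assume "\<exists>u\<in>cl B' C. adj v u"
      then obtain u u' where "adj v u" "u' \<in> C" "eqS B' u' u" unfolding cl_def by blast
      then show "\<exists>u\<in>C. adj v u" using eqS_adj[of B' u' u v] that \<open>B \<inter> B' = {}\<close> \<open>B \<subseteq> V\<close> adj_sym by blast
    qed (use \<open>C \<subseteq> B'\<close> eqS_refl in \<open>unfold cl_def, blast\<close>)
    have 2: "(\<exists>u\<in>C. adj v u) \<longleftrightarrow> (\<exists>u\<in>C. adj v' u)" if "eqS B v v'" for v v'
      using eqS_adj[OF that] \<open>C \<subseteq> B'\<close> \<open>B' \<subseteq> V\<close> \<open>B \<inter> B' = {}\<close> by blast
    have "set (lst (unmet p (satS B Y) (satS B' C))) = {v \<in> cl B Y. \<not> (\<exists>u\<in>cl B' C. adj v u)}"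
      unfolding unmet_def using set_satS that by simp
    also have "\<dots> = {v \<in> cl B Y. \<not> (\<exists>u\<in>C. adj v u)}" using 1 by (auto simp: cl_def)
    also have "\<dots> = cl B {v \<in> Y. \<not> (\<exists>u\<in>C. adj v u)}" unfolding cl_def using 2 by blast
    finally show ?thesis .
  qed
  have "sat p a (app (satS A1 C1) (satS A2 C2)) = satS (A1 \<union> A2) {v \<in> A1 \<union> A2. f v = j}"
  proof -
    have "C1 \<union> C2 = {v \<in> A1 \<union> A2. f v = j}" unfolding C1_def C2_def by auto
    then show ?thesis using cl_union[OF sub(3,4)] assms
      by (simp add: sat_conv app_def set_satS) (simp add: satS_def)
  qed
  moreover have "sat p a (app (unmet p (satS A1 X1) (satS A2 C2)) (unmet p (satS A2 X2) (satS A1 C1))) =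
      satS (A1 \<union> A2) {v \<in> D1 \<union> D2. f v \<noteq> j \<and> \<not> (\<exists>u\<in>A1 \<union> A2. f u = j \<and> adj v u)}"
  proof -
    let ?Y1 = "{v \<in> X1. \<not> (\<exists>u\<in>C2. adj v u)}" and ?Y2 = "{v \<in> X2. \<not> (\<exists>u\<in>C1. adj v u)}"
    have "set (lst (unmet p (satS A1 X1) (satS A2 C2))) = cl A1 ?Y1"
      "set (lst (unmet p (satS A2 X2) (satS A1 C1))) = cl A2 ?Y2"
      by (rule unmet; use assms sub in blast)+
    moreover have "?Y1 \<union> ?Y2 = {v \<in> D1 \<union> D2. f v \<noteq> j \<and> \<not> (\<exists>u\<in>A1 \<union> A2. f u = j \<and> adj v u)}"
      unfolding X1_def X2_def C1_def C2_def by auto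
    moreover have "cl (A1 \<union> A2) (cl A1 ?Y1 \<union> cl A2 ?Y2) = cl (A1 \<union> A2) (?Y1 \<union> ?Y2)"
      using sub by (intro cl_union) auto
    ultimately show ?thesis using assms(6)
      by (simp add: sat_conv app_def) (simp add: satS_def)
  qed
  moreover have "(if enc_bool (\<exists>v\<in>D1. f v = j) = Nl then enc_bool (\<exists>v\<in>D2. f v = j) else enc_bool (\<exists>v\<in>D1. f v = j))
     = enc_bool (\<exists>v\<in>D1 \<union> D2. f v = j)" by (auto simp: enc_bool_def)
  ultimately show ?thesis
    unfolding comb_def ftyp_def X1_def[symmetric] X2_def[symmetric] C1_def[symmetric] C2_def[symmetric]
    by (simp only: val_fst.simps val_snd.simps)
qed

text \<open>An edge between members of two classes, one on each side, can be moved to any other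
  members, one endpoint after the other.\<close>

lemma compatible_ftyp:
  assumes "A1 \<inter> A2 = {}" "A1 \<subseteq> V" "A2 \<subseteq> V"
  shows "compatible p (ftyp f A1 D1 j) (ftyp f A2 D2 j) \<longleftrightarrow>
    \<not> ((\<exists>v\<in>D1. f v = j) \<and> (\<exists>v\<in>D2. f v = j)) \<and>
    \<not> (\<exists>u\<in>A1. \<exists>v\<in>A2. f u = j \<and> f v = j \<and> adj u v)"
proof -
  have "(\<exists>u\<in>cl A1 {v \<in> A1. f v = j}. \<exists>v\<in>cl A2 {v \<in> A2. f v = j}. adj u v) \<longleftrightarrow>
    (\<exists>u\<in>A1. \<exists>v\<in>A2. f u = j \<and> f v = j \<and> adj u v)"
  proof
    assume "\<exists>u\<in>cl A1 {v \<in> A1. f v = j}. \<exists>v\<in>cl A2 {v \<in> A2. f v = j}. adj u v"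
    then obtain u u' v v' where *: "eqS A1 u' u" "eqS A2 v' v" "adj u v" "u' \<in> A1" "v' \<in> A2" "f u' = j" "f v' = j"
      "u \<in> A1" "v \<in> A2" unfolding cl_def by blast
    have "adj u' v" using eqS_adj[OF *(1), of v] * assms by blast
    then have "adj u' v'" using eqS_adj[OF *(2), of u'] * assms adj_sym by blast
    then show "\<exists>u\<in>A1. \<exists>v\<in>A2. f u = j \<and> f v = j \<and> adj u v" using * by blast
  next
    assume "\<exists>u\<in>A1. \<exists>v\<in>A2. f u = j \<and> f v = j \<and> adj u v"
    then show "\<exists>u\<in>cl A1 {v \<in> A1. f v = j}. \<exists>v\<in>cl A2 {v \<in> A2. f v = j}. adj u v"
      unfolding cl_def using eqS_refl by blast
  qed
  then show ?thesis unfolding compatible_def ftyp_def using assms by (simp add: set_satS)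
qed

text \<open>Conditions inside a side are those of \<open>valid\<close> there;
  \<open>compatible\<close> collects, color by color, the edges and the pairs of b-vertices
  across.\<close>

lemma valid_Un:
  assumes "A1 \<inter> A2 = {}" "A1 \<subseteq> V" "A2 \<subseteq> V" "D1 \<subseteq> A1" "D2 \<subseteq> A2"
  shows "valid (A1 \<union> A2) f (D1 \<union> D2) \<longleftrightarrow> valid A1 f D1 \<and> valid A2 f D2 \<and>
    (\<forall>j<k. compatible p (ftyp f A1 D1 j) (ftyp f A2 D2 j))"
proof -
  have "D1 - D2 = D1" "D2 - D1 = D2" using assms by auto
  then have inj: "inj_on f (D1 \<union> D2) \<longleftrightarrow> inj_on f D1 \<and> inj_on f D2 \<and> (\<forall>u\<in>D1. \<forall>v\<in>D2. f u \<noteq> f v)"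
    by (auto simp: inj_on_Un)
  have c: "(\<forall>j<k. compatible p (ftyp f A1 D1 j) (ftyp f A2 D2 j)) \<longleftrightarrow>
    (\<forall>u\<in>D1. \<forall>v\<in>D2. f u \<noteq> f v) \<and> (\<forall>u\<in>A1. \<forall>v\<in>A2. adj u v \<longrightarrow> f u \<noteq> f v)"
    if "\<forall>v\<in>A1. f v < k"
  proof -
    have "\<forall>v\<in>D1. f v < k" using that assms by blast
    show ?thesis unfolding compatible_ftyp[OF assms(1-3)]
    proof (intro iffI conjI ballI allI impI)
      fix u v assume *: "\<forall>j<k. \<not> ((\<exists>v\<in>D1. f v = j) \<and> (\<exists>v\<in>D2. f v = j)) \<and>
        \<not> (\<exists>u\<in>A1. \<exists>v\<in>A2. f u = j \<and> f v = j \<and> adj u v)"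
      { assume "u \<in> D1" "v \<in> D2"
        with * \<open>\<forall>v\<in>D1. f v < k\<close> show "f u \<noteq> f v" by metis }
      { assume "u \<in> A1" "v \<in> A2" "adj u v"
        with * that show "f u \<noteq> f v" by metis }
    next
      fix j assume *: "(\<forall>u\<in>D1. \<forall>v\<in>D2. f u \<noteq> f v) \<and> (\<forall>u\<in>A1. \<forall>v\<in>A2. adj u v \<longrightarrow> f u \<noteq> f v)"
      then show "\<not> ((\<exists>v\<in>D1. f v = j) \<and> (\<exists>v\<in>D2. f v = j))" by metis
      from * show "\<not> (\<exists>u\<in>A1. \<exists>v\<in>A2. f u = j \<and> f v = j \<and> adj u v)" by metis
    qed
  qed
  have sw: "(\<forall>u\<in>A2. \<forall>v\<in>A1. adj u v \<longrightarrow> f u \<noteq> f v) \<longleftrightarrow> (\<forall>u\<in>A1. \<forall>v\<in>A2. adj u v \<longrightarrow> f u \<noteq> f v)"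
    using adj_sym by metis
  show ?thesis
  proof (cases "\<forall>v\<in>A1. f v < k")
    case True
    have "D1 \<subseteq> A1 \<union> A2" "D2 \<subseteq> A1 \<union> A2" using assms by auto
    then show ?thesis unfolding c[OF True] unfolding valid_def inj using assms(4,5)
      by (simp add: ball_Un ball_conj_distrib sw) (simp only: conj_ac)
  qed (auto simp: valid_def)
qed

text \<open>In one direction \<open>f\<close> and \<open>D\<close> are restricted. In the other, two
  colorings are glued, which preserves the types because these depend on \<open>f\<close> only
  inside their side. Positions in the lists are colors, so no renaming is involved yet.\<close>

lemma states_Un:
  assumes "A1 \<inter> A2 = {}" "A1 \<subseteq> V" "A2 \<subseteq> V" "set (lst a) = A1 \<union> A2"
  shows "\<sigma> \<in> states (A1 \<union> A2) \<longleftrightarrow> (\<exists>\<sigma>1\<in>states A1. \<exists>\<sigma>2\<in>states A2. list_all2 (compatible p) \<sigma>1 \<sigma>2 \<and> \<sigma> = map2 (comb p a) \<sigma>1 \<sigma>2)"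
proof
  assume "\<sigma> \<in> states (A1 \<union> A2)"
  then obtain f D where fD: "\<sigma> = map (ftyp f (A1 \<union> A2) D) [0..<k]" "valid (A1 \<union> A2) f D"
    unfolding states_def by blast
  define D1 where "D1 = D \<inter> A1"
  define D2 where "D2 = D \<inter> A2"
  have D: "D1 \<subseteq> A1" "D2 \<subseteq> A2" "D = D1 \<union> D2" using fD(2) unfolding D1_def D2_def valid_def by auto
  have v: "valid A1 f D1" "valid A2 f D2" "\<forall>j<k. compatible p (ftyp f A1 D1 j) (ftyp f A2 D2 j)"
    using valid_Un[OF assms(1-3) D(1,2)] fD(2) D(3) by auto
  show "\<exists>\<sigma>1\<in>states A1. \<exists>\<sigma>2\<in>states A2. list_all2 (compatible p) \<sigma>1 \<sigma>2 \<and> \<sigma> = map2 (comb p a) \<sigma>1 \<sigma>2"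
  proof (intro bexI conjI)
    show "list_all2 (compatible p) (map (ftyp f A1 D1) [0..<k]) (map (ftyp f A2 D2) [0..<k])"
      using v(3) by (simp add: list_all2_conv_all_nth)
    show "\<sigma> = map2 (comb p a) (map (ftyp f A1 D1) [0..<k]) (map (ftyp f A2 D2) [0..<k])"
      using comb_ftyp[OF assms(1-3) D(1,2) assms(4)] fD(1) D(3)
      by (simp add: zip_map_map zip_same_conv_map)
  qed (intro statesI v)+
next
  assume "\<exists>\<sigma>1\<in>states A1. \<exists>\<sigma>2\<in>states A2. list_all2 (compatible p) \<sigma>1 \<sigma>2 \<and> \<sigma> = map2 (comb p a) \<sigma>1 \<sigma>2"
  then obtain f1 D1 f2 D2 where *: "valid A1 f1 D1" "valid A2 f2 D2"
    "list_all2 (compatible p) (map (ftyp f1 A1 D1) [0..<k]) (map (ftyp f2 A2 D2) [0..<k])"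
    "\<sigma> = map2 (comb p a) (map (ftyp f1 A1 D1) [0..<k]) (map (ftyp f2 A2 D2) [0..<k])"
    unfolding states_def by blast
  define f where "f v = (if v \<in> A1 then f1 v else f2 v)" for v
  have D: "D1 \<subseteq> A1" "D2 \<subseteq> A2" using *(1,2) unfolding valid_def by auto
  have f2: "f v = f2 v" if "v \<in> A2" for v using that assms(1) unfolding f_def by auto
  have t1: "ftyp f1 A1 D1 = ftyp f A1 D1"
    by (rule ext, rule ftyp_cong[OF D(1)]) (simp add: f_def)
  have t2: "ftyp f2 A2 D2 = ftyp f A2 D2"
    by (rule ext, rule ftyp_cong[OF D(2)]) (simp add: f2)
  have v: "valid A1 f D1" "valid A2 f D2"
    by (rule valid_cong[OF _ *(1)], simp add: f_def) (rule valid_cong[OF _ *(2)], simp add: f2)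
  have "\<forall>j<k. compatible p (ftyp f A1 D1 j) (ftyp f A2 D2 j)"
    using *(3) unfolding t1 t2 by (simp add: list_all2_conv_all_nth)
  then have "valid (A1 \<union> A2) f (D1 \<union> D2)" using valid_Un[OF assms(1-3) D] v by simp
  moreover have "\<sigma> = map (ftyp f (A1 \<union> A2) (D1 \<union> D2)) [0..<k]"
    using *(4) comb_ftyp[OF assms(1-3) D assms(4)] unfolding t1 t2
    by (simp add: zip_map_map zip_same_conv_map)
  ultimately show "\<sigma> \<in> states (A1 \<union> A2)" unfolding states_def by blast
qed

text \<open>Entries are exact states, but completeness holds only up to renaming colors. As first
  components are \<open>Nl\<close>, distinct keys mean that no multiset of types is listed twice;
  the size bounds rest on this.\<close>

definition is_table :: "val set \<Rightarrow> val \<Rightarrow> bool" where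
  "is_table A T \<longleftrightarrow> (\<forall>c\<in>set (lst T). val_fst c = Nl \<and> lst (val_snd c) \<in> states A) \<and>
    (\<forall>\<sigma>\<in>states A. \<exists>c\<in>set (lst T). mset (lst (val_snd c)) = mset \<sigma>) \<and> distinct (map ckey (lst T))"

lemma length_states: "\<sigma> \<in> states A \<Longrightarrow> length \<sigma> = k"
  unfolding states_def by auto

lemma merge_is_table:
  assumes "A1 \<inter> A2 = {}" "A1 \<subseteq> V" "A2 \<subseteq> V" "set (lst a) = A1 \<union> A2" "is_table A1 T1" "is_table A2 T2"
  shows "is_table (A1 \<union> A2) (merge T1 T2 a p)"
proof -
  define M where "M c1 c2 = match_fold p a (val_snd c2) (lst (val_snd c1))" for c1 c2
  define L where "L = enc_list (concat (map (\<lambda>c1. lst (enc_list (concat (map (\<lambda>c2.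
     lst (strip (M c1 c2))) (lst T2))))) (lst T1)))"
  have merge: "merge T1 T2 a p = dedup L" unfolding merge_def L_def M_def ..
  have setL: "c \<in> set (lst L) \<longleftrightarrow> (\<exists>c1\<in>set (lst T1). \<exists>c2\<in>set (lst T2). \<exists>d\<in>set (lst (M c1 c2)). c = Pair Nl (val_snd d))" for c
    unfolding L_def strip_def by auto
  have sound: "val_fst c = Nl \<and> lst (val_snd c) \<in> states (A1 \<union> A2)" if "c \<in> set (lst L)" for c
  proof -
    obtain c1 c2 d where c: "c1 \<in> set (lst T1)" "c2 \<in> set (lst T2)" "d \<in> set (lst (M c1 c2))" "c = Pair Nl (val_snd d)"
      using \<open>c \<in> set (lst L)\<close> setL by blast
    have R: "lst (val_snd c1) \<in> states A1" "lst (val_snd c2) \<in> states A2" using assms(5,6) c unfolding is_table_def by auto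
    note ms = match_fold_sound[OF c(3)[unfolded M_def]]
    then have "length (lst (val_fst d)) = length (lst (val_snd c2))"
      using length_states[OF R(1)] length_states[OF R(2)] list_all2_lengthD by metis
    \<comment> \<open>All colors of the second state are used up, so the inclusion of multisets is
      an equality.\<close>
    then have "mset (lst (val_fst d)) = mset (lst (val_snd c2))"
      using ms by (metis mset_subset_size size_mset nat_neq_iff subset_mset.le_imp_less_or_eq)
    then have R2: "lst (val_fst d) \<in> states A2" by (rule states_perm[OF R(2)])
    have "lst (val_snd d) \<in> states (A1 \<union> A2)" unfolding states_Un[OF assms(1-4)]
      by (rule bexI[OF bexI[OF _ R2] R(1)]) (use ms in simp)
    then show ?thesis using c(4) by simp
  qed
  have complete: "\<exists>c\<in>set (lst L). mset (lst (val_snd c)) = mset \<sigma>" if \<sigma>: "\<sigma> \<in> states (A1 \<union> A2)" for \<sigma>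
  proof -
    obtain \<sigma>1 \<sigma>2 where s: "\<sigma>1 \<in> states A1" "\<sigma>2 \<in> states A2" "list_all2 (compatible p) \<sigma>1 \<sigma>2" "\<sigma> = map2 (comb p a) \<sigma>1 \<sigma>2"
      using \<sigma> unfolding states_Un[OF assms(1-4)] by blast
    obtain c1 where c1: "c1 \<in> set (lst T1)" "mset (lst (val_snd c1)) = mset \<sigma>1" using s(1) assms(5) unfolding is_table_def by blast
    obtain c2 where c2: "c2 \<in> set (lst T2)" "mset (lst (val_snd c2)) = mset \<sigma>2" using s(2) assms(6) unfolding is_table_def by blast
    have len: "length \<sigma>1 = length \<sigma>2" using s by (simp add: length_states)
    \<comment> \<open>The table knows \<open>\<sigma>1\<close> only up to order; \<open>us\<close>
      rearranges \<open>\<sigma>2\<close> along with it, so that the same pairs of types are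
      combined.\<close>
    from ex_mset_zip_left[OF len c1(2)] obtain us where
      us: "length us = length (lst (val_snd c1))" "mset (zip (lst (val_snd c1)) us) = mset (zip \<sigma>1 \<sigma>2)" by blast
    have "list_all2 (compatible p) (lst (val_snd c1)) us"
      using s(3) us mset_eq_setD[OF us(2)] by (simp add: list_all2_iff)
    moreover have "mset us = mset \<sigma>2"
      using arg_cong[OF us(2), of "image_mset snd"] us(1) len by (simp flip: mset_map)
    ultimately obtain d where d: "d \<in> set (lst (M c1 c2))"
      "ckey d = (mset us, mset (map2 (comb p a) (lst (val_snd c1)) us))"
      using match_fold_complete[of p "lst (val_snd c1)" us "val_snd c2" a] c2(2) unfolding M_def by auto
    have "mset (lst (val_snd d)) = image_mset (\<lambda>(x, y). comb p a x y) (mset (zip (lst (val_snd c1)) us))"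
      using d(2) by (simp add: ckey_def)
    also have "\<dots> = mset \<sigma>" unfolding us(2) s(4) by simp
    finally have "mset (lst (val_snd (Pair Nl (val_snd d)))) = mset \<sigma>" by simp
    moreover have "Pair Nl (val_snd d) \<in> set (lst L)" using setL c1 c2 d by blast
    ultimately show ?thesis by blast
  qed
  show ?thesis unfolding is_table_def merge
  proof (intro conjI ballI)
    fix c assume "c \<in> set (lst (dedup L))"
    then have "c \<in> set (lst L)" using dedup_props(1) by blast
    from sound[OF this] show "val_fst c = Nl" "lst (val_snd c) \<in> states (A1 \<union> A2)" by auto
  next
    fix \<sigma> assume "\<sigma> \<in> states (A1 \<union> A2)"
    from complete[OF this] obtain c where c: "c \<in> set (lst L)" "mset (lst (val_snd c)) = mset \<sigma>" by blast
    from dedup_ckey[OF c(1)] obtain e where "e \<in> set (lst (dedup L))" "ckey e = ckey c" by blast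
    then show "\<exists>c\<in>set (lst (dedup L)). mset (lst (val_snd c)) = mset \<sigma>" using c(2) by (auto simp: ckey_def)
  qed (rule dedup_props(3))
qed

lemma leaf_is_table:
  assumes "u \<in> V" "lst (ck p) = replicate k Nl"
  shows "is_table {u} (leaf_table (ck p) (Pair u Nl) (sat p (Pair u Nl) (Pair u Nl)))"
proof (cases k)
  case 0
  then have "states {u} = {}" unfolding states_def valid_def by auto
  then show ?thesis using 0 assms unfolding leaf_table_def is_table_def by simp
next
  case (Suc k')
  have ck: "ck p \<noteq> Nl" using assms(2) Suc by auto
  have "lst (val_snd (ck p)) = replicate k' Nl" using assms(2) Suc by (cases "ck p") auto
  define S where "S = sat p (Pair u Nl) (Pair u Nl)"
  have cl0: "cl A {} = {}" for A unfolding cl_def by simp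
  have sat0: "satS A {} = Nl" for A unfolding satS_def cl0 by simp
  have S: "S = satS {u} {u}" unfolding S_def sat_conv by simp
  \<comment> \<open>The type of the vertex's own color and that of every other color;
    \<open>b\<close> tells whether the vertex is chosen.\<close>
  define \<tau> where "\<tau> b = (if b then (Pair S (Pair (Pair Nl Nl) Nl), Pair Nl (Pair Nl S))
      else (Pair S (Pair Nl Nl), Pair Nl (Pair Nl Nl)))" for b
  have ft: "ftyp f {u} (if b then {u} else {}) j = (if f u = j then fst (\<tau> b) else snd (\<tau> b))" for f b j
  proof -
    have "{v \<in> {u}. f v = j} = (if f u = j then {u} else {})" by auto
    moreover have "{v \<in> if b then {u} else {}. f v \<noteq> j \<and> \<not> (\<exists>w\<in>{u}. f w = j \<and> adj v w)} =
      (if b \<and> f u \<noteq> j then {u} else {})" by auto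
    ultimately show ?thesis unfolding ftyp_def \<tau>_def S by (auto simp: sat0 enc_bool_def)
  qed
  have valid: "valid {u} f D \<longleftrightarrow> f u < k \<and> (\<exists>b. D = (if b then {u} else {}))" for f D
    unfolding valid_def using adj_irrefl by (auto simp: subset_singleton_iff ex_bool_eq)
  define st where "st b j = map (\<lambda>i. if j = i then fst (\<tau> b) else snd (\<tau> b)) [0..<k]" for b and j :: nat
  have states: "states {u} = {st b j | b j. j < k}"
  proof (intro set_eqI iffI)
    fix \<sigma> assume "\<sigma> \<in> states {u}"
    then obtain f b where "\<sigma> = map (ftyp f {u} (if b then {u} else {})) [0..<k]" "f u < k"
      unfolding states_def valid by blast
    then have "\<sigma> = st b (f u)" by (simp add: ft st_def)
    with \<open>f u < k\<close> show "\<sigma> \<in> {st b j | b j. j < k}" by blast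
  next
    fix \<sigma> assume "\<sigma> \<in> {st b j | b j. j < k}"
    then obtain b j where "\<sigma> = st b j" "j < k" by blast
    then show "\<sigma> \<in> states {u}" unfolding states_def valid
      by (intro CollectI exI[of _ "\<lambda>_. j"] exI[of _ "if b then {u} else {}"]) (auto simp: ft st_def)
  qed
  have mst: "mset (st b j) = add_mset (fst (\<tau> b)) (replicate_mset k' (snd (\<tau> b)))" if "j < k" for b j
  proof -
    have "st b j = replicate j (snd (\<tau> b)) @ fst (\<tau> b) # replicate (k - Suc j) (snd (\<tau> b))"
      by (rule nth_equalityI) (use that in \<open>auto simp: st_def nth_append nth_Cons split: nat.split\<close>)
    then have "mset (st b j) = add_mset (fst (\<tau> b)) (mset (replicate j (snd (\<tau> b)) @ replicate (k - Suc j) (snd (\<tau> b))))"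
      by simp
    also have "replicate j (snd (\<tau> b)) @ replicate (k - Suc j) (snd (\<tau> b)) = replicate k' (snd (\<tau> b))"
      using that Suc by (simp add: replicate_add[symmetric])
    finally show ?thesis by simp
  qed
  have st0: "st b 0 = fst (\<tau> b) # replicate k' (snd (\<tau> b))" for b
    unfolding st_def Suc by (rule nth_equalityI) (auto simp: nth_Cons' simp del: upt_Suc)
  have T: "lst (leaf_table (ck p) (Pair u Nl) S) = [Pair Nl (enc_list (st False 0)), Pair Nl (enc_list (st True 0))]"
    unfolding leaf_table_def st0 using ck \<open>lst (val_snd (ck p)) = replicate k' Nl\<close> by (simp add: \<tau>_def)
  have "fst (\<tau> True) \<notin># mset (st False 0)" unfolding st0 \<tau>_def by auto
  then have "mset (st True 0) \<noteq> mset (st False 0)" unfolding st0 by (metis list.set_intros(1) set_mset_mset)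
  then have "distinct (map ckey (lst (leaf_table (ck p) (Pair u Nl) S)))"
    unfolding T by (auto simp: ckey_def)
  moreover have "st b 0 \<in> states {u}" for b unfolding states using Suc by blast
  moreover have "\<exists>c\<in>set (lst (leaf_table (ck p) (Pair u Nl) S)). mset (lst (val_snd c)) = mset \<sigma>" if "\<sigma> \<in> states {u}" for \<sigma>
  proof -
    obtain b j where "\<sigma> = st b j" "j < k" using \<open>\<sigma> \<in> states {u}\<close> unfolding states by blast
    then have "mset (st b 0) = mset \<sigma>" using mst Suc by simp
    then show ?thesis unfolding T by (cases b) auto
  qed
  ultimately show ?thesis unfolding is_table_def S_def[symmetric] by (auto simp: T)
qed

text \<open>A set is contained in its saturation, so an empty third component means that no chosen
  vertex lacks the color. The test concerns the set of types only and thus does not depend on the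
  representative in the table.\<close>

lemma accepting_iff:
  assumes "is_table V (val_snd r)"
  shows "accepting r \<longleftrightarrow> (\<exists>f D. valid V f D \<and> (\<forall>j<k. (\<exists>v\<in>D. f v = j) \<and>
     (\<forall>v\<in>D. f v \<noteq> j \<longrightarrow> (\<exists>u\<in>V. f u = j \<and> adj v u))))"
proof -
  have sat_Nl: "satS V X = Nl \<longleftrightarrow> X = {}" if "X \<subseteq> V" for X
  proof -
    have "satS V X = Nl \<longleftrightarrow> (\<forall>v\<in>V. v \<notin> cl V X)" unfolding satS_def by (simp add: filter_empty_conv)
    moreover have "X \<subseteq> cl V X" using that eqS_refl unfolding cl_def by auto
    moreover have "cl V X \<subseteq> V" "cl V {} = {}" unfolding cl_def by auto
    ultimately show ?thesis by (metis empty_iff subsetD subset_empty subsetI)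
  qed
  have branching: "(\<forall>t\<in>set (map (ftyp f V D) [0..<k]). \<not> tb t = Nl \<and> tQ t = Nl) \<longleftrightarrow>
    (\<forall>j<k. (\<exists>v\<in>D. f v = j) \<and> (\<forall>v\<in>D. f v \<noteq> j \<longrightarrow> (\<exists>u\<in>V. f u = j \<and> adj v u)))" if "valid V f D" for f D
  proof -
    have "D \<subseteq> V" using that unfolding valid_def by blast
    then have "satS V {v \<in> D. f v \<noteq> j \<and> \<not> (\<exists>u\<in>V. f u = j \<and> adj v u)} = Nl \<longleftrightarrow>
       (\<forall>v\<in>D. f v \<noteq> j \<longrightarrow> (\<exists>u\<in>V. f u = j \<and> adj v u))" for j
      by (subst sat_Nl) auto
    then show ?thesis unfolding ftyp_def by auto
  qed
  have "accepting r \<longleftrightarrow> (\<exists>\<sigma>\<in>states V. \<forall>t\<in>set \<sigma>. \<not> tb t = Nl \<and> tQ t = Nl)"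
  proof
    assume "accepting r"
    then obtain c where c: "c \<in> set (lst (val_snd r))" "\<forall>t\<in>set (lst (val_snd c)). \<not> tb t = Nl \<and> tQ t = Nl"
      unfolding accepting_def by (elim bexE)
    have "lst (val_snd c) \<in> states V" using assms c(1) unfolding is_table_def by simp
    with c(2) show "\<exists>\<sigma>\<in>states V. \<forall>t\<in>set \<sigma>. \<not> tb t = Nl \<and> tQ t = Nl" by (intro bexI)
  next
    assume "\<exists>\<sigma>\<in>states V. \<forall>t\<in>set \<sigma>. \<not> tb t = Nl \<and> tQ t = Nl"
    then obtain \<sigma> where \<sigma>: "\<sigma> \<in> states V" "\<forall>t\<in>set \<sigma>. \<not> tb t = Nl \<and> tQ t = Nl" by (elim bexE)
    obtain c where c: "c \<in> set (lst (val_snd r))" "mset (lst (val_snd c)) = mset \<sigma>"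
      using assms \<sigma>(1) unfolding is_table_def by auto
    have "set (lst (val_snd c)) = set \<sigma>" by (rule mset_eq_setD[OF c(2)])
    then show "accepting r" using \<sigma>(2) c(1) unfolding accepting_def by (intro bexI[of _ c]) simp_all
  qed
  also have "\<dots> \<longleftrightarrow> (\<exists>f D. valid V f D \<and> (\<forall>t\<in>set (map (ftyp f V D) [0..<k]). \<not> tb t = Nl \<and> tQ t = Nl))"
    unfolding states_def by blast
  also have "\<dots> \<longleftrightarrow> (\<exists>f D. valid V f D \<and> (\<forall>j<k. (\<exists>v\<in>D. f v = j) \<and>
     (\<forall>v\<in>D. f v \<noteq> j \<longrightarrow> (\<exists>u\<in>V. f u = j \<and> adj v u))))"
    by (simp only: branching cong: conj_cong)
  finally show ?thesis .
qed

end

section \<open>The number of states\<close>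

text \<open>Such a multiset is determined by its multiplicities on \<open>U\<close>, each of which
  lies between 0 and \<open>k\<close>.\<close>

lemma finite_card_bounded_msets:
  assumes "finite U"
  shows "finite {M. set_mset M \<subseteq> U \<and> size M \<le> k} \<and> card {M. set_mset M \<subseteq> U \<and> size M \<le> k} \<le> Suc k ^ card U"
proof -
  let ?S = "{M. set_mset M \<subseteq> U \<and> size M \<le> k}"
  let ?F = "\<lambda>M. restrict (count M) U"
  have inj: "inj_on ?F ?S"
  proof (rule inj_onI, rule multiset_eqI)
    fix M N a assume MN: "M \<in> ?S" "N \<in> ?S" "?F M = ?F N"
    show "count M a = count N a"
    proof (cases "a \<in> U")
      case True
      then show ?thesis using fun_cong[OF MN(3), of a] by simp
    next
      case False
      then have "a \<notin># M" "a \<notin># N" using MN by auto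
      then show ?thesis by (simp add: not_in_iff)
    qed
  qed
  have img: "?F ` ?S \<subseteq> (U \<rightarrow>\<^sub>E {..k})"
    by (auto intro: order_trans[OF count_le_size])
  have fin: "finite (U \<rightarrow>\<^sub>E {..k})" using assms by (intro finite_PiE) auto
  have "card (U \<rightarrow>\<^sub>E {..k}) = Suc k ^ card U" using card_funcsetE[OF assms, of "{..k}"] by simp
  with card_inj_on_le[OF inj img fin] inj_on_finite[OF inj img fin] show ?thesis
    by (intro conjI) (assumption, simp only:)
qed

lemma length_distinct_keys_le:
  assumes "finite U1" "finite U2" "distinct (map ckey cs)"
    and "\<And>c. c \<in> set cs \<Longrightarrow> set (lst (val_fst c)) \<subseteq> U1 \<and> length (lst (val_fst c)) \<le> k \<and>
      set (lst (val_snd c)) \<subseteq> U2 \<and> length (lst (val_snd c)) \<le> k"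
  shows "length cs \<le> Suc k ^ (card U1 + card U2)"
proof -
  let ?S = "\<lambda>U. {M. set_mset M \<subseteq> U \<and> size M \<le> k}"
  have "set (map ckey cs) \<subseteq> ?S U1 \<times> ?S U2"
  proof
    fix x assume "x \<in> set (map ckey cs)"
    then obtain c where c: "c \<in> set cs" "x = ckey c" by auto
    from assms(4)[OF c(1)] show "x \<in> ?S U1 \<times> ?S U2" unfolding c(2) ckey_def by simp
  qed
  then have "card (set (map ckey cs)) \<le> card (?S U1 \<times> ?S U2)"
    using finite_card_bounded_msets[OF assms(1), of k] finite_card_bounded_msets[OF assms(2), of k]
    by (intro card_mono finite_cartesian_product) blast+
  also have "\<dots> \<le> Suc k ^ card U1 * Suc k ^ card U2"
    unfolding card_cartesian_product
    using finite_card_bounded_msets[OF assms(1), of k] finite_card_bounded_msets[OF assms(2), of k]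
    by (intro mult_le_mono) blast+
  finally show ?thesis using distinct_card[OF assms(3)] by (simp add: power_add)
qed

context graph_ctx
begin

text \<open>A superset of the types in \<open>states A\<close> that is closed enough for partial
  matchings, and whose size follows from the number of saturated sets.\<close>

definition types :: "val set \<Rightarrow> val set" where
  "types A = {Pair (satS A X) (Pair (enc_bool b) (satS A Y)) | X Y b. True}"

lemma finite_range_satS: "A \<subseteq> V \<Longrightarrow> finite (range (satS A))"
proof -
  assume "A \<subseteq> V"
  have "range (satS A) \<subseteq> (\<lambda>C. enc_list (filter (\<lambda>v. v \<in> C) (lst (cv p)))) ` Pow A"
    unfolding satS_def cl_def by blast
  then show ?thesis using \<open>A \<subseteq> V\<close> finite_subset[of A V] by (meson finite_Pow_iff finite_imageI finite_set finite_subset)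
qed

text \<open>Two saturated sets and one bit, whence the exponent \<open>2 * w + 1\<close>.\<close>

lemma types_card:
  assumes "A \<subseteq> V" "card (range (satS A)) \<le> 2 ^ w"
  shows "finite (types A)" "card (types A) \<le> 2 ^ (2 * w + 1)"
proof -
  let ?S = "range (satS A)"
  let ?f = "\<lambda>(s, b, q). Pair s (Pair (enc_bool b) q)"
  have eq: "types A = ?f ` (?S \<times> UNIV \<times> ?S)" unfolding types_def by (auto simp: image_iff)
  have fin: "finite (?S \<times> (UNIV :: bool set) \<times> ?S)" using finite_range_satS[OF assms(1)] by simp
  then show "finite (types A)" unfolding eq by simp
  have "card (types A) \<le> card (?S \<times> (UNIV :: bool set) \<times> ?S)" unfolding eq by (rule card_image_le[OF fin])
  also have "\<dots> = card ?S * (2 * card ?S)" by (simp add: card_cartesian_product)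
  also have "\<dots> \<le> 2 ^ w * (2 * 2 ^ w)" using assms(2) by (intro mult_le_mono) auto
  also have "\<dots> = 2 ^ (2 * w + 1)" by (simp add: power_even_eq power2_eq_square)
  finally show "card (types A) \<le> 2 ^ (2 * w + 1)" .
qed

lemma states_types: "\<sigma> \<in> states A \<Longrightarrow> set \<sigma> \<subseteq> types A"
proof -
  assume "\<sigma> \<in> states A"
  moreover have "ftyp f A D j \<in> types A" for f D j unfolding types_def ftyp_def by blast
  ultimately show ?thesis unfolding states_def by auto
qed

lemma comb_types:
  assumes "s \<in> types A1" "t \<in> types A2"
  shows "comb p a s t \<in> types (set (lst a))"
proof -
  obtain b c where "tb s = enc_bool b" "tb t = enc_bool c" using assms unfolding types_def by auto
  then have "(if tb s = Nl then tb t else tb s) = enc_bool (b \<or> c)" by (auto simp: enc_bool_def)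
  then show ?thesis unfolding comb_def types_def sat_conv by auto
qed

lemma table_configs:
  assumes "is_table A T" "c \<in> set (lst T)"
  shows "set (lst (val_fst c)) \<subseteq> types A \<and> length (lst (val_fst c)) \<le> k \<and>
      set (lst (val_snd c)) \<subseteq> types A \<and> length (lst (val_snd c)) \<le> k"
proof -
  have "val_fst c = Nl" "lst (val_snd c) \<in> states A" using assms unfolding is_table_def by auto
  then show ?thesis using states_types length_states by auto
qed

lemma match_fold_configs:
  assumes "s1 \<in> states A1" "lst s2 \<in> states A2" "s1 = ys @ zs" "c \<in> set (lst (match_fold p a s2 zs))"
  shows "set (lst (val_fst c)) \<subseteq> types A2 \<and> length (lst (val_fst c)) \<le> k \<and>
      set (lst (val_snd c)) \<subseteq> types (set (lst a)) \<and> length (lst (val_snd c)) \<le> k"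
proof -
  note m = match_fold_sound[OF assms(4)]
  have l: "length zs \<le> k" using length_states[OF assms(1)] assms(3) by simp
  have ll: "length (lst (val_fst c)) = length zs" using m list_all2_lengthD by metis
  have 1: "set (lst (val_fst c)) \<subseteq> types A2"
    using set_mset_mono[OF conjunct1[OF m]] states_types[OF assms(2)] by simp
  have 2: "set zs \<subseteq> types A1" using states_types[OF assms(1)] assms(3) by simp
  have "set (lst (val_snd c)) \<subseteq> types (set (lst a))"
  proof
    fix t assume "t \<in> set (lst (val_snd c))"
    then obtain x y where "(x, y) \<in> set (zip zs (lst (val_fst c)))" "t = comb p a x y" using m by auto
    then show "t \<in> types (set (lst a))" using 1 2 comb_types by (metis set_zip_leftD set_zip_rightD subsetD)
  qed
  moreover have "length (lst (val_snd c)) = length zs" using m ll by simp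
  ultimately show ?thesis using 1 l ll by simp
qed

end

text \<open>\<open>m\<close> bounds the number of configurations: the base comes from the at most
  \<open>k + 1 \<le> n + 2\<close> multiplicities of a type, and the exponent is twice the bound on
  the number of types, since a configuration consists of two multisets.\<close>

locale sized_ctx = graph_ctx +
  fixes n w m :: nat
  assumes n_pos: "1 \<le> n" and k_le: "k \<le> Suc n"
    and length_verts: "length (lst (cv p)) = n"
    and size_verts: "v \<in> set (lst (cv p)) \<Longrightarrow> size v \<le> n"
    and m_def: "m = (n + 2) ^ (2 ^ (2 * w + 2))"
begin

lemma m_ge: "n + 2 \<le> m" "k + 1 \<le> m" "16 \<le> m"
proof -
  have "(n + 2) ^ 4 \<le> m" unfolding m_def
    by (intro power_increasing) (auto simp: power_add)
  moreover have "(n + 2) ^ 1 \<le> (n + 2) ^ 4" by (intro power_increasing) auto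
  moreover have "(2::nat) ^ 4 \<le> (n + 2) ^ 4" by (intro power_mono) auto
  ultimately show "n + 2 \<le> m" "k + 1 \<le> m" "16 \<le> m" using k_le by auto
qed

lemma size_verts_list:
  assumes "set xs \<subseteq> V" "length xs \<le> n"
  shows "size (enc_list xs) \<le> m ^ 2"
proof -
  have "size (enc_list xs) \<le> n * (n + 1)" by (rule size_enc_list_le) (use assms size_verts in auto)
  also have "\<dots> \<le> m * m" using m_ge by (intro mult_le_mono) auto
  finally show ?thesis by (simp add: power2_eq_square)
qed

lemma size_satS: "size (satS A X) \<le> m ^ 2"
  unfolding satS_def by (rule size_verts_list) (use length_verts in \<open>auto simp: order_trans[OF length_filter_le]\<close>)

lemma size_types:
  assumes "t \<in> types A"
  shows "size t \<le> m ^ 3"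
proof -
  obtain X Y b where t: "t = Pair (satS A X) (Pair (enc_bool b) (satS A Y))" using assms unfolding types_def by blast
  have "size (enc_bool b) \<le> 1" by (simp add: enc_bool_def)
  then have "size t \<le> 2 * m ^ 2 + 3" using size_satS[of A X] size_satS[of A Y] unfolding t by simp
  also have "\<dots> \<le> 2 * m ^ 2 + 3 * m ^ 2" using m_ge(3) by simp
  also have "\<dots> \<le> m * m ^ 2" using m_ge(3) by simp
  finally show ?thesis by (simp add: eval_nat_numeral)
qed

lemma size_configs:
  assumes "A1 \<subseteq> V" "A2 \<subseteq> V" "card (range (satS A1)) \<le> 2 ^ w" "card (range (satS A2)) \<le> 2 ^ w"
    and "distinct (map ckey (lst T))"
    and "\<And>c. c \<in> set (lst T) \<Longrightarrow> set (lst (val_fst c)) \<subseteq> types A1 \<and> length (lst (val_fst c)) \<le> k \<and>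
      set (lst (val_snd c)) \<subseteq> types A2 \<and> length (lst (val_snd c)) \<le> k"
  shows "size T \<le> m ^ 8"
proof -
  have "length (lst T) \<le> Suc k ^ (card (types A1) + card (types A2))"
    by (rule length_distinct_keys_le) (use assms types_card in auto)
  also have "\<dots> \<le> (n + 2) ^ (card (types A1) + card (types A2))" using k_le by (intro power_mono) auto
  also have "\<dots> \<le> m" unfolding m_def
    using types_card(2)[OF assms(1,3)] types_card(2)[OF assms(2,4)] by (intro power_increasing) auto
  finally have len: "length (lst T) \<le> m" .
  have st: "size s \<le> m ^ 5" if "set (lst s) \<subseteq> types A" "length (lst s) \<le> k" for s A
  proof -
    have "size (enc_list (lst s)) \<le> k * (m ^ 3 + 1)"
      by (rule size_enc_list_le) (use that size_types in auto)
    also have "\<dots> \<le> m * (m ^ 3 + m ^ 3)" using m_ge by (intro mult_le_mono) auto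
    also have "\<dots> = 2 * m ^ 4" by (simp add: eval_nat_numeral algebra_simps)
    also have "\<dots> \<le> m * m ^ 4" using m_ge by (intro mult_le_mono) auto
    finally show ?thesis by (simp add: eval_nat_numeral)
  qed
  have "size c \<le> m ^ 6" if "c \<in> set (lst T)" for c
  proof -
    have "size c \<le> size (val_fst c) + size (val_snd c) + 1" by (cases c) auto
    also have "\<dots> \<le> m ^ 5 + m ^ 5 + m ^ 5" using assms(6)[OF that] m_ge by (intro add_mono st) auto
    also have "\<dots> = 3 * m ^ 5" by simp
    also have "\<dots> \<le> m * m ^ 5" using m_ge by (intro mult_right_mono) auto
    finally show ?thesis by (simp add: eval_nat_numeral)
  qed
  then have "size (enc_list (lst T)) \<le> m * (m ^ 6 + 1)" using len by (intro size_enc_list_le)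
  also have "\<dots> \<le> m * (m * m ^ 6)"
  proof (intro mult_le_mono order_refl)
    have "m ^ 6 + 1 \<le> 2 * m ^ 6" using m_ge by simp
    also have "\<dots> \<le> m * m ^ 6" using m_ge by (intro mult_right_mono) auto
    finally show "m ^ 6 + 1 \<le> m * m ^ 6" .
  qed
  finally show ?thesis by (simp add: eval_nat_numeral)
qed

lemma size_table:
  assumes "A \<subseteq> V" "card (range (satS A)) \<le> 2 ^ w" "is_table A T"
  shows "size T \<le> m ^ 8"
proof (rule size_configs[OF assms(1,1,2,2)])
  show "distinct (map ckey (lst T))" using assms(3) unfolding is_table_def by simp
qed (rule table_configs[OF assms(3)])

text \<open>Supplies what \<open>match_bound\<close> leaves open: configurations of partial
  matchings have distinct keys and types from small sets. The factor \<open>m\<close> beyond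
  \<open>size_configs\<close> pays for assembling the pieces, by \<open>10 \<le> m\<close>.\<close>

lemma node_bound:
  assumes A: "A1 \<subseteq> V" "A2 \<subseteq> V" and tabs: "is_table A1 T1" "is_table A2 T2"
    and a: "set (lst a1) = A1" "set (lst a2) = A2" "length (lst a1) + length (lst a2) \<le> n"
    and w: "card (range (satS A1)) \<le> 2 ^ w" "card (range (satS A2)) \<le> 2 ^ w" "card (range (satS (A1 \<union> A2))) \<le> 2 ^ w"
    and sp: "size p \<le> m ^ 8"
  shows "node_bound (Pair (Pair a1 T1) (Pair (Pair a2 T2) p)) (m ^ 9)"
proof -
  have a1: "size a1 \<le> m ^ 8" and a2: "size a2 \<le> m ^ 8" and aa: "size (app a1 a2) \<le> m ^ 8"
  proof -
    have le: "m ^ 2 \<le> m ^ 8" using m_ge by (intro power_increasing) auto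
    show "size a1 \<le> m ^ 8" using size_verts_list[of "lst a1"] a A le by simp
    show "size a2 \<le> m ^ 8" using size_verts_list[of "lst a2"] a A le by simp
    show "size (app a1 a2) \<le> m ^ 8" using size_verts_list[of "lst a1 @ lst a2"] a A le by (simp add: app_def)
  qed
  have T1: "size T1 \<le> m ^ 8" and T2: "size T2 \<le> m ^ 8"
    by (rule size_table[OF A(1) w(1) tabs(1)], rule size_table[OF A(2) w(2) tabs(2)])
  have "10 * m ^ 8 \<le> m * m ^ 8" using m_ge by (intro mult_right_mono) auto
  then have ten: "10 * m ^ 8 \<le> m ^ 9" by (simp flip: power_Suc)
  have one: "1 \<le> m ^ 8" using m_ge by simp
  have setaa: "set (lst (app a1 a2)) = A1 \<union> A2" using a by (simp add: app_def)
  have mb: "match_bound (Pair (val_snd c1) (Pair (val_snd c2) (Pair (app a1 a2) p))) (m ^ 9)"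
    if c: "c1 \<in> set (lst T1)" "c2 \<in> set (lst T2)" for c1 c2
    unfolding match_bound_def
  proof (intro conjI allI impI)
    have "size (val_snd c1) \<le> m ^ 8" "size (val_snd c2) \<le> m ^ 8"
      using size_mem_lst[OF c(1)] size_mem_lst[OF c(2)] size_val_snd[of c1] size_val_snd[of c2] T1 T2 by linarith+
    then show "size (Pair (val_snd c1) (Pair (val_snd c2) (Pair (app a1 a2) p))) \<le> m ^ 9"
      using aa sp ten one by simp
    fix ys zs
    assume yz: "lst (val_fst (Pair (val_snd c1) (Pair (val_snd c2) (Pair (app a1 a2) p)))) = ys @ zs"
    have R: "lst (val_snd c1) \<in> states A1" "lst (val_snd c2) \<in> states A2" using tabs c unfolding is_table_def by auto
    have "size (match_fold p (app a1 a2) (val_snd c2) zs) \<le> m ^ 8"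
    \<comment> \<open>The used types belong to \<open>A2\<close>, the combined ones to the
      union.\<close>
    proof (rule size_configs[of A2 "A1 \<union> A2"])
      show "distinct (map ckey (lst (match_fold p (app a1 a2) (val_snd c2) zs)))" by (rule match_fold_distinct)
    qed (use A w match_fold_configs[OF R(1,2), of ys zs _ "app a1 a2"] yz in \<open>auto simp: setaa\<close>)
    then show "size (match_fold (snd_snd (val_snd (Pair (val_snd c1) (Pair (val_snd c2) (Pair (app a1 a2) p)))))
      (fst_snd (val_snd (Pair (val_snd c1) (Pair (val_snd c2) (Pair (app a1 a2) p)))))
      (fst_snd (Pair (val_snd c1) (Pair (val_snd c2) (Pair (app a1 a2) p)))) zs) \<le> m ^ 9"
      using ten by simp
  qed
  show ?thesis unfolding node_bound_def merge_bound_def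
    using mb a1 a2 aa T1 T2 sp ten one by simp
qed

end

section \<open>Binary decomposition trees\<close>

datatype btree = BL nat | BB btree btree

text \<open>\<open>Nl\<close> as first component marks a leaf; this is unambiguous because no
  encoded tree is \<open>Nl\<close>.\<close>

fun btenc :: "btree \<Rightarrow> val" where
  "btenc (BL v) = Pair Nl (enc_nat v)"
| "btenc (BB l r) = Pair (btenc l) (btenc r)"

fun bleaves :: "btree \<Rightarrow> nat list" where
  "bleaves (BL v) = [v]"
| "bleaves (BB l r) = bleaves l @ bleaves r"

fun bsub :: "btree \<Rightarrow> btree set" where
  "bsub (BL v) = {BL v}"
| "bsub (BB l r) = insert (BB l r) (bsub l \<union> bsub r)"

lemma bsub_refl: "t \<in> bsub t"
  by (cases t) auto

lemma bsub_trans: "t \<in> bsub s \<Longrightarrow> s \<in> bsub u \<Longrightarrow> t \<in> bsub u"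
  by (induction u) auto

lemma btenc_not_Nl: "btenc t \<noteq> Nl"
  by (cases t) auto

lemma nodes_btenc: "s \<in> nodes (btenc t) \<Longrightarrow> \<exists>u\<in>bsub t. s = btenc u"
proof (induction rule: nodes.induct)
  case root
  then show ?case using bsub_refl by blast
next
  case (left s)
  then obtain u where "u \<in> bsub t" "s = btenc u" by blast
  then show ?case using left.hyps bsub_trans[of _ u t] bsub_refl by (cases u) auto
next
  case (right s)
  then obtain u where "u \<in> bsub t" "s = btenc u" by blast
  then show ?case using right.hyps bsub_trans[of _ u t] bsub_refl by (cases u) auto
qed

lemma bsub_leaves: "u \<in> bsub t \<Longrightarrow> set (bleaves u) \<subseteq> set (bleaves t)"
  by (induction t) auto

lemma bsub_distinct: "u \<in> bsub t \<Longrightarrow> distinct (bleaves t) \<Longrightarrow> distinct (bleaves u)"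
  by (induction t) auto

locale tree_ctx = sized_ctx +
  fixes nm :: "nat \<Rightarrow> val"
  assumes verts: "set (lst (cv p)) = nm ` {..<n}"
    and inj_nm: "inj_on nm {..<n}"
    and leaf_vertex_nm: "v < n \<Longrightarrow> leaf_vertex (btenc (BL v)) p = nm v"
    and ck: "lst (ck p) = replicate k Nl"
begin

lemma trec_is_table:
  assumes "distinct (bleaves t)" "set (bleaves t) \<subseteq> {..<n}"
  shows "\<exists>a T. trec node_step leaf_step p (btenc t) = Pair a T \<and> set (lst a) = nm ` set (bleaves t) \<and>
    length (lst a) = length (bleaves t) \<and> is_table (nm ` set (bleaves t)) T"
  using assms
proof (induction t)
  case (BL v)
  have v: "v < n" using BL by simp
  have "trec node_step leaf_step p (btenc (BL v)) = leaf_step (btenc (BL v)) p"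
    by (simp add: trec.simps)
  also have "\<dots> = Pair (Pair (nm v) Nl) (leaf_table (ck p) (Pair (nm v) Nl) (sat p (Pair (nm v) Nl) (Pair (nm v) Nl)))"
    unfolding leaf_step_def leaf_vertex_nm[OF v] ..
  finally have tr: "trec node_step leaf_step p (btenc (BL v)) = \<dots>" .
  have "is_table {nm v} (leaf_table (ck p) (Pair (nm v) Nl) (sat p (Pair (nm v) Nl) (Pair (nm v) Nl)))"
    by (rule leaf_is_table) (use v verts ck in auto)
  with tr show ?case
    by (intro exI[of _ "Pair (nm v) Nl"] exI conjI) (assumption | simp)+
next
  case (BB l r)
  obtain a1 T1 where 1: "trec node_step leaf_step p (btenc l) = Pair a1 T1" "set (lst a1) = nm ` set (bleaves l)"
    "length (lst a1) = length (bleaves l)" "is_table (nm ` set (bleaves l)) T1" using BB by auto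
  obtain a2 T2 where 2: "trec node_step leaf_step p (btenc r) = Pair a2 T2" "set (lst a2) = nm ` set (bleaves r)"
    "length (lst a2) = length (bleaves r)" "is_table (nm ` set (bleaves r)) T2" using BB by auto
  have tr: "trec node_step leaf_step p (btenc (BB l r)) = Pair (app a1 a2) (merge T1 T2 (app a1 a2) p)"
    using 1(1) 2(1) btenc_not_Nl by (subst trec.simps) (simp add: node_step_def)
  have "nm ` set (bleaves l) \<inter> nm ` set (bleaves r) = nm ` (set (bleaves l) \<inter> set (bleaves r))"
    by (rule inj_on_image_Int[OF inj_nm, symmetric]) (use BB.prems in auto)
  also have "\<dots> = {}" using BB.prems by auto
  finally have disj: "nm ` set (bleaves l) \<inter> nm ` set (bleaves r) = {}" .
  have "is_table (nm ` set (bleaves l) \<union> nm ` set (bleaves r)) (merge T1 T2 (app a1 a2) p)"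
    by (rule merge_is_table[OF disj]) (use 1 2 BB.prems verts in \<open>auto simp: app_def\<close>)
  then show ?case using tr 1 2 by (simp add: image_Un app_def)
qed

lemma trec_node_bound:
  assumes "distinct (bleaves t)" "set (bleaves t) \<subseteq> {..<n}"
    and w: "\<And>u. u \<in> bsub t \<Longrightarrow> card (range (satS (nm ` set (bleaves u)))) \<le> 2 ^ w"
    and sp: "size p \<le> m ^ 8"
    and s: "s \<in> nodes (btenc t)" "val_fst s \<noteq> Nl"
  shows "node_bound (Pair (trec node_step leaf_step p (val_fst s)) (Pair (trec node_step leaf_step p (val_snd s)) p)) (m ^ 9)"
proof -
  obtain u where u: "u \<in> bsub t" "s = btenc u" using nodes_btenc[OF s(1)] by blast
  then obtain l r where lr: "u = BB l r" using s(2) by (cases u) auto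
  have sub: "l \<in> bsub t" "r \<in> bsub t" using bsub_trans[OF _ u(1)] lr bsub_refl by auto
  have d: "distinct (bleaves l @ bleaves r)" "set (bleaves l @ bleaves r) \<subseteq> {..<n}"
    using bsub_distinct[OF u(1) assms(1)] bsub_leaves[OF u(1)] assms(2) lr by auto
  obtain a1 T1 where 1: "trec node_step leaf_step p (btenc l) = Pair a1 T1" "set (lst a1) = nm ` set (bleaves l)"
    "length (lst a1) = length (bleaves l)" "is_table (nm ` set (bleaves l)) T1" using trec_is_table[of l] d by auto
  obtain a2 T2 where 2: "trec node_step leaf_step p (btenc r) = Pair a2 T2" "set (lst a2) = nm ` set (bleaves r)"
    "length (lst a2) = length (bleaves r)" "is_table (nm ` set (bleaves r)) T2" using trec_is_table[of r] d by auto
  have "length (bleaves l @ bleaves r) \<le> n"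
    using distinct_card[OF d(1)] card_mono[OF _ d(2)] by simp
  then have "node_bound (Pair (Pair a1 T1) (Pair (Pair a2 T2) p)) (m ^ 9)"
    using d verts by (intro node_bound[OF _ _ 1(4) 2(4) 1(2) 2(2)])
      (auto simp: 1 2 sp image_Un[symmetric] intro: w sub w[OF u(1), unfolded lr, simplified])
  then show ?thesis using 1(1) 2(1) u(2) lr by simp
qed

end

section \<open>Preprocessing in linear time\<close>

text \<open>Contracts unary nodes and splits ternary ones directly on the encoding; the tests count
  the children. Unary nodes may enter the time only linearly, so this precedes all polynomial work.
  Leaves are returned as they are, since \<open>enc_tree\<close> and \<open>btenc\<close> agree on
  them.\<close>

function compress :: "val \<Rightarrow> val" where
  "compress x = (if val_fst x = Nl then x
     else if snd_snd x = Nl then compress (fst_snd x)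
     else if snd_snd (val_snd x) = Nl
       then Pair (compress (fst_snd x)) (compress (fst_snd (val_snd x)))
     else Pair (compress (fst_snd x)) (Pair (compress (fst_snd (val_snd x)))
       (compress (fst_snd (snd_snd x)))))"
  by auto

lemma size_snd_less: "val_fst x \<noteq> Nl \<Longrightarrow> size (val_snd x) < size x"
  by (cases x) auto

lemma size_sub_less:
  assumes "val_fst x \<noteq> Nl"
  shows "size (fst_snd x) < size x" "size (fst_snd (val_snd x)) < size x"
    "size (fst_snd (snd_snd x)) < size x"
  using size_snd_less[OF assms] size_val_fst[of "val_snd x"] size_val_fst[of "snd_snd x"]
    size_val_fst[of "snd_snd (val_snd x)"] size_val_snd[of "val_snd x"] size_val_snd[of "snd_snd x"]
  by linarith+

termination compress
  by (relation "measure size") (use size_sub_less in auto)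

declare compress.simps [simp del]

function ctime :: "val \<Rightarrow> nat" where
  "ctime x = (if val_fst x = Nl then 60
     else if snd_snd x = Nl then ctime (fst_snd x) + 60
     else if snd_snd (val_snd x) = Nl
       then ctime (fst_snd x) + ctime (fst_snd (val_snd x)) + 60
     else ctime (fst_snd x) + (ctime (fst_snd (val_snd x)) +
       ctime (fst_snd (snd_snd x))) + 60)"
  by auto
termination ctime
  by (relation "measure size") (use size_sub_less in auto)

declare ctime.simps [simp del]

lemma implT_compress: "implT compress ctime"
proof -
  define c where "c = ESnd (Var 0)"
  define c1 where "c1 = ESnd c"
  define c2 where "c2 = ESnd c1"
  define call where "call e = ECall 0 [EFst e]" for e
  define body where "body = EIf (EFst (Var 0)) (EIf c1 (EIf c2 (EPair (call c) (EPair (call c1) (call c2)))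
     (EPair (call c) (call c1))) (call c)) (Var 0)"
  let ?P = "[body]"
  have "\<exists>t\<le>ctime x. eval ?P [x] body (compress x) t" for x
  proof (induction x rule: measure_induct_rule[of size])
    case (less x)
    have v: "eval ?P [x] (Var 0) x 1" by (rule eval_Var0)
    have a: "eval ?P [x] (EFst (Var 0)) (val_fst x) 2" using eval_evals.Fst[OF v] by (simp add: eval_nat_numeral)
    have ec: "eval ?P [x] c (val_snd x) 2" unfolding c_def using eval_evals.Snd[OF v] by (simp add: eval_nat_numeral)
    have ec1: "eval ?P [x] c1 (snd_snd x) 3" unfolding c1_def
      using eval_evals.Snd[OF ec] by (simp add: eval_nat_numeral)
    have ec2: "eval ?P [x] c2 (snd_snd (val_snd x)) 4" unfolding c2_def
      using eval_evals.Snd[OF ec1] by (simp add: eval_nat_numeral)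
    have call: "\<exists>t\<le>ctime (val_fst z) + 6. eval ?P [x] (call e) (compress (val_fst z)) t"
      if e: "eval ?P [x] e z s" "s \<le> 4" "size (val_fst z) < size x" for e z s
    proof -
      obtain t where t: "t \<le> ctime (val_fst z)" "eval ?P [val_fst z] body (compress (val_fst z)) t"
        using less.IH[OF e(3)] by blast
      have "eval ?P [x] (call e) (compress (val_fst z)) ((s + 1) + 0 + t + 1)" unfolding call_def
        by (rule eval_evals.Call[OF eval_evals.Cons[OF eval_evals.Fst[OF e(1)] eval_evals.Nil]]) (use t in auto)
      then show ?thesis using t(1) e(2) by (intro exI[of _ "(s + 1) + 0 + t + 1"]) simp
    qed
    show ?case
    proof (cases "val_fst x = Nl")
      case True
      have "eval ?P [x] body x (2 + 1 + 1)" unfolding body_def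
        using eval_evals.If_false[OF a[unfolded True] v] by (simp add: body_def)
      then show ?thesis using True by (intro exI[of _ 4]) (simp add: compress.simps[of x] ctime.simps[of x] eval_nat_numeral)
    next
      case False
      note lt = size_sub_less[OF False]
      obtain t1 where t1: "t1 \<le> ctime (fst_snd x) + 6"
        "eval ?P [x] (call c) (compress (fst_snd x)) t1" using call[OF ec _ lt(1)] by auto
      obtain t2 where t2: "t2 \<le> ctime (fst_snd (val_snd x)) + 6"
        "eval ?P [x] (call c1) (compress (fst_snd (val_snd x))) t2" using call[OF ec1 _ lt(2)] by auto
      obtain t3 where t3: "t3 \<le> ctime (fst_snd (snd_snd x)) + 6"
        "eval ?P [x] (call c2) (compress (fst_snd (snd_snd x))) t3" using call[OF ec2 _ lt(3)] by auto
      show ?thesis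
      proof (cases "snd_snd x = Nl")
        case True
        have "eval ?P [x] body (compress (fst_snd x)) (2 + (3 + t1 + 1) + 1)" unfolding body_def
          using eval_evals.If_true[OF a False eval_evals.If_false[OF ec1[unfolded True] t1(2)]] by (simp add: body_def)
        then show ?thesis using False True t1(1)
          by (intro exI[of _ "2 + (3 + t1 + 1) + 1"]) (simp add: compress.simps[of x] ctime.simps[of x])
      next
        case n2: False
        show ?thesis
        proof (cases "snd_snd (val_snd x) = Nl")
          case True
          have "eval ?P [x] body (Pair (compress (fst_snd x)) (compress (fst_snd (val_snd x))))
             (2 + (3 + (4 + (t1 + t2 + 1) + 1) + 1) + 1)" unfolding body_def
            using eval_evals.If_true[OF a False eval_evals.If_true[OF ec1 n2
               eval_evals.If_false[OF ec2[unfolded True] eval_evals.Pair[OF t1(2) t2(2)]]]] by (simp add: body_def)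
          then show ?thesis using False n2 True t1(1) t2(1)
            by (intro exI[of _ "2 + (3 + (4 + (t1 + t2 + 1) + 1) + 1) + 1"]) (simp add: compress.simps[of x] ctime.simps[of x])
        next
          case n3: False
          have "eval ?P [x] body (Pair (compress (fst_snd x)) (Pair (compress (fst_snd (val_snd x)))
               (compress (fst_snd (snd_snd x)))))
             (2 + (3 + (4 + (t1 + (t2 + t3 + 1) + 1) + 1) + 1) + 1)" unfolding body_def
            using eval_evals.If_true[OF a False eval_evals.If_true[OF ec1 n2
               eval_evals.If_true[OF ec2 n3 eval_evals.Pair[OF t1(2) eval_evals.Pair[OF t2(2) t3(2)]]]]] by (simp add: body_def)
          then show ?thesis using False n2 n3 t1(1) t2(1) t3(1)
            by (intro exI[of _ "2 + (3 + (4 + (t1 + (t2 + t3 + 1) + 1) + 1) + 1) + 1"])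
              (simp add: compress.simps[of x] ctime.simps[of x])
        qed
      qed
    qed
  qed
  then show ?thesis unfolding implT_def by blast
qed

text \<open>
  Splitting a ternary root creates one new node, whose vertex set is a union of two old ones; this
  at most doubles the module-width.
\<close>

fun bin :: "nat rtree \<Rightarrow> btree" where
  "bin (Leaf v) = BL v"
| "bin (Node []) = BL 0"
| "bin (Node [t]) = bin t"
| "bin (Node [s, t]) = BB (bin s) (bin t)"
| "bin (Node (s # t # u # us)) = BB (bin s) (BB (bin t) (bin u))"

text \<open>Three children are allowed at every node and not only at the root, so the property is
  inherited by subtrees, as inductions require.\<close>

definition branching :: "nat rtree \<Rightarrow> bool" where
  "branching T \<longleftrightarrow> (\<forall>t\<in>subtrees T. t \<noteq> Node [] \<and> length (children t) \<le> 3)"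

lemma branching_Node: "branching (Node ts) \<Longrightarrow> t \<in> set ts \<Longrightarrow> branching t"
  unfolding branching_def by auto

lemma branching_Node_children: "branching (Node ts) \<Longrightarrow> ts \<noteq> [] \<and> length ts \<le> 3"
  unfolding branching_def by auto

lemma rbd_branching: "rooted_branch_decomposition V T \<Longrightarrow> branching T"
  unfolding rooted_branch_decomposition_def max_degree_le_3_def branching_def
  by (cases T) fastforce+

text \<open>Besides the unary ones, a tree with \<open>l\<close> leaves has at most
  \<open>2 * l - 1\<close> nodes, at 60 steps each. The 60 added on the left accounts for the
  missing node and makes the bound inductive.\<close>

lemma compress_enc_tree:
  "branching T \<Longrightarrow> compress (enc_tree T) = btenc (bin T) \<and> bleaves (bin T) = leaf_labels T \<and>
    ctime (enc_tree T) + 60 \<le> 60 * (2 * length (leaf_labels T) + num_unary T)"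
proof (induction T rule: bin.induct)
  case (1 v)
  then show ?case by (simp add: compress.simps[of "Pair _ _"] ctime.simps[of "Pair _ _"] enc_bool_def)
next
  case 2
  then show ?case using branching_Node_children by blast
next
  case (3 t)
  then show ?case using branching_Node[OF 3(2)]
    by (simp add: compress.simps[of "Pair _ _"] ctime.simps[of "Pair _ _"] enc_bool_def)
next
  case (4 s t)
  then show ?case using branching_Node[OF 4(3)]
    by (simp add: compress.simps[of "Pair _ _"] ctime.simps[of "Pair _ _"] enc_bool_def)
next
  case (5 s t u us)
  then have "us = []" using branching_Node_children[OF 5(4)] by simp
  then show ?case using 5 branching_Node[OF 5(4)]
    by (simp add: compress.simps[of "Pair _ _"] ctime.simps[of "Pair _ _"] enc_bool_def)
qed

lemma subtrees_refl: "t \<in> subtrees t"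
  by (cases t) auto

text \<open>Most nodes of \<open>bin T\<close> have the leaves of a single node of \<open>T\<close>,
  and then \<open>s\<close> and \<open>t\<close> coincide. Only the lower one of the two nodes made
  from a ternary node needs two different ones.\<close>

lemma bsub_bin:
  "branching T \<Longrightarrow> u \<in> bsub (bin T) \<Longrightarrow>
    \<exists>s\<in>subtrees T. \<exists>t\<in>subtrees T. set (bleaves u) = set (leaf_labels s) \<union> set (leaf_labels t)"
proof (induction T rule: bin.induct)
  case (1 v)
  then show ?case by simp
next
  case 2
  then show ?case using branching_Node_children by blast
next
  case (3 t)
  then show ?case using branching_Node[OF 3(2)] by auto
next
  case (4 s t)
  have g: "branching s" "branching t" using branching_Node[OF 4(3)] by auto
  show ?case
  proof (cases "u = bin (Node [s, t])")
    case True
    then have "set (bleaves u) = set (leaf_labels (Node [s, t])) \<union> set (leaf_labels (Node [s, t]))"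
      using compress_enc_tree[OF 4(3)] by simp
    then show ?thesis using subtrees_refl by blast
  next
    case False
    then have "u \<in> bsub (bin s) \<or> u \<in> bsub (bin t)" using 4(4) by auto
    then show ?thesis using 4(1)[OF g(1)] 4(2)[OF g(2)] by auto
  qed
next
  case (5 s t v us)
  have us: "us = []" using branching_Node_children[OF 5(4)] by simp
  have g: "branching s" "branching t" "branching v" using branching_Node[OF 5(4)] by auto
  consider "u = bin (Node (s # t # v # us))" | "u = BB (bin t) (bin v)" | "u \<in> bsub (bin s)" | "u \<in> bsub (bin t)" | "u \<in> bsub (bin v)"
    using 5(5) by auto
  then show ?case
  proof cases
    case 1
    then have "set (bleaves u) = set (leaf_labels (Node (s # t # v # us))) \<union> set (leaf_labels (Node (s # t # v # us)))"
      using compress_enc_tree[OF 5(4)] by simp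
    then show ?thesis using subtrees_refl by blast
  next
    case 2
    then have "set (bleaves u) = set (leaf_labels t) \<union> set (leaf_labels v)"
      using compress_enc_tree[OF g(2)] compress_enc_tree[OF g(3)] by simp
    moreover have "t \<in> subtrees (Node (s # t # v # us))" "v \<in> subtrees (Node (s # t # v # us))"
      using subtrees_refl by auto
    ultimately show ?thesis by blast
  next
    case 3
    then show ?thesis using 5(1)[OF g(1)] by auto
  next
    case 4
    then show ?thesis using 5(2)[OF g(2)] by auto
  next
    case 5
    then show ?thesis using "5.IH"(3)[OF g(3)] by auto
  qed
qed

text \<open>
  The number \<open>k\<close> may be much larger than the rest of the input, so only its first \<open>n\<close> bits are
  looked at; a longer \<open>k\<close> exceeds \<open>n\<close> and is replaced by \<open>0\<close>, for which the answer is also negative.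
\<close>

definition preprocess :: "val \<Rightarrow> val" where
  "preprocess x = Pair (val_fst x) (Pair (compress (fst_snd x))
     (if dropv (val_fst x) (snd_snd x) \<noteq> Nl then Nl else snd_snd x))"

lemma implT_preprocess:
  "implT preprocess (\<lambda>x. ctime (fst_snd x) + 24 * length (lst (val_fst x)) + 100)"
proof -
  have 1: "implT (\<lambda>x. foldr (\<lambda>a r. val_snd r) (lst (val_fst x)) (snd_snd x))
    (\<lambda>x. (1 + 1) + (1 + 1 + 1) + 20 + fold_time (\<lambda>_. 1 + 1 + 1 + 1) (\<lambda>a r. val_snd r) (snd_snd x) x (lst (val_fst x)))"
    by (rule implT_foldr[where G = "\<lambda>a r x. val_snd r"]) (intro implT_fst implT_snd implT_id)+
  have "fold_time (\<lambda>_. 1 + 1 + 1 + 1) (\<lambda>a r. val_snd r) h x xs = 24 * length xs" for h x xs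
    by (induction xs) auto
  with 1 have dr: "implT (\<lambda>x. dropv (val_fst x) (snd_snd x)) (\<lambda>x. 25 + 24 * length (lst (val_fst x)))"
    unfolding dropv_def by simp
  have "implT preprocess (\<lambda>x. (1 + 1) + ((1 + 1 + 1) + ctime (fst_snd x) + 3 +
      (25 + 24 * length (lst (val_fst x)) + 1 + (1 + 1 + 1) + 5) + 5) + 5)"
    unfolding preprocess_def
    by (rule implT_Pair[OF implT_fst[OF implT_id] implT_Pair[OF implT_comp[OF implT_compress implT_fst[OF implT_snd[OF implT_id]]]
      implT_If[OF dr implT_Nl implT_snd[OF implT_snd[OF implT_id]]]]])
  then show ?thesis by (rule implT_mono) simp
qed

section \<open>Counting module classes\<close>

text \<open>Equivalence inside a part is finer than in the union, so each class of the union arises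
  from a class of one of the parts.\<close>

lemma card_module_equiv_Un:
  assumes "finite A" "finite B"
  shows "card ((A \<union> B) // module_equiv V E (A \<union> B)) \<le>
    card (A // module_equiv V E A) + card (B // module_equiv V E B)"
proof -
  let ?r = "module_equiv V E (A \<union> B)"
  have img: "?r `` {x} = ?r `` (module_equiv V E C `` {x})" if "x \<in> C" "C \<subseteq> A \<union> B" for x C
    using that unfolding module_equiv_def by blast
  have "(A \<union> B) // ?r \<subseteq> (\<lambda>C. ?r `` C) ` (A // module_equiv V E A \<union> B // module_equiv V E B)"
  proof
    fix C assume "C \<in> (A \<union> B) // ?r"
    then obtain x where x: "x \<in> A \<union> B" "C = ?r `` {x}" by (rule quotientE)
    show "C \<in> (\<lambda>C. ?r `` C) ` (A // module_equiv V E A \<union> B // module_equiv V E B)"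
    proof (cases "x \<in> A")
      case True
      show ?thesis unfolding x(2) by (subst img[OF True]) (auto intro!: imageI quotientI True)
    next
      case False
      then have B: "x \<in> B" using x by simp
      show ?thesis unfolding x(2) by (subst img[OF B]) (auto intro!: imageI quotientI B)
    qed
  qed
  moreover have fin: "finite (A // module_equiv V E A)" "finite (B // module_equiv V E B)"
    using assms by (auto intro!: finite_quotient simp: module_equiv_def)
  ultimately have "card ((A \<union> B) // ?r) \<le> card (A // module_equiv V E A \<union> B // module_equiv V E B)"
    by (intro surj_card_le) auto
  also have "\<dots> \<le> card (A // module_equiv V E A) + card (B // module_equiv V E B)" by (rule card_Un_le)
  finally show ?thesis .
qed

section \<open>Bounds on the module-width\<close>

lemma finite_subtrees: "finite (subtrees T)"
  by (induction T) auto

lemma subtrees_leaves: "t \<in> subtrees T \<Longrightarrow> set (leaf_labels t) \<subseteq> set (leaf_labels T)"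
  by (induction T) fastforce+

lemma module_width_ge:
  assumes "t \<in> subtrees T"
  shows "card (set (leaf_labels t) // module_equiv V E (set (leaf_labels t))) \<le> module_width V E T"
  unfolding module_width_def using assms by (intro Max_ge finite_imageI finite_subtrees) auto

lemma card_quotient_le: "finite A \<Longrightarrow> card (A // r) \<le> card A"
proof -
  have "A // r = (\<lambda>x. r `` {x}) ` A" unfolding quotient_def by auto
  then show "finite A \<Longrightarrow> card (A // r) \<le> card A" by (simp add: card_image_le)
qed

lemma module_width_le_card:
  assumes "finite V" "set (leaf_labels T) \<subseteq> V"
  shows "module_width V E T \<le> card V"
proof -
  have "card (set (leaf_labels t) // module_equiv V E (set (leaf_labels t))) \<le> card V" if "t \<in> subtrees T" for t
    using card_quotient_le[of "set (leaf_labels t)"] subtrees_leaves[OF that] assms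
    by (meson card_mono finite_set order_trans)
  then show ?thesis unfolding module_width_def
    using subtrees_refl by (subst Max_le_iff) (auto intro: finite_subtrees)
qed

section \<open>Binary numbers\<close>

lemma lst_enc_nat: "lst (enc_nat k) = (if k = 0 then [] else enc_bool (odd k) # lst (enc_nat (k div 2)))"
  by (subst enc_nat.simps) simp

lemma enc_nat_0: "enc_nat 0 = Nl"
  by (simp add: enc_nat.simps)

lemma length_enc_nat: "k < 2 ^ c \<Longrightarrow> length (lst (enc_nat k)) \<le> c"
proof (induction c arbitrary: k)
  case (Suc c)
  then have "k div 2 < 2 ^ c" by auto
  then show ?case using Suc.IH by (subst lst_enc_nat) simp
qed (simp add: enc_nat.simps)

lemma size_enc_bool: "size (enc_bool b) \<le> Suc 0"
  by (simp add: enc_bool_def)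

lemma enc_nat_bits: "x \<in> set (lst (enc_nat k)) \<Longrightarrow> size x \<le> 1"
proof (induction k rule: less_induct)
  case (less k)
  then show ?case
    by (subst (asm) (2) lst_enc_nat) (auto split: if_splits simp: size_enc_bool dest: less.IH[rotated])
qed

lemma size_enc_nat:
  assumes "length (lst (enc_nat k)) \<le> c"
  shows "size (enc_nat k) \<le> 2 * c"
proof -
  have "size (enc_list (lst (enc_nat k))) \<le> c * (1 + 1)"
    by (rule size_enc_list_le) (use assms enc_nat_bits in auto)
  then show ?thesis by simp
qed

lemma size_unary: "size (enc_list (replicate c Nl)) = c"
  by (induction c) auto

text \<open>Cutting off at the intermediate stages is harmless: once the leading bits form a number
  of at least \<open>c\<close>, so does the whole.\<close>

lemma tou_enc_nat:
  assumes "lst cap = replicate c Nl"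
  shows "tou cap (enc_nat k) = enc_list (replicate (min k c) Nl)"
proof (induction k rule: less_induct)
  case (less k)
  show ?case
  proof (cases "k = 0")
    case False
    define q where "q = min (k div 2) c"
    have cap: "cap = enc_list (replicate c Nl)" by (metis assms enc_list_lst)
    define b where "b = (if enc_bool (odd k) = Nl then Nl else Pair Nl Nl)"
    have "b = enc_list (replicate (k mod 2) Nl)" unfolding b_def by (auto simp: odd_iff_mod_2_eq_one)
    moreover have "tou cap (enc_nat (k div 2)) = enc_list (replicate q Nl)"
      unfolding q_def using False by (intro less) simp
    ultimately have r: "app (app (tou cap (enc_nat (k div 2))) (tou cap (enc_nat (k div 2)))) b
        = enc_list (replicate (q + q + k mod 2) Nl)"
      by (simp add: app_def replicate_add)
    have "tou cap (enc_nat k) = (let s = app (app (tou cap (enc_nat (k div 2))) (tou cap (enc_nat (k div 2)))) b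
      in if dropv cap s = Nl then s else cap)"
      unfolding tou_def b_def by (subst lst_enc_nat) (simp add: False Let_def)
    also have "\<dots> = enc_list (replicate (min k c) Nl)"
      unfolding r Let_def by (auto simp: dropv_conv cap q_def min_def split: if_splits) presburger+
    finally show ?thesis .
  qed (simp add: tou_def enc_nat.simps)
qed

section \<open>Instances\<close>

locale graph_instance =
  fixes n :: nat and E :: "nat set set" and k :: nat
  assumes graph: "simple_graph {..<n} E" and n_pos: "1 \<le> n"
begin

text \<open>The program names vertex \<open>i\<close> by the unary \<open>n - 1 - i\<close>, since \<open>foldr\<close> counts from the end.\<close>

definition nm :: "nat \<Rightarrow> val" where
  "nm i = enc_list (replicate (n - 1 - i) Nl)"

definition kbits :: val where
  "kbits = (if dropv (enc_graph n E) (enc_nat k) \<noteq> Nl then Nl else enc_nat k)"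

definition kk :: nat where
  "kk = min (if length (lst (enc_nat k)) \<le> n then k else 0) (Suc n)"

definition ctx :: val where
  "ctx = ctx_of (idx (enc_graph n E)) kbits"

lemma inj_nm: "inj_on nm {..<n}"
proof (rule inj_onI)
  fix i j assume ij: "i \<in> {..<n}" "j \<in> {..<n}" "nm i = nm j"
  then have "length (replicate (n - 1 - i) Nl) = length (replicate (n - 1 - j) Nl)" unfolding nm_def by simp
  then show "i = j" using ij by simp
qed

lemma nm_eq_iff: "i < n \<Longrightarrow> j < n \<Longrightarrow> nm i = nm j \<longleftrightarrow> i = j"
  using inj_nm by (auto dest: inj_onD)

lemma size_nm: "size (nm i) < n"
  using n_pos unfolding nm_def size_unary by simp

lemma idx_map: "lst (idx (enc_list (map f [0..<n]))) = map (\<lambda>i. Pair (nm i) (f i)) [0..<n]"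
  unfolding idx_conv nm_def by simp

lemma lst_ctx_verts: "lst (cv ctx) = map nm [0..<n]"
  unfolding ctx_def ctx_of_def enc_graph_def by (simp add: idx_map)

lemma verts: "set (lst (cv ctx)) = nm ` {..<n}"
  unfolding lst_ctx_verts by auto

lemma lst_cap: "lst (ccap ctx) = replicate (Suc n) Nl"
  unfolding ctx_def ctx_of_def enc_graph_def by (simp add: idx_map map_replicate_const)

lemma tou_kbits: "lst (ck ctx) = replicate kk Nl"
proof -
  have "ck ctx = tou (ccap ctx) kbits" unfolding ctx_def ctx_of_def by simp
  moreover have "kbits = enc_nat (if length (lst (enc_nat k)) \<le> n then k else 0)"
    unfolding kbits_def dropv_conv enc_graph_def by (auto simp: enc_nat_0)
  ultimately show ?thesis unfolding kk_def by (simp only: tou_enc_nat[OF lst_cap] lst_enc_list)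
qed

lemma lst_ctx_edges:
  "lst (ce ctx) = concat (map (\<lambda>i. map (\<lambda>j. Pair (nm i) (nm j)) (filter (\<lambda>j. {i, j} \<in> E) [0..<n])) [0..<n])"
proof -
  let ?row = "\<lambda>i. map (\<lambda>j. Pair (nm j) (enc_bool ({i, j} \<in> E))) [0..<n]"
  let ?R = "map (\<lambda>i. Pair (nm i) (enc_list (map (\<lambda>j. enc_bool ({i, j} \<in> E)) [0..<n]))) [0..<n]"
  have "lst (ce ctx) = concat (map (\<lambda>r. map (\<lambda>c. Pair (val_fst r) (val_fst c))
    (filter (\<lambda>c. \<not> val_snd c = Nl) (lst (idx (val_snd r))))) ?R)"
    unfolding ctx_def ctx_of_def enc_graph_def by (simp add: idx_map)
  also have "\<dots> = concat (map (\<lambda>i. map (\<lambda>c. Pair (nm i) (val_fst c)) (filter (\<lambda>c. \<not> val_snd c = Nl) (?row i))) [0..<n])"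
    by (simp add: idx_map comp_def)
  also have "(\<lambda>i. map (\<lambda>c. Pair (nm i) (val_fst c)) (filter (\<lambda>c. \<not> val_snd c = Nl) (?row i))) =
      (\<lambda>i. map (\<lambda>j. Pair (nm i) (nm j)) (filter (\<lambda>j. {i, j} \<in> E) [0..<n]))"
    by (simp add: filter_map comp_def)
  finally show ?thesis .
qed

lemma adj_ctx: "adjp ctx u v \<longleftrightarrow> (\<exists>i<n. \<exists>j<n. {i, j} \<in> E \<and> u = nm i \<and> v = nm j)"
  unfolding adjp_def lst_ctx_edges set_concat set_map UN_iff image_iff by auto
lemma adj_nm: "i < n \<Longrightarrow> j < n \<Longrightarrow> adjp ctx (nm i) (nm j) \<longleftrightarrow> {i, j} \<in> E"
  unfolding adj_ctx by (auto simp: nm_eq_iff)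

lemma edge_not_loop: "{i} \<notin> E"
  using graph unfolding simple_graph_def by fastforce

lemma graph_ctx: "graph_ctx ctx"
proof
  show "distinct (lst (cv ctx))" unfolding lst_ctx_verts using inj_nm by (simp add: distinct_map atLeast0LessThan)
  show "adjp ctx v u" if "adjp ctx u v" for u v
    using that unfolding adj_ctx by (metis insert_commute)
  show "\<not> adjp ctx u u" for u
    unfolding adj_ctx using nm_eq_iff edge_not_loop by auto
qed

sublocale graph_ctx ctx kk
  by (rule graph_ctx)

lemma leaf_vertex_nm:
  assumes "v < n"
  shows "leaf_vertex (btenc (BL v)) ctx = nm v"
proof -
  have "tou (ccap ctx) (enc_nat v) = enc_list (replicate v Nl)"
    using tou_enc_nat[OF lst_cap, of v] assms by simp
  then have "leaf_vertex (btenc (BL v)) ctx = val_fst (enc_list (drop v (map nm [0..<n])))"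
    unfolding leaf_vertex_def by (simp add: dropv_conv lst_ctx_verts)
  also have "drop v (map nm [0..<n]) = map nm [v..<n]" by (simp add: drop_map)
  also have "\<dots> = nm v # map nm [Suc v..<n]" using assms by (simp add: upt_conv_Cons)
  finally show ?thesis by simp
qed

lemma tree_ctx: "tree_ctx ctx kk n w ((n + 2) ^ 2 ^ (2 * w + 2)) nm"
proof
  show "kk \<le> Suc n" unfolding kk_def by simp
  show "length (lst (cv ctx)) = n" unfolding lst_ctx_verts by simp
  show "size v \<le> n" if "v \<in> V" for v
    using that size_nm order_less_imp_le unfolding verts by auto
qed (use n_pos verts inj_nm leaf_vertex_nm tou_kbits in auto)

text \<open>A saturated set is a union of classes and thus determined by a subset of the quotient.
  Here the relation on vertex names is identified with \<open>module_equiv\<close>.\<close>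

lemma range_satS_card:
  assumes "B \<subseteq> {..<n}"
  shows "card (range (satS (nm ` B))) \<le> 2 ^ card (B // module_equiv {..<n} E B)"
proof -
  let ?r = "module_equiv {..<n} E B"
  let ?f = "\<lambda>K. enc_list (filter (\<lambda>v. v \<in> nm ` \<Union>K) (lst (cv ctx)))"
  have eqS_iff: "eqS (nm ` B) (nm x) (nm b) \<longleftrightarrow> (x, b) \<in> ?r" if xb: "x \<in> B" "b \<in> B" for x b
  proof -
    have "eqS (nm ` B) (nm x) (nm b) \<longleftrightarrow> (\<forall>i<n. nm i \<in> nm ` B \<or> (adjp ctx (nm x) (nm i) \<longleftrightarrow> adjp ctx (nm b) (nm i)))"
      using xb unfolding eqS_def verts by auto
    also have "\<dots> \<longleftrightarrow> (\<forall>i<n. i \<in> B \<or> ({x, i} \<in> E \<longleftrightarrow> {b, i} \<in> E))"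
    proof -
      have "nm i \<in> nm ` B \<longleftrightarrow> i \<in> B" if "i < n" for i
        using that assms inj_on_image_mem_iff[OF inj_nm] by auto
      moreover have "x < n" "b < n" using xb assms by auto
      ultimately show ?thesis by (simp add: adj_nm)
    qed
    also have "\<dots> \<longleftrightarrow> (x, b) \<in> ?r" using xb unfolding module_equiv_def nbhd_def by auto
    finally show ?thesis .
  qed
  have "satS (nm ` B) X \<in> ?f ` Pow (B // ?r)" for X
  proof -
    define K where "K = (\<lambda>x. ?r `` {x}) ` {x \<in> B. nm x \<in> X}"
    have "cl (nm ` B) X = nm ` \<Union>K"
    proof (intro set_eqI iffI)
      fix v assume "v \<in> cl (nm ` B) X"
      then obtain b x where b: "b \<in> B" "v = nm b" "x \<in> B" "nm x \<in> X" "eqS (nm ` B) (nm x) (nm b)"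
        unfolding cl_def eqS_def by auto
      then have "(x, b) \<in> ?r" using eqS_iff by simp
      then show "v \<in> nm ` \<Union>K" unfolding K_def using b by blast
    next
      fix v assume "v \<in> nm ` \<Union>K"
      then obtain x b where b: "x \<in> B" "nm x \<in> X" "(x, b) \<in> ?r" "v = nm b" unfolding K_def by auto
      then have "b \<in> B" unfolding module_equiv_def by simp
      then show "v \<in> cl (nm ` B) X" using b eqS_iff unfolding cl_def by auto
    qed
    then have "satS (nm ` B) X = ?f K" unfolding satS_def by simp
    moreover have "K \<in> Pow (B // ?r)" unfolding K_def quotient_def by auto
    ultimately show ?thesis by (rule image_eqI)
  qed
  then have sub: "range (satS (nm ` B)) \<subseteq> ?f ` Pow (B // ?r)" by blast
  have fin: "finite (B // ?r)"
    using finite_subset[OF assms] by (auto intro!: finite_quotient simp: module_equiv_def)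
  then have "card (range (satS (nm ` B))) \<le> card (Pow (B // ?r))"
    using sub by (intro surj_card_le) auto
  then show ?thesis using fin by (simp add: card_Pow)
qed

subsection \<open>b-colorings\<close>

lemma b_coloring_of_valid:
  assumes f: "valid V f D" and D: "\<And>j. j < kk \<Longrightarrow> (\<exists>v\<in>D. f v = j) \<and> (\<forall>v\<in>D. f v \<noteq> j \<longrightarrow> (\<exists>u\<in>V. f u = j \<and> adjp ctx v u))"
  shows "\<exists>C. b_coloring {..<n} E kk C"
proof -
  \<comment> \<open>Classes are numbered from 1 in \<open>b_coloring\<close>, the colors of the
    program from 0.\<close>
  define C where "C i = {x. x < n \<and> Suc (f (nm x)) = i}" for i
  have fk: "f (nm x) < kk" if "x < n" for x using f that verts unfolding valid_def by auto
  have "coloring {..<n} kk C" unfolding coloring_def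
  proof
    show "disjoint_family_on C {1..kk}" unfolding disjoint_family_on_def C_def by auto
    show "(\<Union>i\<in>{1..kk}. C i) = {..<n}" unfolding C_def using fk by (auto simp: Suc_le_eq)
  qed
  moreover have "independent E (C i)" for i
  proof -
    have "{u, v} \<notin> E" if "u \<in> C i" "v \<in> C i" for u v
    proof
      assume "{u, v} \<in> E"
      then have "adjp ctx (nm u) (nm v)" "nm u \<in> V" "nm v \<in> V" using that adj_nm verts unfolding C_def by auto
      then have "f (nm u) \<noteq> f (nm v)" using f unfolding valid_def by blast
      then show False using that unfolding C_def by auto
    qed
    then show ?thesis unfolding independent_def by blast
  qed
  moreover have "\<exists>v. b_vertex E kk C i v" if i: "i \<in> {1..kk}" for i
  proof -
    have ik: "i - 1 < kk" using i by auto
    obtain v where v: "v \<in> D" "f v = i - 1" using D[OF ik] by blast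
    then have "v \<in> nm ` {..<n}" using f verts unfolding valid_def by blast
    then obtain x where x: "x < n" "v = nm x" by auto
    have "nbhd E x \<inter> C j \<noteq> {}" if j: "j \<in> {1..kk}" "j \<noteq> i" for j
    proof -
      have "j - 1 < kk" "f v \<noteq> j - 1" using i j v by auto
      then obtain u where u: "u \<in> V" "f u = j - 1" "adjp ctx v u" using D v(1) by blast
      then obtain y where y: "y < n" "u = nm y" using verts by auto
      have "{x, y} \<in> E" using u(3) x y adj_nm by simp
      then have "y \<in> nbhd E x \<inter> C j" using y u(2) j unfolding nbhd_def C_def by auto
      then show ?thesis by blast
    qed
    then have "b_vertex E kk C i x" using x v i unfolding b_vertex_def C_def by auto
    then show ?thesis by blast
  qed
  ultimately show ?thesis unfolding b_coloring_def proper_coloring_def by blast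
qed

text \<open>One b-vertex is fixed for each color. These vertices form \<open>D\<close>; they lie in
  different classes, so \<open>f\<close> is injective on them.\<close>

lemma valid_of_b_coloring:
  assumes "b_coloring {..<n} E kk C"
  shows "\<exists>f D. valid V f D \<and> (\<forall>j<kk. (\<exists>v\<in>D. f v = j) \<and> (\<forall>v\<in>D. f v \<noteq> j \<longrightarrow> (\<exists>u\<in>V. f u = j \<and> adjp ctx v u)))"
proof -
  have disj: "disjoint_family_on C {1..kk}" and un: "(\<Union>i\<in>{1..kk}. C i) = {..<n}"
    and ind: "\<And>i. i \<in> {1..kk} \<Longrightarrow> independent E (C i)"
    and bv: "\<And>i. i \<in> {1..kk} \<Longrightarrow> \<exists>v. b_vertex E kk C i v"
    using assms unfolding b_coloring_def proper_coloring_def coloring_def by auto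
  obtain b where b: "\<And>i. i \<in> {1..kk} \<Longrightarrow> b_vertex E kk C i (b i)" using bv by metis
  obtain g where g: "\<And>x. x < n \<Longrightarrow> g x \<in> {1..kk} \<and> x \<in> C (g x)" using un by (metis UN_E lessThan_iff)
  have gu: "g x = i" if "i \<in> {1..kk}" "x \<in> C i" for x i
  proof (rule ccontr)
    assume "g x \<noteq> i"
    moreover have "x < n" using un that by auto
    ultimately show False using disj g that unfolding disjoint_family_on_def by blast
  qed
  \<comment> \<open>\<open>g\<close> gives the class of a vertex, numbered from 1, and
    \<open>inv_into\<close> recovers the vertex from its name.\<close>
  define f where "f v = g (inv_into {..<n} nm v) - 1" for v
  have f: "f (nm x) = g x - 1" if "x < n" for x
    unfolding f_def using that inv_into_f_f[OF inj_nm] by simp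
  have bn: "b i < n" "g (b i) = i" if "i \<in> {1..kk}" for i
  proof -
    have "b i \<in> C i" using b[OF that] unfolding b_vertex_def by blast
    then show "b i < n" "g (b i) = i" using un that gu by auto
  qed
  define D where "D = (\<lambda>i. nm (b i)) ` {1..kk}"
  have fD: "f (nm (b i)) = i - 1" if "i \<in> {1..kk}" for i using f bn that by simp
  have "valid V f D" unfolding valid_def
  proof (intro conjI ballI impI)
    fix v assume "v \<in> V"
    then obtain x where x: "x < n" "v = nm x" using verts by auto
    show "f v < kk" using g[OF x(1)] x f by auto
  next
    show "D \<subseteq> V" unfolding D_def verts using bn by auto
    show "inj_on f D"
    proof (rule inj_onI)
      fix u v assume "u \<in> D" "v \<in> D" "f u = f v"
      then obtain i j where ij: "i \<in> {1..kk}" "j \<in> {1..kk}" "u = nm (b i)" "v = nm (b j)" unfolding D_def by blast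
      then have "i - 1 = j - 1" using fD \<open>f u = f v\<close> by simp
      then show "u = v" using ij by (metis atLeastAtMost_iff eq_diff_iff)
    qed
    fix u v assume uv: "u \<in> V" "v \<in> V" "adjp ctx u v"
    then obtain x y where xy: "x < n" "u = nm x" "y < n" "v = nm y" using verts by auto
    have "{x, y} \<in> E" using uv(3) xy adj_nm by simp
    then have "g x \<noteq> g y" using ind[of "g x"] g[OF xy(1)] g[OF xy(3)] unfolding independent_def by metis
    then show "f u \<noteq> f v" using f xy g[OF xy(1)] g[OF xy(3)] by auto
  qed
  moreover have "(\<exists>v\<in>D. f v = j) \<and> (\<forall>v\<in>D. f v \<noteq> j \<longrightarrow> (\<exists>u\<in>V. f u = j \<and> adjp ctx v u))" if j: "j < kk" for j
  proof
    have sj: "Suc j \<in> {1..kk}" using j by auto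
    show "\<exists>v\<in>D. f v = j" using fD[OF sj] sj unfolding D_def by auto
    show "\<forall>v\<in>D. f v \<noteq> j \<longrightarrow> (\<exists>u\<in>V. f u = j \<and> adjp ctx v u)"
    proof (intro ballI impI)
      fix v assume "v \<in> D" "f v \<noteq> j"
      then obtain i where i: "i \<in> {1..kk}" "v = nm (b i)" unfolding D_def by blast
      then have "Suc j \<noteq> i" using fD \<open>f v \<noteq> j\<close> by auto
      then obtain y where y: "y \<in> nbhd E (b i)" "y \<in> C (Suc j)" using b[OF i(1)] sj unfolding b_vertex_def by blast
      have yn: "y < n" using un y(2) sj by auto
      have "f (nm y) = j" using f[OF yn] gu[OF sj y(2)] by simp
      moreover have "adjp ctx v (nm y)" using y(1) i yn bn adj_nm unfolding nbhd_def by simp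
      ultimately show "\<exists>u\<in>V. f u = j \<and> adjp ctx v u" using yn verts by auto
    qed
  qed
  ultimately show ?thesis by blast
qed

text \<open>The classes are disjoint and each contains its b-vertex, so there are at most
  \<open>n\<close>; zero classes cannot cover a nonempty vertex set.\<close>

lemma b_coloring_le:
  assumes "b_coloring {..<n} E k' C"
  shows "1 \<le> k'" "k' \<le> n"
proof -
  have disj: "disjoint_family_on C {1..k'}" and un: "(\<Union>i\<in>{1..k'}. C i) = {..<n}"
    and bv: "\<And>i. i \<in> {1..k'} \<Longrightarrow> \<exists>v. b_vertex E k' C i v"
    using assms unfolding b_coloring_def proper_coloring_def coloring_def by auto
  show "1 \<le> k'"
  proof (rule ccontr)
    assume "\<not> 1 \<le> k'"
    then have "{..<n} = {}" using un by simp
    moreover have "0 \<in> {..<n}" using n_pos by simp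
    ultimately show False by (simp only: empty_iff)
  qed
  have "\<exists>v. v \<in> C i" if "i \<in> {1..k'}" for i using bv[OF that] unfolding b_vertex_def by blast
  then obtain b where b: "\<And>i. i \<in> {1..k'} \<Longrightarrow> b i \<in> C i" by metis
  have "inj_on b {1..k'}"
  proof (rule inj_onI, rule ccontr)
    fix i j assume ij: "i \<in> {1..k'}" "j \<in> {1..k'}" "b i = b j" "i \<noteq> j"
    then have "C i \<inter> C j = {}" using disj unfolding disjoint_family_on_def by blast
    then show False using b[OF ij(1)] b[OF ij(2)] ij(3) by auto
  qed
  moreover have "b ` {1..k'} \<subseteq> {..<n}" unfolding un[symmetric] using b by blast
  ultimately have "card {1..k'} \<le> card {..<n}" by (rule card_inj_on_le) simp
  then show "k' \<le> n" by simp
qed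

text \<open>The substitutes, \<open>0\<close> for a \<open>k\<close> with too many bits and
  \<open>n + 1\<close> for any other \<open>k\<close> beyond \<open>n\<close>, admit no b-coloring,
  just as \<open>k\<close> itself.\<close>

lemma b_coloring_kk: "(\<exists>C. b_coloring {..<n} E kk C) \<longleftrightarrow> (\<exists>C. b_coloring {..<n} E k C)"
proof (cases "k \<le> n")
  case True
  moreover have "length (lst (enc_nat k)) \<le> n"
    using True less_exp[of n] by (intro length_enc_nat) linarith
  ultimately have "kk = k" unfolding kk_def by simp
  then show ?thesis by simp
next
  case False
  then have "kk = 0 \<or> kk = Suc n" unfolding kk_def by auto
  then have "\<not> b_coloring {..<n} E kk C" for C using b_coloring_le[of kk C] by auto
  moreover have "\<not> b_coloring {..<n} E k C" for C using b_coloring_le(2)[of k C] False by auto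
  ultimately show ?thesis by simp
qed

lemma accepting_b_coloring:
  assumes "is_table V T"
  shows "accepting (Pair a T) \<longleftrightarrow> (\<exists>C. b_coloring {..<n} E k C)"
proof -
  have "accepting (Pair a T) \<longleftrightarrow> (\<exists>f D. valid V f D \<and> (\<forall>j<kk. (\<exists>v\<in>D. f v = j) \<and>
     (\<forall>v\<in>D. f v \<noteq> j \<longrightarrow> (\<exists>u\<in>V. f u = j \<and> adjp ctx v u))))"
    by (rule accepting_iff) (use assms in simp)
  also have "\<dots> \<longleftrightarrow> (\<exists>C. b_coloring {..<n} E kk C)"
  proof
    assume "\<exists>f D. valid V f D \<and> (\<forall>j<kk. (\<exists>v\<in>D. f v = j) \<and>
     (\<forall>v\<in>D. f v \<noteq> j \<longrightarrow> (\<exists>u\<in>V. f u = j \<and> adjp ctx v u)))"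
    then obtain f D where "valid V f D" "\<forall>j<kk. (\<exists>v\<in>D. f v = j) \<and>
     (\<forall>v\<in>D. f v \<noteq> j \<longrightarrow> (\<exists>u\<in>V. f u = j \<and> adjp ctx v u))" by (elim exE conjE)
    then show "\<exists>C. b_coloring {..<n} E kk C" by (intro b_coloring_of_valid[of f D]) simp_all
  qed (elim exE, rule valid_of_b_coloring)
  finally show ?thesis unfolding b_coloring_kk .
qed

end

section \<open>Sizes of the preprocessed instance and of its context\<close>

lemma size_btenc:
  assumes "set (bleaves t) \<subseteq> {..<n}"
  shows "size (btenc t) + 1 \<le> length (bleaves t) * (2 * n + 2)"
  using assms
proof (induction t)
  case (BL v)
  have "v < 2 ^ n" using BL less_exp[of n] by (simp add: order.strict_trans)
  then show ?case using size_enc_nat[OF length_enc_nat] by simp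
next
  case (BB l r)
  then have "size (btenc l) + 1 \<le> length (bleaves l) * (2 * n + 2)"
    "size (btenc r) + 1 \<le> length (bleaves r) * (2 * n + 2)" by auto
  then show ?case by (simp add: algebra_simps)
qed

context graph_instance
begin

text \<open>Cubic sizes fit below the eighth power because 6 is at most
  \<open>(n + 2) ^ 5\<close>.\<close>

lemma small_le:
  assumes "x \<le> 6 * (n + 2) ^ 3"
  shows "x \<le> ((n + 2) ^ 2 ^ (2 * w + 2)) ^ 8"
proof -
  have "6 \<le> (3::nat) ^ 5" by simp
  also have "\<dots> \<le> (n + 2) ^ 5" using n_pos by (intro power_mono) auto
  finally have "6 * (n + 2) ^ 3 \<le> (n + 2) ^ 5 * (n + 2) ^ 3" by (rule mult_right_mono) simp
  also have "\<dots> = (n + 2) ^ 8" by (simp flip: power_add)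
  also have "\<dots> \<le> (n + 2) ^ (2 ^ (2 * w + 2) * 8)" by (intro power_increasing) auto
  also have "\<dots> = ((n + 2) ^ 2 ^ (2 * w + 2)) ^ 8" by (rule power_mult)
  finally show ?thesis using assms by (rule order_trans[rotated])
qed

lemma poly_le:
  assumes "a \<le> (n + 2) ^ 2" "b \<le> 2 * (n + 2) ^ 3" "c \<le> n + 2" "d \<le> n + 2" "e \<le> 3"
  shows "a + b + c + d + e \<le> 6 * (n + 2) ^ 3"
proof -
  let ?M = "n + 2"
  have "?M ^ 2 \<le> ?M ^ 3" "?M \<le> ?M ^ 3" using power_increasing[of 1 3 ?M] by (auto intro: power_increasing)
  moreover have "3 * 1 \<le> ?M * ?M ^ 2" using n_pos by (intro mult_mono) auto
  then have "3 \<le> ?M ^ 3" by (simp add: eval_nat_numeral)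
  ultimately have "a \<le> ?M ^ 3" "b \<le> 2 * ?M ^ 3" "c \<le> ?M ^ 3" "d \<le> ?M ^ 3" "e \<le> ?M ^ 3" using assms by linarith+
  then show ?thesis by linarith
qed

lemma size_ctx: "size ctx \<le> ((n + 2) ^ 2 ^ (2 * w + 2)) ^ 8"
proof (rule small_le)
  have "size (enc_list (map nm [0..<n])) \<le> n * (n + 1)"
    by (rule size_enc_list_le) (use size_nm order_less_imp_le in auto)
  also have "\<dots> \<le> (n + 2) ^ 2" unfolding power2_eq_square by (intro mult_le_mono) auto
  finally have 1: "size (cv ctx) \<le> (n + 2) ^ 2" by (metis lst_ctx_verts enc_list_lst)
  let ?f = "\<lambda>i. enc_list (map (\<lambda>j. Pair (nm i) (nm j)) (filter (\<lambda>j. {i, j} \<in> E) [0..<n]))"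
  have "size (?f i) \<le> n * (2 * n + 1)" for i
  proof -
    have "size (?f i) \<le> n * (2 * n + 1)"
    proof (rule order_trans[OF size_enc_list_le[of _ "2 * n" n]])
      fix x assume "x \<in> set (map (\<lambda>j. Pair (nm i) (nm j)) (filter (\<lambda>j. {i, j} \<in> E) [0..<n]))"
      then obtain j where "x = Pair (nm i) (nm j)" by auto
      then show "size x \<le> 2 * n" using size_nm[of i] size_nm[of j] by simp
    qed (auto intro: order_trans[OF length_filter_le])
    then show ?thesis .
  qed
  then have "size (enc_list (concat (map (\<lambda>i. lst (?f i)) [0..<n]))) \<le> length [0..<n] * (n * (2 * n + 1))"
    by (rule size_concat_le)
  also have "\<dots> \<le> (n + 2) * ((n + 2) * (2 * (n + 2)))" unfolding length_upt by (intro mult_le_mono) auto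
  also have "\<dots> = 2 * (n + 2) ^ 3" unfolding power3_eq_cube by (simp only: mult_ac)
  finally have "size (enc_list (lst (ce ctx))) \<le> 2 * (n + 2) ^ 3" unfolding lst_ctx_edges by simp
  then have 2: "size (ce ctx) \<le> 2 * (n + 2) ^ 3" by simp
  have "ck ctx = enc_list (replicate kk Nl)" by (metis tou_kbits enc_list_lst)
  then have 3: "size (ck ctx) \<le> n + 2" unfolding kk_def by (simp add: size_unary)
  have "ccap ctx = enc_list (replicate (Suc n) Nl)" by (metis lst_cap enc_list_lst)
  then have 4: "size (ccap ctx) \<le> n + 2" by (simp only: size_unary)
  have "size ctx = size (cv ctx) + size (ce ctx) + size (ck ctx) + size (ccap ctx) + 3"
    unfolding ctx_def ctx_of_def by simp
  also have "\<dots> \<le> 6 * (n + 2) ^ 3" by (rule poly_le[OF 1 2 3 4]) simp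
  finally show "size ctx \<le> 6 * (n + 2) ^ 3" .
qed

lemma length_kbits: "length (lst kbits) \<le> n" "size kbits \<le> 2 * n"
proof -
  have "kbits = (if length (lst (enc_nat k)) \<le> n then enc_nat k else Nl)"
    unfolding kbits_def dropv_conv enc_graph_def by simp
  then show "length (lst kbits) \<le> n" "size kbits \<le> 2 * n" using size_enc_nat[of k n] by auto
qed

context
  fixes T :: "nat rtree"
  assumes T: "rooted_branch_decomposition {..<n} T"
begin

definition inst :: val where
  "inst = Pair (enc_graph n E) (Pair (btenc (bin T)) kbits)"

lemma preprocess_instance: "preprocess (enc_instance n E T k) = inst"
  unfolding preprocess_def enc_instance_def inst_def kbits_def
  using compress_enc_tree[OF rbd_branching[OF T]] by simp

lemma leaves: "distinct (bleaves (bin T))" "set (bleaves (bin T)) = {..<n}" "length (bleaves (bin T)) = n"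
proof -
  show 1: "distinct (bleaves (bin T))" and 2: "set (bleaves (bin T)) = {..<n}"
    using compress_enc_tree[OF rbd_branching[OF T]] T unfolding rooted_branch_decomposition_def by auto
  show "length (bleaves (bin T)) = n" using distinct_card[OF 1] 2 by simp
qed

lemma size_inst: "size inst \<le> ((n + 2) ^ 2 ^ (2 * w + 2)) ^ 8"
proof (rule small_le)
  have "size (enc_graph n E) \<le> n * (2 * n + 1)" unfolding enc_graph_def
  proof (rule size_enc_list_le)
    fix x assume "x \<in> set (map (\<lambda>i. enc_list (map (\<lambda>j. enc_bool ({i, j} \<in> E)) [0..<n])) [0..<n])"
    then obtain i where "x = enc_list (map (\<lambda>j. enc_bool ({i, j} \<in> E)) [0..<n])" by auto
    moreover have "size (enc_list (map (\<lambda>j. enc_bool ({i, j} \<in> E)) [0..<n])) \<le> n * (1 + 1)"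
      by (rule size_enc_list_le) (use size_enc_bool in auto)
    ultimately show "size x \<le> 2 * n" by simp
  qed simp
  moreover have "size (btenc (bin T)) + 1 \<le> n * (2 * n + 2)"
    using size_btenc[of "bin T" n] leaves by simp
  ultimately have "size inst \<le> n * (2 * n + 1) + n * (2 * n + 2) + 2 * n + 2"
    using length_kbits(2) unfolding inst_def by simp
  also have "\<dots> \<le> 0 + 2 * (n + 2) ^ 3 + n + n + 2"
  proof -
    have "n * (2 * n + 1) + n * (2 * n + 2) \<le> (n + 2) * (2 * (n + 2)) + (n + 2) * (2 * (n + 2))"
      by (intro add_mono mult_le_mono) auto
    also have "\<dots> = 4 * (n + 2) ^ 2" by (simp add: power2_eq_square)
    also have "\<dots> \<le> 2 * (n + 2) * (n + 2) ^ 2" by (intro mult_right_mono) auto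
    also have "\<dots> = 2 * (n + 2) ^ 3" unfolding power3_eq_cube power2_eq_square by (simp only: mult_ac)
    finally show ?thesis by simp
  qed
  also have "\<dots> \<le> 6 * (n + 2) ^ 3" by (rule poly_le) auto
  finally show "size inst \<le> 6 * (n + 2) ^ 3" .
qed

lemma solve_ctx_inst: "solve_ctx inst = ctx"
  unfolding solve_ctx_def inst_def ctx_def by simp

text \<open>Here the width doubles, since a node of the binary tree may be a union of two nodes of
  \<open>T\<close>; the dynamic program is therefore instantiated with twice the
  module-width.\<close>

lemma range_satS_bin:
  assumes "u \<in> bsub (bin T)"
  shows "card (range (satS (nm ` set (bleaves u)))) \<le> 2 ^ (2 * module_width {..<n} E T)"
proof -
  let ?me = "module_equiv {..<n} E"
  obtain s t where st: "s \<in> subtrees T" "t \<in> subtrees T"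
    "set (bleaves u) = set (leaf_labels s) \<union> set (leaf_labels t)"
    using bsub_bin[OF rbd_branching[OF T] assms] by blast
  have "set (bleaves u) \<subseteq> {..<n}" using bsub_leaves[OF assms] leaves(2) by simp
  from range_satS_card[OF this]
  have "card (range (satS (nm ` set (bleaves u)))) \<le> 2 ^ card (set (bleaves u) // ?me (set (bleaves u)))" .
  also have "\<dots> \<le> 2 ^ (2 * module_width {..<n} E T)"
  proof (rule power_increasing)
    have "card (set (bleaves u) // ?me (set (bleaves u))) \<le>
      card (set (leaf_labels s) // ?me (set (leaf_labels s))) + card (set (leaf_labels t) // ?me (set (leaf_labels t)))"
      unfolding st(3) by (rule card_module_equiv_Un) simp_all
    also have "\<dots> \<le> module_width {..<n} E T + module_width {..<n} E T"
      by (intro add_mono module_width_ge st)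
    finally show "card (set (bleaves u) // ?me (set (bleaves u))) \<le> 2 * module_width {..<n} E T" by simp
  qed simp
  finally show ?thesis .
qed

lemma solve_inst: "solve inst = enc_bool (\<exists>C. b_coloring {..<n} E k C)"
proof -
  interpret tc: tree_ctx ctx kk n "2 * module_width {..<n} E T" "(n + 2) ^ 2 ^ (2 * (2 * module_width {..<n} E T) + 2)" nm
    by (rule tree_ctx)
  obtain a tb where at: "trec node_step leaf_step ctx (btenc (bin T)) = Pair a tb" "is_table (nm ` set (bleaves (bin T))) tb"
    using tc.trec_is_table[OF leaves(1)] leaves(2) by auto
  then have "is_table V tb" using leaves(2) verts by simp
  moreover have "solve inst = enc_bool (accepting (Pair a tb))"
    unfolding solve_def solve_ctx_def[symmetric] solve_ctx_inst using at(1) by (simp add: inst_def)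
  ultimately show ?thesis using accepting_b_coloring by simp
qed

lemma solve_bound_inst:
  "solve_bound inst (((n + 2) ^ 2 ^ (2 * (2 * module_width {..<n} E T) + 2)) ^ 9)"
proof -
  let ?w = "2 * module_width {..<n} E T"
  let ?m = "(n + 2) ^ 2 ^ (2 * ?w + 2)"
  interpret tc: tree_ctx ctx kk n ?w ?m nm
    by (rule tree_ctx)
  have "size inst \<le> ?m ^ 8" by (rule size_inst)
  also have "\<dots> \<le> ?m ^ 9" by (intro power_increasing) auto
  finally have "size inst \<le> ?m ^ 9" .
  moreover have "node_bound (Pair (trec node_step leaf_step ctx (val_fst s)) (Pair (trec node_step leaf_step ctx (val_snd s)) ctx)) (?m ^ 9)"
    if "s \<in> nodes (btenc (bin T))" "val_fst s \<noteq> Nl" for s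
    by (rule tc.trec_node_bound[OF leaves(1) _ range_satS_bin size_ctx that]) (use leaves(2) in auto)
  ultimately show ?thesis unfolding solve_bound_def solve_ctx_inst by (simp add: inst_def)
qed

text \<open>A positive width lets \<open>C * w\<close> absorb additive constants in the exponent of
  the running time.\<close>

lemma module_width_pos: "1 \<le> module_width {..<n} E T"
proof -
  let ?me = "module_equiv {..<n} E {..<n}"
  have "set (leaf_labels T) = {..<n}" using T unfolding rooted_branch_decomposition_def by blast
  then have "card ({..<n} // ?me) \<le> module_width {..<n} E T"
    using module_width_ge[OF subtrees_refl[of T], of "{..<n}" E] by simp
  moreover have "finite ({..<n} // ?me)" by (auto intro!: finite_quotient simp: module_equiv_def)
  moreover have "?me `` {0} \<in> {..<n} // ?me" using n_pos by (intro quotientI) auto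
  ultimately show ?thesis by (metis One_nat_def Suc_leI card_gt_0_iff empty_iff order_trans)
qed

lemma module_width_le_n: "module_width {..<n} E T \<le> n"
  using module_width_le_card[of "{..<n}" T E] T unfolding rooted_branch_decomposition_def by simp

lemma ctime_instance:
  "ctime (fst_snd (enc_instance n E T k)) + 24 * length (lst (val_fst (enc_instance n E T k)))
    \<le> 144 * n + 60 * num_unary T"
  using compress_enc_tree[OF rbd_branching[OF T]] leaves(3) by (simp add: enc_instance_def enc_graph_def)

end

end

text \<open>For \<open>n = 1\<close> all powers of \<open>n\<close> are 1, so \<open>C\<close> must
  dominate the run by itself; then \<open>w = 1\<close>, and the last summand is
  \<open>3 ^ (576 * c)\<close> with \<open>576 = 2 ^ 6 * 9\<close>. For \<open>n \<ge> 2\<close>,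
  \<open>n + 2 \<le> n ^ 2\<close> changes the base to \<open>n\<close> and \<open>9 * c\<close>
  into \<open>18 * c\<close>, which is below \<open>2 ^ (18 * c)\<close> and moves into the upper
  exponent.\<close>

lemma run_time_bound:
  fixes n w c u t :: nat
  assumes n: "1 \<le> n" and w: "1 \<le> w" "w \<le> n"
    and t: "t \<le> 144 * n + 60 * u + 103 + (((n + 2) ^ 2 ^ (2 * (2 * w) + 2)) ^ 9) ^ c"
    and C: "C = 1000 + 18 * c + 3 ^ (576 * c)"
  shows "t \<le> C * (n ^ (2 ^ (C * w)) + u)"
proof (cases "n = 1")
  case True
  then have "w = 1" using w by simp
  have "((x ^ 64) ^ 9) ^ c = x ^ (576 * c)" for x :: nat by (simp flip: power_mult)
  moreover have "n + 2 = 3" "2 ^ (2 * (2 * w) + 2) = (64::nat)" using True \<open>w = 1\<close> by simp_all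
  ultimately have eq: "(((n + 2) ^ 2 ^ (2 * (2 * w) + 2)) ^ 9) ^ c = 3 ^ (576 * c)" by (simp only:)
  define Y :: nat where "Y = 3 ^ (576 * c)"
  have "t \<le> 144 * n + 60 * u + 103 + Y" using t unfolding eq Y_def .
  moreover have "247 + Y \<le> C" "60 \<le> C" unfolding C Y_def by linarith+
  moreover from this have "60 * u \<le> C * u" by (intro mult_right_mono) auto
  ultimately have "t \<le> C + C * u" using True by linarith
  then show ?thesis unfolding True by simp
next
  case False
  then have n2: "2 \<le> n" using n by simp
  define X where "X = n ^ (2 ^ (C * w))"
  have "n ^ 1 \<le> X" unfolding X_def using n by (intro power_increasing) auto
  then have nX: "n \<le> X" by simp
  have "2 * n \<le> n * n" using n2 by (intro mult_right_mono) auto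
  then have "n + 2 \<le> n ^ 2" unfolding power2_eq_square using n2 by linarith
  then have "(n + 2) ^ (2 ^ (4 * w + 2) * 9 * c) \<le> (n ^ 2) ^ (2 ^ (4 * w + 2) * 9 * c)" by (intro power_mono) auto
  also have "\<dots> = n ^ (18 * c * 2 ^ (4 * w + 2))" by (simp flip: power_mult add: mult_ac)
  also have "\<dots> \<le> X" unfolding X_def
  proof (rule power_increasing)
    have "18 * c * 2 ^ (4 * w + 2) \<le> 2 ^ (18 * c) * 2 ^ (4 * w + 2)"
      by (rule mult_right_mono[OF less_imp_le[OF less_exp]]) simp
    also have "\<dots> = 2 ^ (18 * c + (4 * w + 2))" by (simp only: power_add)
    also have "\<dots> \<le> 2 ^ (C * w)"
    proof (rule power_increasing)
      have "18 * c * 1 \<le> 18 * c * w" using w(1) by (rule mult_left_mono) simp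
      then have "18 * c + (4 * w + 2) \<le> 18 * c * w + 6 * w" using w(1) by linarith
      also have "\<dots> = (18 * c + 6) * w" by (simp only: add_mult_distrib)
      also have "\<dots> \<le> C * w" unfolding C by (rule mult_right_mono) simp_all
      finally show "18 * c + (4 * w + 2) \<le> C * w" .
    qed simp
    finally show "18 * c * 2 ^ (4 * w + 2) \<le> 2 ^ (C * w)" .
  qed (use n in auto)
  finally have le: "(n + 2) ^ (2 ^ (4 * w + 2) * 9 * c) \<le> X" .
  have "2 * (2 * w) = 4 * w" by simp
  then have "(((n + 2) ^ 2 ^ (2 * (2 * w) + 2)) ^ 9) ^ c \<le> X" using le by (simp only: power_mult)
  then have "t \<le> 144 * X + 60 * u + 103 * X + X" using t nX n by linarith
  also have "\<dots> = 248 * X + 60 * u" by simp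
  also have "\<dots> \<le> C * X + C * u" unfolding C by (intro add_mono mult_right_mono) simp_all
  finally show ?thesis unfolding X_def by (simp only: add_mult_distrib2)
qed

text \<open>\<open>runs\<close> starts at function 0, so the expression is put in front and all
  calls move by one.\<close>

lemma implT_runs:
  assumes "implT F T"
  shows "\<exists>P. \<forall>x. \<exists>t\<le>T x. runs P x (F x) t"
proof -
  obtain P e where *: "\<And>x. \<exists>t\<le>T x. eval P [x] e (F x) t" using assms unfolding implT_def by blast
  define Q where "Q = [shift 1 e] @ map (shift 1) P"
  have "\<exists>t\<le>T x. runs Q x (F x) t" for x
  proof -
    obtain t where t: "t \<le> T x" "eval P [x] e (F x) t" using * by blast
    have "eval Q [x] (shift 1 e) (F x) t"
      using eval_shift(1)[OF t(2), of "[shift 1 e]"] unfolding Q_def by simp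
    then show ?thesis using t(1) unfolding runs_def Q_def by auto
  qed
  then show ?thesis by blast
qed

text \<open>Provides \<open>n \<ge> 1\<close>: the empty graph has no decomposition.\<close>

lemma rbd_nonempty: "branching T \<Longrightarrow> leaf_labels T \<noteq> []"
proof (induction T)
  case (Node ts)
  then obtain t ts' where "ts = t # ts'" using branching_Node_children by (cases ts) auto
  then show ?case using Node branching_Node by auto
qed simp

theorem mainTheorem1:
  "\<exists>(P :: prog) (c :: nat). \<forall>(n :: nat) (E :: nat set set) (T :: nat rtree) (w :: nat) (k :: nat).
     simple_graph {..<n} E \<longrightarrow>
     rooted_branch_decomposition {..<n} T \<longrightarrow>
     module_width {..<n} E T = w \<longrightarrow>
     (\<exists>t. runs P (enc_instance n E T k) (enc_bool (\<exists>C. b_coloring {..<n} E k C)) t \<and>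
          t \<le> c * (n ^ (2 ^ (c * w)) + num_unary T))"
proof -
  obtain TS where TS: "implT solve TS" "pb solve_bound TS" using fpr_solve by (rule fprE)
  obtain c where c: "\<And>x m. 2 \<le> m \<Longrightarrow> solve_bound x m \<Longrightarrow> TS x \<le> m ^ c" using TS(2) unfolding pb_def by blast
  define C :: nat where "C = 1000 + 18 * c + 3 ^ (576 * c)"
  obtain P where P: "\<And>x. \<exists>t\<le>(ctime (fst_snd x) + 24 * length (lst (val_fst x)) + 100) + TS (preprocess x) + 3.
      runs P x (solve (preprocess x)) t"
    using implT_runs[OF implT_comp[OF TS(1) implT_preprocess]] by blast
  show ?thesis
  proof (rule exI[of _ P], rule exI[of _ C], intro allI impI)
    fix n :: nat and E T w k
    assume E: "simple_graph {..<n} E" and T: "rooted_branch_decomposition {..<n} T"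
      and w: "module_width {..<n} E T = w"
    have "set (leaf_labels T) = {..<n}" using T unfolding rooted_branch_decomposition_def by blast
    then have "1 \<le> n" using rbd_nonempty[OF rbd_branching[OF T]] by (cases n) auto
    then interpret graph_instance n E k using E by unfold_locales
    let ?x = "enc_instance n E T k"
    let ?m = "((n + 2) ^ 2 ^ (2 * (2 * w) + 2)) ^ 9"
    obtain t where t: "t \<le> (ctime (fst_snd ?x) + 24 * length (lst (val_fst ?x)) + 100) + TS (preprocess ?x) + 3"
      "runs P ?x (solve (preprocess ?x)) t" using P[of ?x] by blast
    have "2 \<le> ?m"
    proof -
      have "(n + 2) ^ 1 \<le> (n + 2) ^ (2 ^ (2 * (2 * w) + 2) * 9)" by (intro power_increasing) auto
      also have "\<dots> = ?m" by (rule power_mult)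
      finally show ?thesis by simp
    qed
    then have "TS (preprocess ?x) \<le> ?m ^ c"
      using c solve_bound_inst[OF T] unfolding preprocess_instance[OF T] w by blast
    \<comment> \<open>\<open>103\<close> is the \<open>100\<close> of \<open>preprocess\<close> plus
      the \<open>3\<close> for composing it with \<open>solve\<close>.\<close>
    then have "t \<le> 144 * n + 60 * num_unary T + 103 + ?m ^ c"
      using t(1) ctime_instance[OF T] by linarith
    then have "t \<le> C * (n ^ (2 ^ (C * w)) + num_unary T)"
      using module_width_pos[OF T] module_width_le_n[OF T] n_pos
      by (intro run_time_bound[of n w]) (auto simp: w C_def)
    then show "\<exists>t. runs P ?x (enc_bool (\<exists>C. b_coloring {..<n} E k C)) t \<and>
          t \<le> C * (n ^ (2 ^ (C * w)) + num_unary T)"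
      using t(2) unfolding preprocess_instance[OF T] solve_inst[OF T] by blast
  qed
qed

end
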